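(* Let $\lambda\le\kappa$ be two infinite cardinals. Then the universal minimal flow of the group of automorphisms of the structure $\mathcal{P}^{\kappa}_{\lambda}$ is the space $\mathrm{NO}(\mathcal{P}^{\kappa}_{\lambda})$ of normal orderings of $\mathcal{P}^{\kappa}_{\lambda}$.
   Context: $\mathcal{P}(\kappa)/[\kappa]^{<\lambda}$ is the quotient of the power set Boolean algebra of $\kappa$ by the ideal $[\kappa]^{<\lambda}$ of subsets of cardinality less than $\lambda$; $[X]$ denotes the class of $X\subseteq\kappa$. For each cardinal $\mu$ with $\lambda\le\mu\le\kappa$ let $P_\mu$ be the set of classes $[X]$ with $|X|\le\mu$ (so $P_\kappa$ is the whole algebra and imposes no condition). $\mathcal{P}^{\kappa}_{\lambda}=(\mathcal{P}(\kappa)/[\kappa]^{<\lambda},\,P_\mu:\mu\in[\lambda,\kappa])$ is the Boolean algebra expanded by these unary predicates; its automorphisms are the Boolean algebra automorphisms preserving every $P_\mu$. Automorphism groups carry the topology of pointwise convergence (underlying structure discrete). A linear ordering $<$ of the atoms of a finite subalgebra $A$ of $\mathcal{P}^{\kappa}_{\lambda}$ is proper if $a<b$ whenever $a,b$ are atoms of $A$ and for some $\mu$ we have $a\in P_\mu$ and $b\notin P_\mu$. A linear ordering of $A$ is natural if it is the antilexicographical extension of a proper ordering $a_1<\dots<a_n$ of its atoms: for distinct $x,y\in A$, $x<y$ iff, for the largest $m$ such that exactly one of $a_m\le x$, $a_m\le y$ holds (with $\le$ the Boolean order), we have $a_m\le y$. $\mathrm{NO}(\mathcal{P}^{\kappa}_{\lambda})$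 is the set of all linear orderings of $\mathcal{P}^{\kappa}_{\lambda}$ whose restriction to every finite subalgebra $A$ is natural, with the subspace topology from $2^{\mathcal{P}^{\kappa}_{\lambda}\times\mathcal{P}^{\kappa}_{\lambda}}$ and the action $a\,(g{<})\,b\iff g^{-1}a<g^{-1}b$ of $G=\mathrm{Aut}(\mathcal{P}^{\kappa}_{\lambda})$. For a topological group $G$, a $G$-flow is a continuous action of $G$ on a compact Hausdorff space; the universal minimal flow is the (unique up to isomorphism of $G$-flows) minimal $G$-flow having every minimal $G$-flow as a factor. "Is" means isomorphic as $G$-flows. *)

theory Defs
  imports "HOL-Analysis.Analysis" "HOL-Algebra.Group_Action"
begin

unbundle cardinal_syntax

section \<open>Flows of topological groups\<close>

definition topological_group :: "('g, 'm) monoid_scheme \<Rightarrow> 'g topology \<Rightarrow> bool" where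
  "topological_group G T \<longleftrightarrow>
     group G \<and> topspace T = carrier G \<and>
     continuous_map (prod_topology T T) T (\<lambda>(g, h). g \<otimes>\<^bsub>G\<^esub> h) \<and>
     continuous_map T T (\<lambda>g. inv\<^bsub>G\<^esub> g)"

definition flow ::
  "('g, 'm) monoid_scheme \<Rightarrow> 'g topology \<Rightarrow> 'x topology \<Rightarrow> ('g \<Rightarrow> 'x \<Rightarrow> 'x) \<Rightarrow> bool" where
  "flow G T X \<phi> \<longleftrightarrow>
     topological_group G T \<and> compact_space X \<and> Hausdorff_space X \<and>
     group_action G (topspace X) \<phi> \<and>
     continuous_map (prod_topology T X) X (\<lambda>(g, x). \<phi> g x)"

definition minimal_flow ::
  "('g, 'm) monoid_scheme \<Rightarrow> 'g topology \<Rightarrow> 'x topology \<Rightarrow> ('g \<Rightarrow> 'x \<Rightarrow> 'x) \<Rightarrow> bool" where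
  "minimal_flow G T X \<phi> \<longleftrightarrow>
     flow G T X \<phi> \<and> topspace X \<noteq> {} \<and>
     (\<forall>C. closedin X C \<and> C \<noteq> {} \<and> (\<forall>g\<in>carrier G. \<phi> g ` C \<subseteq> C) \<longrightarrow> C = topspace X)"

definition flow_factor ::
  "('g, 'm) monoid_scheme \<Rightarrow> 'x topology \<Rightarrow> ('g \<Rightarrow> 'x \<Rightarrow> 'x) \<Rightarrow>
   'y topology \<Rightarrow> ('g \<Rightarrow> 'y \<Rightarrow> 'y) \<Rightarrow> bool" where
  "flow_factor G X \<phi> Y \<psi> \<longleftrightarrow>
     (\<exists>f. continuous_map X Y f \<and> f ` topspace X = topspace Y \<and>
          (\<forall>g\<in>carrier G. \<forall>x\<in>topspace X. f (\<phi> g x) = \<psi> g (f x)))"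

text \<open>
  HOL cannot quantify over types inside a formula, so the type carrying the competing minimal
  flows is a parameter. A theorem in which that type is a free type variable speaks about all
  minimal flows.
\<close>

definition universal_minimal_flow ::
  "'y itself \<Rightarrow> ('g, 'm) monoid_scheme \<Rightarrow> 'g topology \<Rightarrow> 'x topology \<Rightarrow>
   ('g \<Rightarrow> 'x \<Rightarrow> 'x) \<Rightarrow> bool" where
  "universal_minimal_flow ty G T X \<phi> \<longleftrightarrow>
     minimal_flow G T X \<phi> \<and>
     (\<forall>(Y :: 'y topology) \<psi>. minimal_flow G T Y \<psi> \<longrightarrow> flow_factor G X \<phi> Y \<psi>)"


section \<open>Boolean algebras on a carrier set\<close>

record 'e bool_alg = "'e partial_object" +
  bjoin :: "'e \<Rightarrow> 'e \<Rightarrow> 'e"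
  bmeet :: "'e \<Rightarrow> 'e \<Rightarrow> 'e"
  bcompl :: "'e \<Rightarrow> 'e"
  bbot :: 'e
  btop :: 'e

definition bool_le :: "('e, 'm) bool_alg_scheme \<Rightarrow> 'e \<Rightarrow> 'e \<Rightarrow> bool" where
  "bool_le B x y \<longleftrightarrow> bmeet B x y = x"

definition finite_subalgebra :: "('e, 'm) bool_alg_scheme \<Rightarrow> 'e set \<Rightarrow> bool" where
  "finite_subalgebra B A \<longleftrightarrow>
     finite A \<and> A \<subseteq> carrier B \<and> bbot B \<in> A \<and> btop B \<in> A \<and>
     (\<forall>x\<in>A. bcompl B x \<in> A) \<and>
     (\<forall>x\<in>A. \<forall>y\<in>A. bjoin B x y \<in> A \<and> bmeet B x y \<in> A)"

definition atoms_of :: "('e, 'm) bool_alg_scheme \<Rightarrow> 'e set \<Rightarrow> 'e set" where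
  "atoms_of B A =
     {a \<in> A. a \<noteq> bbot B \<and> (\<forall>b\<in>A. bool_le B b a \<longrightarrow> b = bbot B \<or> b = a)}"

definition bool_automorphisms :: "('e, 'm) bool_alg_scheme \<Rightarrow> ('e \<Rightarrow> 'e) set" where
  "bool_automorphisms B =
     {f \<in> Bij (carrier B).
        f (bbot B) = bbot B \<and> f (btop B) = btop B \<and>
        (\<forall>x\<in>carrier B. f (bcompl B x) = bcompl B (f x)) \<and>
        (\<forall>x\<in>carrier B. \<forall>y\<in>carrier B.
           f (bjoin B x y) = bjoin B (f x) (f y) \<and> f (bmeet B x y) = bmeet B (f x) (f y))}"


section \<open>The quotient of the power set algebra and its predicates\<close>

text \<open>
  Cardinals are represented by cardinal orders; the cardinal \<^term>\<open>kap\<close> has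
  \<^term>\<open>Field kap\<close> as its underlying set.
\<close>

definition small_diff :: "'b rel \<Rightarrow> 'a rel \<Rightarrow> 'a set rel" where
  "small_diff lam kap =
     {(X, Y). X \<subseteq> Field kap \<and> Y \<subseteq> Field kap \<and> |sym_diff X Y| <o lam}"

definition cls :: "'b rel \<Rightarrow> 'a rel \<Rightarrow> 'a set \<Rightarrow> 'a set set" where
  "cls lam kap X = small_diff lam kap `` {X}"

text \<open>
  The operations are defined on representatives; each union below ranges over equal classes.
\<close>

definition pow_quot :: "'b rel \<Rightarrow> 'a rel \<Rightarrow> 'a set set bool_alg" where
  "pow_quot lam kap =
     \<lparr>carrier = Pow (Field kap) // small_diff lam kap,
      bjoin = (\<lambda>x y. \<Union>X\<in>x. \<Union>Y\<in>y. cls lam kap (X \<union> Y)),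
      bmeet = (\<lambda>x y. \<Union>X\<in>x. \<Union>Y\<in>y. cls lam kap (X \<inter> Y)),
      bcompl = (\<lambda>x. \<Union>X\<in>x. cls lam kap (Field kap - X)),
      bbot = cls lam kap {},
      btop = cls lam kap (Field kap)\<rparr>"

text \<open>
  Every cardinal below \<^term>\<open>kap\<close> is isomorphic to a cardinal order on the type
  of the elements of \<^term>\<open>kap\<close>, so it is enough to let the indices range over that type.
\<close>

definition cards_between :: "'b rel \<Rightarrow> 'a rel \<Rightarrow> 'a rel set" where
  "cards_between lam kap = {mu. Card_order mu \<and> lam \<le>o mu \<and> mu \<le>o kap}"

definition level :: "'b rel \<Rightarrow> 'a rel \<Rightarrow> 'a rel \<Rightarrow> 'a set set set" where
  "level lam kap mu = {cls lam kap X | X. X \<subseteq> Field kap \<and> |X| \<le>o mu}"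

definition automorphisms :: "'b rel \<Rightarrow> 'a rel \<Rightarrow> ('a set set \<Rightarrow> 'a set set) set" where
  "automorphisms lam kap =
     {f \<in> bool_automorphisms (pow_quot lam kap).
        \<forall>mu\<in>cards_between lam kap. \<forall>x\<in>carrier (pow_quot lam kap).
          f x \<in> level lam kap mu \<longleftrightarrow> x \<in> level lam kap mu}"

definition Aut :: "'b rel \<Rightarrow> 'a rel \<Rightarrow> ('a set set \<Rightarrow> 'a set set) monoid" where
  "Aut lam kap =
     BijGroup (carrier (pow_quot lam kap)) \<lparr>carrier := automorphisms lam kap\<rparr>"

definition Aut_topology :: "'b rel \<Rightarrow> 'a rel \<Rightarrow> ('a set set \<Rightarrow> 'a set set) topology" where
  "Aut_topology lam kap =
     subtopology
       (product_topology (\<lambda>_. discrete_topology (carrier (pow_quot lam kap)))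
          (carrier (pow_quot lam kap)))
       (carrier (Aut lam kap))"


section \<open>Natural orderings\<close>

text \<open>
  A linear ordering of the finitely many atoms is given by the list enumerating them
  increasingly.
\<close>

definition proper_ordering ::
  "'b rel \<Rightarrow> 'a rel \<Rightarrow> 'a set set set \<Rightarrow> 'a set set list \<Rightarrow> bool" where
  "proper_ordering lam kap A as \<longleftrightarrow>
     distinct as \<and> set as = atoms_of (pow_quot lam kap) A \<and>
     (\<forall>i<length as. \<forall>j<length as.
        (\<exists>mu\<in>cards_between lam kap. as ! i \<in> level lam kap mu \<and> as ! j \<notin> level lam kap mu)
        \<longrightarrow> i < j)"

definition antilex :: "('e, 'm) bool_alg_scheme \<Rightarrow> 'e list \<Rightarrow> 'e \<Rightarrow> 'e \<Rightarrow> bool" where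
  "antilex B as x y \<longleftrightarrow>
     x \<noteq> y \<and>
     bool_le B (as ! Max {m. m < length as \<and> bool_le B (as ! m) x \<noteq> bool_le B (as ! m) y}) y"

text \<open>
  A binary relation on a set \<open>P\<close> is a point of the power \<open>2\<close> to the
  \<open>P \<times> P\<close>, i.e. an extensional Boolean function on pairs.
\<close>

definition natural_on ::
  "'b rel \<Rightarrow> 'a rel \<Rightarrow> 'a set set set \<Rightarrow> ('a set set \<times> 'a set set \<Rightarrow> bool) \<Rightarrow> bool" where
  "natural_on lam kap A r \<longleftrightarrow>
     (\<exists>as. proper_ordering lam kap A as \<and>
        (\<forall>x\<in>A. \<forall>y\<in>A. r (x, y) \<longleftrightarrow> antilex (pow_quot lam kap) as x y))"

definition NO :: "'b rel \<Rightarrow> 'a rel \<Rightarrow> ('a set set \<times> 'a set set \<Rightarrow> bool) set" where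
  "NO lam kap =
     (let P = carrier (pow_quot lam kap) in
      {r \<in> extensional (P \<times> P).
         strict_linear_order_on P {(x, y) \<in> P \<times> P. r (x, y)} \<and>
         (\<forall>A. finite_subalgebra (pow_quot lam kap) A \<longrightarrow> natural_on lam kap A r)})"

definition NO_topology ::
  "'b rel \<Rightarrow> 'a rel \<Rightarrow> ('a set set \<times> 'a set set \<Rightarrow> bool) topology" where
  "NO_topology lam kap =
     subtopology
       (product_topology (\<lambda>_. discrete_topology UNIV)
          (carrier (pow_quot lam kap) \<times> carrier (pow_quot lam kap)))
       (NO lam kap)"

definition NO_action ::
  "'b rel \<Rightarrow> 'a rel \<Rightarrow> ('a set set \<Rightarrow> 'a set set) \<Rightarrow>
   ('a set set \<times> 'a set set \<Rightarrow> bool) \<Rightarrow> ('a set set \<times> 'a set set \<Rightarrow> bool)" where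
  "NO_action lam kap g =
     (\<lambda>r\<in>NO lam kap. \<lambda>(x, y)\<in>carrier (pow_quot lam kap) \<times> carrier (pow_quot lam kap).
        r ((inv\<^bsub>Aut lam kap\<^esub> g) x, (inv\<^bsub>Aut lam kap\<^esub> g) y))"

end

theory Submission
  imports Defs
begin

text \<open>
  Two facts about the automorphism group \<open>G\<close> carry the proof.

  The first is homogeneity. The atoms of a finite subalgebra are represented by the pieces of a
  finite partition of \<open>\<kappa>\<close> into sets of size at least \<open>\<lambda>\<close>, and bijections between pieces of equal
  size add up to a permutation of \<open>\<kappa>\<close>. So every size preserving isomorphism between finite
  subalgebras extends to an automorphism (\<open>homogeneous\<close>). Since moreover every nondecreasing finite
  sequence of sizes that ends with \<open>\<kappa>\<close> is realized in every natural ordering, the orbit of each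
  natural ordering is dense, and the flow of natural orderings is minimal (\<open>NO_minimal_flow\<close>).

  The second is the Ramsey property of naturally ordered finite subalgebras
  (\<open>ramsey_for_orders\<close>). The atoms of an ordered subalgebra are listed from the largest down. An
  embedding into a larger one is then a word that tells for each atom of the larger algebra in
  which atom of the smaller one it lies. In the antilexicographical ordering two disjoint
  elements are compared by their largest atoms, and as the ordering is proper these also determine
  the sizes. Hence a word encodes an embedding that preserves sizes and order exactly if its letters
  first occur in their order and each of them first occurs at an atom of the right size. These are
  the parameter words of Graham and Rothschild with an additional labelling, and
  \<open>ramsey_embeddings\<close> extends their theorem to them, by induction on the number of letters
  with the Hales--Jewett theorem as the basis.

  To map the natural orderings onto a minimal flow \<open>Y\<close>, take a continuous real function \<open>f\<close>
  on \<open>Y\<close>. By compactness there is a finite subalgebra \<open>A\<close> such that automorphisms that fix \<open>A\<close>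
  pointwise change the values of \<open>f\<close> by less than \<open>\<epsilon>\<close>. Thus \<open>f (g\<inverse> y)\<close> is, up to \<open>\<epsilon>\<close>, a colour
  of the copy \<open>g A\<close> of \<open>A\<close>. By the Ramsey property a pair \<open>(r, y)\<close> of a natural ordering and a point of
  \<open>Y\<close> can be moved within its orbit such that for the copies inside any given finite subalgebra this
  colour depends only on the ordering that \<open>r\<close> induces on the copy. Compactness yields one pair
  \<open>(r, y)\<close> for which this holds for all copies and for all \<open>f\<close> and \<open>\<epsilon>\<close> (\<open>coherent_point\<close>).
  The closure of the orbit of this pair in the product of the two flows is then the graph of a function.
  The function is defined everywhere because orbits of orderings are dense, continuous because
  \<open>Y\<close> is compact, and onto because \<open>Y\<close> is minimal (\<open>NO_maps_onto\<close>).
\<close>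

section \<open>Embeddings of labelled patterns as words\<close>

text \<open>
  A word over the letters below \<open>a\<close> and the parameters \<open>a, a + 1, ...\<close> encodes an embedding of
  the pattern \<open>p\<close> into the pattern \<open>c\<close>: the parameters first occur in their order, and the
  parameter \<open>a + i\<close> first occurs where \<open>c\<close> has the label \<open>p ! i\<close>. From its first occurrence on
  a parameter is an ordinary letter, so the alphabet grows along the word.
\<close>

inductive emb :: "nat \<Rightarrow> 'l list \<Rightarrow> 'l list \<Rightarrow> nat list \<Rightarrow> bool" where
  emb_Nil: "emb a [] [] []"
| emb_old: "x < a \<Longrightarrow> emb a p c w \<Longrightarrow> emb a p (l # c) (x # w)"
| emb_new: "emb (Suc a) p c w \<Longrightarrow> emb a (l # p) (l # c) (a # w)"

inductive_cases emb_ConsE: "emb a p (l # c) w"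
inductive_cases emb_NilE: "emb a p [] w"

lemma emb_Cons_cases:
  assumes "emb a p (l # c) w"
  obtains (old) y u where "w = y # u" "y < a" "emb a p c u"
    | (new) q u where "w = a # u" "p = l # q" "emb (Suc a) q c u"
  using assms by (auto elim: emb_ConsE)

text \<open>
  Substitution of \<open>u\<close> for the parameters of \<open>v\<close>; on embeddings it is composition.
\<close>

definition plug :: "nat \<Rightarrow> nat list \<Rightarrow> nat list \<Rightarrow> nat list" where
  "plug a u v = map ((!) ([0..<a] @ u)) v"

lemma emb_length: "emb a p c w \<Longrightarrow> length w = length c"
  by (induction rule: emb.induct) auto

lemma emb_letters: "emb a p c w \<Longrightarrow> set w \<subseteq> {..<a + length p}"
  by (induction rule: emb.induct) auto

text \<open>
  The list \<open>s\<close> contains the values of the letters that \<open>v\<close> has introduced so far. It has to be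
  arbitrary because it grows during the induction.
\<close>

lemma emb_subst:
  assumes "emb b d c v" "length s = b" "set s \<subseteq> {..<a}" "emb a p d u"
  shows "emb a p c (map ((!) (s @ u)) v)"
  using assms
proof (induction arbitrary: s u a p rule: emb.induct)
  case (emb_Nil a')
  then show ?case by (auto elim: emb_NilE intro: emb.intros)
next
  case (emb_old x b d c v l)
  have "s ! x < a" using emb_old.hyps(1) emb_old.prems(1,2) nth_mem[of x s] by (metis lessThan_iff subsetD)
  then show ?case using emb_old by (auto simp: nth_append intro: emb.intros)
next
  case (emb_new b d c v l)
  from emb_new.prems(3) show ?case
  proof (cases rule: emb_Cons_cases)
    case (old y u')
    have "emb a p c (map ((!) ((s @ [y]) @ u')) v)"
      using emb_new.prems old by (intro emb_new.IH) auto
    then have "emb a p (l # c) (y # map ((!) (s @ y # u')) v)"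
      using old by (auto intro: emb.intros)
    moreover have "(s @ y # u') ! b = y" using emb_new.prems(1) by auto
    ultimately show ?thesis using old by simp
  next
    case (new p' u')
    have "emb (Suc a) p' c (map ((!) ((s @ [a]) @ u')) v)"
      using emb_new.prems new by (intro emb_new.IH) auto
    then have "emb a (l # p') (l # c) (a # map ((!) (s @ a # u')) v)"
      by (auto intro: emb.intros)
    moreover have "(s @ a # u') ! b = a" using emb_new.prems(1) by auto
    ultimately show ?thesis using new by simp
  qed
qed

lemma emb_plug:
  "emb a d c v \<Longrightarrow> emb a p d u \<Longrightarrow> emb a p c (plug a u v)"
  unfolding plug_def by (rule emb_subst) auto

lemma plug_plug:
  assumes "set v \<subseteq> {..<a + length u'}"
  shows "plug a u (plug a u' v) = plug a (plug a u u') v"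
  using assms by (auto simp: plug_def nth_append)

lemma length_plug [simp]: "length (plug a u v) = length v"
  by (simp add: plug_def)

lemma plug_letters:
  assumes "set v \<subseteq> {..<a + length u}" "set u \<subseteq> {..<b}" "a \<le> b"
  shows "set (plug a u v) \<subseteq> {..<b}"
proof -
  have "([0..<a] @ u) ! x < b" if "x < a + length u" for x
  proof (cases "x < a")
    case False
    then have "u ! (x - a) \<in> set u" using that by (intro nth_mem) auto
    with False assms show ?thesis by (auto simp: nth_append)
  qed (use assms in \<open>auto simp: nth_append\<close>)
  then show ?thesis using assms by (auto simp: plug_def)
qed

text \<open>
  Renames the letters from \<open>a\<close> on, so that \<open>j\<close> new letters fit in below them.
\<close>

definition shift :: "nat \<Rightarrow> nat \<Rightarrow> nat list \<Rightarrow> nat list" where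
  "shift a j w = map (\<lambda>x. if x < a then x else x + j) w"

lemma length_shift [simp]: "length (shift a j w) = length w"
  by (simp add: shift_def)

lemma emb_shift_gen: "emb a d c v \<Longrightarrow> b \<le> a \<Longrightarrow> emb (a + j) d c (shift b j v)"
proof (induction rule: emb.induct)
  case (emb_new a p c w l)
  then have "emb (Suc (a + j)) p c (shift b j w)" by simp
  then show ?case using emb_new.prems by (auto simp: shift_def intro: emb.intros)
qed (auto simp: shift_def intro: emb.intros)

lemma emb_shift: "emb a d c v \<Longrightarrow> emb (a + j) d c (shift a j v)"
  by (rule emb_shift_gen) auto

lemma emb_append:
  "emb a d1 c1 v1 \<Longrightarrow> emb (a + length d1) d2 c2 v2 \<Longrightarrow> emb a (d1 @ d2) (c1 @ c2) (v1 @ v2)"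
  by (induction arbitrary: v2 rule: emb.induct) (auto intro: emb.intros)

lemma emb_block:
  assumes "emb a [l] c1 v1" "emb a d c2 v2"
  shows "emb a (l # d) (c1 @ c2) (v1 @ shift a 1 v2)"
  using emb_append[OF assms(1), of d c2 "shift a 1 v2"] emb_shift[OF assms(2), of 1] by simp

lemma plug_block:
  assumes "set v1 \<subseteq> {..a}" "set v2 \<subseteq> {..<a + length u}"
  shows "plug a (y # u) (v1 @ shift a 1 v2) = plug a [y] v1 @ plug a u v2"
  using assms by (auto simp: plug_def shift_def nth_append subset_iff)

lemma plug_Suc: "plug (Suc a) u v = plug a (a # u) v"
  by (simp add: plug_def)

lemma emb_constants: "emb a [] c w \<longleftrightarrow> length w = length c \<and> set w \<subseteq> {..<a}"
proof
  show "emb a [] c w \<Longrightarrow> length w = length c \<and> set w \<subseteq> {..<a}"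
    using emb_length[of a "[]" c w] emb_letters[of a "[]" c w] by auto
  show "length w = length c \<and> set w \<subseteq> {..<a} \<Longrightarrow> emb a [] c w"
    by (induction c arbitrary: w) (auto intro: emb.intros simp: length_Suc_conv)
qed

lemma emb_id: "emb a d d [a..<a + length d]"
proof (induction d arbitrary: a)
  case (Cons l d)
  have "[a..<a + length (l # d)] = a # [Suc a..<Suc a + length d]"
    using upt_conv_Cons[of a "a + length (l # d)"] by (simp del: upt_Suc)
  then show ?case using emb_new[OF Cons[of "Suc a"]] by simp
qed (auto intro: emb.intros)

text \<open>
  Codes colourings by functions on a finite set as colourings by numbers. The code is fixed before
  the functions are, because the length of the words in a Ramsey statement may depend on the number of
  colours only.
\<close>

definition colour_code :: "'x set \<Rightarrow> nat \<Rightarrow> (('x \<Rightarrow> nat) \<Rightarrow> nat) \<Rightarrow> nat \<Rightarrow> bool" where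
  "colour_code S r enc R \<longleftrightarrow>
     (\<forall>f. (\<forall>x\<in>S. f x < r) \<longrightarrow> enc f < R) \<and>
     (\<forall>f g. (\<forall>x\<in>S. f x < r) \<longrightarrow> (\<forall>x\<in>S. g x < r) \<longrightarrow> enc f = enc g \<longrightarrow> (\<forall>x\<in>S. f x = g x))"

lemma colour_code_exists:
  assumes "finite S"
  shows "\<exists>enc R. colour_code S r enc R"
proof -
  define F where "F = (S \<rightarrow>\<^sub>E {..<r})"
  have "finite F" unfolding F_def using assms by (intro finite_PiE) auto
  then obtain h :: "('a \<Rightarrow> nat) \<Rightarrow> nat" where h: "bij_betw h F {0..<card F}"
    using ex_bij_betw_finite_nat by blast
  have F: "restrict f S \<in> F" if "\<forall>x\<in>S. f x < r" for f
    using that by (auto simp: F_def)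
  have "colour_code S r (\<lambda>f. h (restrict f S)) (card F)"
    unfolding colour_code_def
  proof (intro conjI allI impI ballI)
    fix f assume "\<forall>x\<in>S. f x < r"
    with F h show "h (restrict f S) < card F" by (auto dest: bij_betwE)
  next
    fix f g x
    assume f: "\<forall>x\<in>S. f x < r" and g: "\<forall>x\<in>S. g x < r"
      and e: "h (restrict f S) = h (restrict g S)" and x: "x \<in> S"
    have "restrict f S = restrict g S"
      using e h F[OF f] F[OF g] by (auto simp: bij_betw_def inj_on_def)
    then show "f x = g x" using x by (metis restrict_apply')
  qed
  then show ?thesis by blast
qed

lemma colour_code_bound: "colour_code S r enc R \<Longrightarrow> (\<And>x. f x < r) \<Longrightarrow> enc f < R"
  by (simp add: colour_code_def)

lemma colour_code_eqD:
  "colour_code S r enc R \<Longrightarrow> enc f = enc g \<Longrightarrow> x \<in> S \<Longrightarrow> (\<And>x. f x < r) \<Longrightarrow> (\<And>x. g x < r)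
     \<Longrightarrow> f x = g x"
  by (simp add: colour_code_def)

text \<open>
  The common form of the Ramsey statements below: \<open>\<Phi> \<gamma> v\<close> says that \<open>\<gamma>\<close> is
  constant in some respect on the subspace \<open>v\<close>, while \<open>c\<close> serves all colourings with \<open>r\<close> colours.
\<close>

definition forces ::
  "nat \<Rightarrow> 'l list \<Rightarrow> 'l list \<Rightarrow> nat \<Rightarrow> ((nat list \<Rightarrow> nat) \<Rightarrow> nat list \<Rightarrow> bool) \<Rightarrow> bool" where
  "forces a d c r \<Phi> \<longleftrightarrow> (\<forall>\<gamma>. (\<forall>w. \<gamma> w < r) \<longrightarrow> (\<exists>v. emb a d c v \<and> \<Phi> \<gamma> v))"

lemma forcesI:
  "(\<And>\<gamma>. \<forall>w. \<gamma> w < r \<Longrightarrow> \<exists>v. emb a d c v \<and> \<Phi> \<gamma> v) \<Longrightarrow> forces a d c r \<Phi>"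
  by (simp add: forces_def)

lemma forcesD:
  "forces a d c r \<Phi> \<Longrightarrow> \<forall>w. \<gamma> w < r \<Longrightarrow> \<exists>v. emb a d c v \<and> \<Phi> \<gamma> v"
  by (simp add: forces_def)

section \<open>The Hales--Jewett theorem\<close>

definition const_line :: "nat \<Rightarrow> (nat list \<Rightarrow> nat) \<Rightarrow> nat list \<Rightarrow> bool" where
  "const_line a \<gamma> v \<longleftrightarrow> (\<forall>x<a. \<forall>y<a. \<gamma> (plug a [x] v) = \<gamma> (plug a [y] v))"

lemma const_lineD: "const_line a \<gamma> v \<Longrightarrow> x < a \<Longrightarrow> y < a \<Longrightarrow> \<gamma> (plug a [x] v) = \<gamma> (plug a [y] v)"
  unfolding const_line_def by blast

definition hales_jewett :: "nat \<Rightarrow> bool" where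
  "hales_jewett a \<longleftrightarrow> (\<forall>r. \<exists>N. forces a [()] (replicate N ()) r (const_line a))"

lemma emb_relabel: "emb a p c w \<Longrightarrow> emb a (map f p) (map f c) w"
  by (induction rule: emb.induct) (auto intro: emb.intros)

lemma hales_jewett_labelled:
  assumes "hales_jewett a"
  shows "\<exists>N. \<forall>l :: 'l. forces a [l] (replicate N l) r (const_line a)"
proof -
  obtain N where N: "forces a [()] (replicate N ()) r (const_line a)"
    using assms unfolding hales_jewett_def by blast
  have "forces a [l] (replicate N l) r (const_line a)" for l :: 'l
  proof (rule forcesI)
    fix \<gamma> :: "nat list \<Rightarrow> nat" assume "\<forall>w. \<gamma> w < r"
    from forcesD[OF N this] obtain v where v: "emb a [()] (replicate N ()) v" "const_line a \<gamma> v"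
      by blast
    from emb_relabel[OF v(1), of "\<lambda>_. l"] v(2)
    show "\<exists>v. emb a [l] (replicate N l) v \<and> const_line a \<gamma> v" by auto
  qed
  then show ?thesis by blast
qed

lemma finite_words: "finite {w :: nat list. set w \<subseteq> {..<a} \<and> length w = n}"
  and finite_words_le: "finite {w :: nat list. set w \<subseteq> {..<a} \<and> length w \<le> n}"
  by (auto intro: finite_lists_length_eq finite_lists_length_le)

definition insensitive :: "nat \<Rightarrow> nat \<Rightarrow> (nat list \<Rightarrow> nat) \<Rightarrow> nat list \<Rightarrow> bool" where
  "insensitive a n \<gamma> v \<longleftrightarrow>
     (\<forall>y z. length y = n \<longrightarrow> set y \<subseteq> {..<Suc a} \<longrightarrow> set z \<subseteq> {..<Suc a} \<longrightarrow>
        list_all2 (\<lambda>i j. i = j \<or> i < a \<and> j < a) y z \<longrightarrow>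
        \<gamma> (plug (Suc a) y v) = \<gamma> (plug (Suc a) z v))"

lemma insensitiveD:
  "insensitive a n \<gamma> v \<Longrightarrow> length y = n \<Longrightarrow> set y \<subseteq> {..<Suc a} \<Longrightarrow> set z \<subseteq> {..<Suc a} \<Longrightarrow>
     list_all2 (\<lambda>i j. i = j \<or> i < a \<and> j < a) y z \<Longrightarrow>
     \<gamma> (plug (Suc a) y v) = \<gamma> (plug (Suc a) z v)"
  unfolding insensitive_def by blast

text \<open>
  The blocks are chosen one after another. The first block is a line over the first \<open>a\<close>
  letters for the colouring of a word by the function that it induces on all tails, so its
  parameter may be changed below \<open>a\<close> whatever follows. The later blocks serve all values of
  that parameter at once.
\<close>

lemma insensitive_subspace:
  assumes "hales_jewett a"
  shows "\<exists>N. forces (Suc a) (replicate n ()) (replicate N ()) r (insensitive a n)"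
proof (induction n arbitrary: r)
  case 0
  have "emb (Suc a) (replicate 0 ()) (replicate 0 ()) []" by (simp add: emb_Nil)
  moreover have "insensitive a 0 \<gamma> []" for \<gamma> by (simp add: insensitive_def plug_def)
  ultimately show ?case unfolding forces_def by blast
next
  case (Suc n)
  obtain enc R where enc: "colour_code {..<Suc a} r enc R"
    using colour_code_exists[OF finite_lessThan] by blast
  obtain N2 where N2: "forces (Suc a) (replicate n ()) (replicate N2 ()) R (insensitive a n)"
    using Suc.IH[of R] ..
  let ?T = "{w :: nat list. set w \<subseteq> {..<Suc a} \<and> length w = N2}"
  obtain enc' R' where enc': "colour_code ?T r enc' R'"
    using colour_code_exists[OF finite_words] by blast
  obtain N1 where N1: "forces a [()] (replicate N1 ()) R' (const_line a)"
    using hales_jewett_labelled[OF assms, of R', where 'l = unit] by blast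
  have "forces (Suc a) (replicate (Suc n) ()) (replicate (N1 + N2) ()) r (insensitive a (Suc n))"
  proof (rule forcesI)
    fix \<gamma> :: "nat list \<Rightarrow> nat" assume \<gamma>: "\<forall>w. \<gamma> w < r"
    have "\<forall>w. enc' (\<lambda>t. \<gamma> (w @ t)) < R'" using colour_code_bound[OF enc'] \<gamma> by simp
    from forcesD[OF N1 this] obtain v1 where v1: "emb a [()] (replicate N1 ()) v1"
      and same1: "const_line a (\<lambda>w. enc' (\<lambda>t. \<gamma> (w @ t))) v1" by blast
    \<comment> \<open>the same word with its parameter renamed, as \<open>a\<close> is now a letter\<close>
    define w1 where "w1 = shift a 1 v1"
    have w1: "emb (Suc a) [()] (replicate N1 ()) w1"
      using emb_shift[OF v1, of 1] by (simp add: w1_def)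
    have v1l: "set v1 \<subseteq> {..a}" using emb_letters[OF v1] by auto
    have pw1: "plug (Suc a) [x] w1 = plug a [x] v1" for x
      using v1l by (auto simp: w1_def plug_def shift_def nth_append subset_iff)
    have indep: "\<gamma> (plug a [x] v1 @ t) = \<gamma> (plug a [y] v1 @ t)"
      if "x < a" "y < a" "t \<in> ?T" for x y t
      using colour_code_eqD[OF enc', OF const_lineD[OF same1 that(1,2)] that(3)] \<gamma> by simp
    have "\<forall>t. enc (\<lambda>x. \<gamma> (plug a [x] v1 @ t)) < R" using colour_code_bound[OF enc] \<gamma> by simp
    from forcesD[OF N2 this] obtain v2 where v2: "emb (Suc a) (replicate n ()) (replicate N2 ()) v2"
      and same2: "insensitive a n (\<lambda>t. enc (\<lambda>x. \<gamma> (plug a [x] v1 @ t))) v2" by blast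
    have indep2: "\<gamma> (plug a [x] v1 @ plug (Suc a) y v2) = \<gamma> (plug a [x] v1 @ plug (Suc a) z v2)"
      if "x < Suc a" "length y = n" "set y \<subseteq> {..<Suc a}" "set z \<subseteq> {..<Suc a}"
        "list_all2 (\<lambda>i j. i = j \<or> i < a \<and> j < a) y z" for x y z
      using colour_code_eqD[OF enc, OF insensitiveD[OF same2 that(2-5)], of x] that(1) \<gamma> by simp
    let ?v = "w1 @ shift (Suc a) 1 v2"
    have v2l: "set v2 \<subseteq> {..<Suc a + n}" using emb_letters[OF v2] by simp
    have w1l: "set w1 \<subseteq> {..Suc a}" using emb_letters[OF w1] by auto
    have "emb (Suc a) (replicate (Suc n) ()) (replicate (N1 + N2) ()) ?v"
      using emb_block[OF w1 v2] by (simp add: replicate_add)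
    moreover have "\<gamma> (plug (Suc a) y ?v) = \<gamma> (plug (Suc a) z ?v)"
      if len: "length y = Suc n" and yz: "set y \<subseteq> {..<Suc a}" "set z \<subseteq> {..<Suc a}"
        and rel: "list_all2 (\<lambda>i j. i = j \<or> i < a \<and> j < a) y z" for y z
    proof -
      obtain y0 ys where y: "y = y0 # ys" "length ys = n" using len by (auto simp: length_Suc_conv)
      obtain z0 zs where z: "z = z0 # zs" using rel y by (auto simp: list_all2_Cons1)
      have rel': "list_all2 (\<lambda>i j. i = j \<or> i < a \<and> j < a) ys zs"
        and rel0: "y0 = z0 \<or> y0 < a \<and> z0 < a" using rel y z by auto
      have zl: "length zs = n" using rel' y by (auto dest: list_all2_lengthD)
      have py: "plug (Suc a) y ?v = plug a [y0] v1 @ plug (Suc a) ys v2"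
        using plug_block[OF w1l, of v2 ys y0] v2l y by (simp add: pw1)
      have pz: "plug (Suc a) z ?v = plug a [z0] v1 @ plug (Suc a) zs v2"
        using plug_block[OF w1l, of v2 zs z0] v2l z zl by (simp add: pw1)
      have "plug (Suc a) ys v2 \<in> ?T"
        using plug_letters[of v2 "Suc a" ys "Suc a"] v2l y yz emb_length[OF v2] by auto
      then have "\<gamma> (plug a [y0] v1 @ plug (Suc a) ys v2) = \<gamma> (plug a [z0] v1 @ plug (Suc a) ys v2)"
        using rel0 indep by blast
      also have "\<dots> = \<gamma> (plug a [z0] v1 @ plug (Suc a) zs v2)"
        using yz y z rel' by (intro indep2) auto
      finally show ?thesis unfolding py pz .
    qed
    ultimately show "\<exists>v. emb (Suc a) (replicate (Suc n) ()) (replicate (N1 + N2) ()) v \<and>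
        insensitive a (Suc n) \<gamma> v"
      unfolding insensitive_def by blast
  qed
  then show ?case by blast
qed

text \<open>
  Take \<open>r\<close> blocks that are insensitive to changes among the first \<open>a\<close> letters. Of the
  \<open>r + 1\<close> words whose blocks are \<open>a, ..., a, 0, ..., 0\<close> two have the same colour. Letting the
  blocks in which these two differ vary together gives a line on which the letters below
  \<open>a\<close> agree by insensitivity and \<open>0\<close> agrees with \<open>a\<close> by the choice of the two words.
\<close>

lemma hales_jewett_Suc:
  assumes "hales_jewett a"
  shows "hales_jewett (Suc a)"
  unfolding hales_jewett_def
proof
  fix r
  obtain N where N: "forces (Suc a) (replicate r ()) (replicate N ()) r (insensitive a r)"
    using insensitive_subspace[OF assms, of r r] ..
  have "forces (Suc a) [()] (replicate N ()) r (const_line (Suc a))"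
  proof (rule forcesI)
    fix \<gamma> :: "nat list \<Rightarrow> nat" assume \<gamma>: "\<forall>w. \<gamma> w < r"
    from forcesD[OF N this] obtain v
      where v: "emb (Suc a) (replicate r ()) (replicate N ()) v" and insens: "insensitive a r \<gamma> v"
      by blast
    define st where "st i = replicate i a @ replicate (r - i) 0" for i
    have "\<not> inj_on (\<lambda>i. \<gamma> (plug (Suc a) (st i) v)) {..r}"
    proof
      assume "inj_on (\<lambda>i. \<gamma> (plug (Suc a) (st i) v)) {..r}"
      then have "card {..r} \<le> card {..<r}" using \<gamma> by (intro card_inj_on_le) auto
      then show False by simp
    qed
    then obtain i j where ij: "i < j" "j \<le> r"
      "\<gamma> (plug (Suc a) (st i) v) = \<gamma> (plug (Suc a) (st j) v)"
      unfolding inj_on_def by (metis atMost_iff linorder_neqE_nat)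
    define ln where "ln x = replicate i a @ replicate (j - i) x @ replicate (r - j) 0" for x
    have ln: "emb (Suc a) [()] (replicate r ()) (ln (Suc a))"
    proof -
      have 1: "emb (Suc a) [] (replicate i ()) (replicate i a)"
        by (auto simp: emb_constants)
      have "emb (Suc (Suc a)) [] (replicate (j - i - 1) ()) (replicate (j - i - 1) (Suc a))"
        by (auto simp: emb_constants)
      then have 2: "emb (Suc a) [()] (replicate (j - i) ()) (replicate (j - i) (Suc a))"
        using ij(1) emb_new[of "Suc a" "[]" "replicate (j - i - 1) ()" "replicate (j - i - 1) (Suc a)" "()"]
        by (cases "j - i") auto
      have 3: "emb (Suc (Suc a)) [] (replicate (r - j) ()) (replicate (r - j) 0)"
        by (auto simp: emb_constants)
      have "replicate r () = replicate i () @ replicate (j - i) () @ replicate (r - j) ()"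
        using ij by (simp flip: replicate_add)
      with emb_append[OF 1, of "[()]"] emb_append[OF 2, of "[]"] 3 show ?thesis
        by (simp add: ln_def)
    qed
    have "plug (Suc a) [x] (ln (Suc a)) = ln x" for x
      by (simp add: plug_def ln_def nth_append)
    then have comp: "plug (Suc a) [x] (plug (Suc a) (ln (Suc a)) v) = plug (Suc a) (ln x) v" for x
      using emb_letters[OF v] emb_length[OF ln] by (simp add: plug_plug)
    have "\<gamma> (plug (Suc a) (ln x) v) = \<gamma> (plug (Suc a) (st j) v)" if "x < Suc a" for x
    proof (cases "x = a")
      case True
      have "st j = ln a"
        using ij by (simp add: st_def ln_def flip: replicate_add append_assoc)
      then show ?thesis by (simp add: True)
    next
      case False
      have st: "st i = ln 0"
        using ij by (simp add: st_def ln_def flip: replicate_add)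
      have "\<gamma> (plug (Suc a) (ln x) v) = \<gamma> (plug (Suc a) (ln 0) v)"
      proof (rule insensitiveD[OF insens])
        show "list_all2 (\<lambda>i j. i = j \<or> i < a \<and> j < a) (ln x) (ln 0)"
          unfolding ln_def using False that
          by (intro list_all2_appendI) (auto simp: list_all2_conv_all_nth)
      qed (use ij that in \<open>auto simp: ln_def\<close>)
      then show ?thesis using ij st by simp
    qed
    then show "\<exists>v. emb (Suc a) [()] (replicate N ()) v \<and> const_line (Suc a) \<gamma> v"
      unfolding const_line_def
      using emb_plug[OF v ln] comp by (intro exI[of _ "plug (Suc a) (ln (Suc a)) v"]) auto
  qed
  then show "\<exists>N. forces (Suc a) [()] (replicate N ()) r (const_line (Suc a))" by blast
qed

theorem hales_jewett: "hales_jewett a"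
proof (induction a)
  case 0
  have "emb 0 [()] (replicate 1 ()) [0]" by (auto intro: emb.intros)
  then have "forces 0 [()] (replicate 1 ()) r (const_line 0)" for r
    unfolding forces_def const_line_def by blast
  then show ?case unfolding hales_jewett_def by blast
qed (rule hales_jewett_Suc)

section \<open>A Ramsey theorem for labelled patterns\<close>

lemma sorted_replicate_append:
  fixes l :: "'l :: order"
  assumes "sorted_wrt (\<le>) c" "set c \<subseteq> set d" "sorted_wrt (\<le>) (l # d)"
  shows "sorted_wrt (\<le>) (replicate n l @ c)"
proof -
  have "sorted_wrt (\<le>) (replicate n l)" by (induction n) auto
  then show ?thesis using assms by (auto simp: sorted_wrt_append)
qed

definition prefix_const :: "nat \<Rightarrow> nat \<Rightarrow> (nat list \<Rightarrow> nat) \<Rightarrow> nat list \<Rightarrow> bool" where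
  "prefix_const a n \<gamma> v \<longleftrightarrow>
     (\<forall>u u'. length u' = length u \<longrightarrow> length u \<le> n \<longrightarrow> set u \<subseteq> {..<a} \<longrightarrow> set u' \<subseteq> {..<a} \<longrightarrow>
        \<gamma> (plug a u (takeWhile (\<lambda>x. x < a + length u) v)) =
        \<gamma> (plug a u' (takeWhile (\<lambda>x. x < a + length u) v)))"

lemma prefix_constD:
  "prefix_const a n \<gamma> v \<Longrightarrow> length u' = length u \<Longrightarrow> length u \<le> n \<Longrightarrow> set u \<subseteq> {..<a} \<Longrightarrow> set u' \<subseteq> {..<a} \<Longrightarrow>
     \<gamma> (plug a u (takeWhile (\<lambda>x. x < a + length u) v)) =
     \<gamma> (plug a u' (takeWhile (\<lambda>x. x < a + length u) v))"
  unfolding prefix_const_def by blast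

text \<open>
  Colours are given to words of all lengths here, and the initial segment of \<open>v\<close> that ends
  before its parameter number \<open>p\<close> gets a colour depending on \<open>p\<close> alone. As for
  insensitive blocks, each block is a line for the colouring by functions on the possible tails.
\<close>

lemma uniform_prefix_subspace:
  fixes d :: "'l :: order list"
  assumes "sorted_wrt (\<le>) d"
  shows "\<exists>c. sorted_wrt (\<le>) c \<and> set c \<subseteq> set d \<and> forces a d c r (prefix_const a (length d))"
  using assms
proof (induction d)
  case Nil
  have "emb a [] [] ([] :: nat list)" by (rule emb_Nil)
  then show ?case by (intro exI[of _ "[]"]) (auto simp: forces_def prefix_const_def intro!: exI[of _ "[]"])
next
  case (Cons l d)
  from Cons obtain c where c: "sorted_wrt (\<le>) c" "set c \<subseteq> set d"
    and c_good: "forces a d c r (prefix_const a (length d))" by auto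
  let ?T = "{w :: nat list. set w \<subseteq> {..<a} \<and> length w \<le> length c}"
  obtain enc R where enc: "colour_code ?T r enc R"
    using colour_code_exists[OF finite_words_le] by blast
  obtain N where N: "\<forall>l :: 'l. forces a [l] (replicate N l) R (const_line a)"
    using hales_jewett_labelled[OF hales_jewett, where r = R]  by blast
  have "forces a (l # d) (replicate N l @ c) r (prefix_const a (length (l # d)))"
  proof (rule forcesI)
    fix \<gamma> :: "nat list \<Rightarrow> nat" assume \<gamma>: "\<forall>w. \<gamma> w < r"
    have "\<forall>w. enc (\<lambda>t. \<gamma> (w @ t)) < R" using colour_code_bound[OF enc] \<gamma> by simp
    from forcesD[OF N[rule_format] this, of l] obtain v1 where v1: "emb a [l] (replicate N l) v1"
      and same1: "const_line a (\<lambda>w. enc (\<lambda>t. \<gamma> (w @ t))) v1" by blast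
    have indep: "\<gamma> (plug a [x] v1 @ t) = \<gamma> (plug a [y] v1 @ t)"
      if "x < a" "y < a" "t \<in> ?T" for x y t
      using colour_code_eqD[OF enc, OF const_lineD[OF same1 that(1,2)] that(3)] \<gamma> by simp
    have "\<forall>t. \<gamma> (plug a [0] v1 @ t) < r" using \<gamma> by simp
    from forcesD[OF c_good this] obtain v2 where v2: "emb a d c v2"
      and same2: "prefix_const a (length d) (\<lambda>t. \<gamma> (plug a [0] v1 @ t)) v2" by blast
    have v1l: "set v1 \<subseteq> {..a}" using emb_letters[OF v1] by auto
    let ?v = "v1 @ shift a 1 v2"
    have split: "plug a (x # u) (takeWhile (\<lambda>y. y < a + length (x # u)) ?v) =
        plug a [x] v1 @ plug a u (takeWhile (\<lambda>y. y < a + length u) v2)" for x u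
    proof -
      have "takeWhile (\<lambda>y. y < a + length (x # u)) ?v =
          v1 @ takeWhile (\<lambda>y. y < a + length (x # u)) (shift a 1 v2)"
        using v1l by (subst takeWhile_append2) auto
      also have "takeWhile (\<lambda>y. y < a + length (x # u)) (shift a 1 v2) =
          shift a 1 (takeWhile (\<lambda>y. y < a + length u) v2)"
        unfolding shift_def takeWhile_map by (intro arg_cong2[where f = map] refl takeWhile_cong) auto
      finally show ?thesis
        using plug_block[OF v1l, of "takeWhile (\<lambda>y. y < a + length u) v2" u x]
        by (auto dest: set_takeWhileD)
    qed
    have tail: "plug a u (takeWhile (\<lambda>y. y < a + length u) v2) \<in> ?T" if "set u \<subseteq> {..<a}" for u
      using that plug_letters[of "takeWhile (\<lambda>y. y < a + length u) v2" a u a]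
        emb_length[OF v2] length_takeWhile_le[of "\<lambda>y. y < a + length u" v2]
      by (auto dest: set_takeWhileD)
    have "emb a (l # d) (replicate N l @ c) ?v" by (rule emb_block[OF v1 v2])
    moreover have "\<gamma> (plug a u (takeWhile (\<lambda>x. x < a + length u) ?v)) =
        \<gamma> (plug a u' (takeWhile (\<lambda>x. x < a + length u) ?v))"
      if len: "length u' = length u" "length u \<le> length (l # d)"
        and sub: "set u \<subseteq> {..<a}" "set u' \<subseteq> {..<a}" for u u'
    proof (cases u)
      case Nil
      then show ?thesis using len by simp
    next
      case (Cons x s)
      then obtain x' s' where u': "u' = x' # s'" using len by (cases u') auto
      have xs: "x < a" "x' < a" "set s \<subseteq> {..<a}" "set s' \<subseteq> {..<a}" "length s' = length s"
        "length s \<le> length d"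
        using Cons u' sub len by auto
      have "\<gamma> (plug a u (takeWhile (\<lambda>x. x < a + length u) ?v)) =
          \<gamma> (plug a [x] v1 @ plug a s (takeWhile (\<lambda>y. y < a + length s) v2))"
        unfolding Cons split ..
      also have "\<dots> = \<gamma> (plug a [0] v1 @ plug a s (takeWhile (\<lambda>y. y < a + length s) v2))"
        using xs tail by (intro indep) auto
      also have "\<dots> = \<gamma> (plug a [0] v1 @ plug a s' (takeWhile (\<lambda>y. y < a + length s) v2))"
        using xs by (intro prefix_constD[OF same2]) auto
      also have "\<dots> = \<gamma> (plug a [x'] v1 @ plug a s' (takeWhile (\<lambda>y. y < a + length s') v2))"
        unfolding xs(5) using xs tail[of s', unfolded xs(5)] by (intro indep) auto
      also have "\<dots> = \<gamma> (plug a u' (takeWhile (\<lambda>x. x < a + length u) ?v))"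
        unfolding len(1)[symmetric] u' split ..
      finally show ?thesis .
    qed
    ultimately show "\<exists>v. emb a (l # d) (replicate N l @ c) v \<and> prefix_const a (length (l # d)) \<gamma> v"
      unfolding prefix_const_def by blast
  qed
  moreover have "sorted_wrt (\<le>) (replicate N l @ c)"
    using c Cons.prems by (rule sorted_replicate_append)
  moreover have "set (replicate N l @ c) \<subseteq> set (l # d)" using c by auto
  ultimately show ?case by blast
qed

definition const_copies :: "nat \<Rightarrow> 'l list \<Rightarrow> 'l list \<Rightarrow> (nat list \<Rightarrow> nat) \<Rightarrow> nat list \<Rightarrow> bool" where
  "const_copies a p d \<gamma> v \<longleftrightarrow>
     (\<forall>u u'. emb a p d u \<longrightarrow> emb a p d u' \<longrightarrow> \<gamma> (plug a u v) = \<gamma> (plug a u' v))"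

lemma const_copiesD:
  "const_copies a p d \<gamma> v \<Longrightarrow> emb a p d u \<Longrightarrow> emb a p d u' \<Longrightarrow> \<gamma> (plug a u v) = \<gamma> (plug a u' v)"
  unfolding const_copies_def by blast

definition ramsey_pattern :: "'l :: order list \<Rightarrow> bool" where
  "ramsey_pattern p \<longleftrightarrow> (\<forall>a d r. sorted_wrt (\<le>) d \<longrightarrow>
     (\<exists>c. sorted_wrt (\<le>) c \<and> set c \<subseteq> set d \<and> forces a d c r (const_copies a p d)))"

lemma ramsey_pattern_Nil: "ramsey_pattern []"
  unfolding ramsey_pattern_def
proof (intro allI impI)
  fix a :: nat and d :: "'a list" and r :: nat
  assume "sorted_wrt (\<le>) d"
  from uniform_prefix_subspace[OF this, of a r]
  obtain c where c: "sorted_wrt (\<le>) c" "set c \<subseteq> set d"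
    and good: "forces a d c r (prefix_const a (length d))" by blast
  have "forces a d c r (const_copies a [] d)"
  proof (rule forcesI)
    fix \<gamma> :: "nat list \<Rightarrow> nat" assume "\<forall>w. \<gamma> w < r"
    from forcesD[OF good this] obtain v where v: "emb a d c v" "prefix_const a (length d) \<gamma> v" by blast
    have all: "takeWhile (\<lambda>x. x < a + length d) v = v"
      using emb_letters[OF v(1)] by (subst takeWhile_eq_all_conv) auto
    have "\<gamma> (plug a u v) = \<gamma> (plug a u' v)" if "emb a [] d u" "emb a [] d u'" for u u'
      using prefix_constD[OF v(2), of u' u] that unfolding emb_constants by (simp add: all)
    with v(1) show "\<exists>v. emb a d c v \<and> const_copies a [] d \<gamma> v" unfolding const_copies_def by blast
  qed
  with c show "\<exists>c. sorted_wrt (\<le>) c \<and> set c \<subseteq> set d \<and> forces a d c r (const_copies a [] d)" by blast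
qed

definition tail_const :: "nat \<Rightarrow> 'l list \<Rightarrow> 'l list \<Rightarrow> (nat list \<Rightarrow> nat) \<Rightarrow> nat list \<Rightarrow> bool" where
  "tail_const a p d \<gamma> v \<longleftrightarrow>
     (\<forall>u u'. emb a p d u \<longrightarrow> emb a p d u' \<longrightarrow>
        takeWhile (\<lambda>x. x < a) u = takeWhile (\<lambda>x. x < a) u' \<longrightarrow> \<gamma> (plug a u v) = \<gamma> (plug a u' v))"

lemma tail_constD:
  "tail_const a p d \<gamma> v \<Longrightarrow> emb a p d u \<Longrightarrow> emb a p d u' \<Longrightarrow>
     takeWhile (\<lambda>x. x < a) u = takeWhile (\<lambda>x. x < a) u' \<Longrightarrow> \<gamma> (plug a u v) = \<gamma> (plug a u' v)"
  unfolding tail_const_def by blast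

text \<open>
  After its first parameter an embedding is an embedding of the shorter pattern over an
  alphabet with one more letter, so the result for the shorter pattern makes the colour
  independent of that tail. Induction on \<open>d\<close> does this for each place at which the first
  parameter may occur; the embeddings that start with a letter are treated for all letters at once.
\<close>

lemma uniform_tail_subspace:
  fixes d :: "'l :: order list"
  assumes "ramsey_pattern p" "sorted_wrt (\<le>) d"
  shows "\<exists>c. sorted_wrt (\<le>) c \<and> set c \<subseteq> set d \<and> forces a d c r (tail_const a (q # p) d)"
  using assms(2)
proof (induction d arbitrary: r)
  case Nil
  have "emb a [] [] ([] :: nat list)" by (rule emb_Nil)
  moreover have "\<not> emb a (q # p) [] u" for u by (auto elim: emb_NilE)
  ultimately show ?case
    by (intro exI[of _ "[]"]) (auto simp: forces_def tail_const_def intro!: exI[of _ "[]"])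
next
  case (Cons l d)
  obtain enc R where enc: "colour_code {..<a} r enc R"
    using colour_code_exists[OF finite_lessThan] by blast
  from Cons.IH[of R] Cons.prems obtain e where e: "sorted_wrt (\<le>) e" "set e \<subseteq> set d"
    and e_good: "forces a d e R (tail_const a (q # p) d)" by auto
  from assms(1) e(1) obtain c where c: "sorted_wrt (\<le>) c" "set c \<subseteq> set e"
    and c_good: "forces (Suc a) e c r (const_copies (Suc a) p e)"
    unfolding ramsey_pattern_def by blast
  have "forces a (l # d) (l # c) r (tail_const a (q # p) (l # d))"
  proof (rule forcesI)
    fix \<gamma> :: "nat list \<Rightarrow> nat" assume \<gamma>: "\<forall>w. \<gamma> w < r"
    have "\<forall>w. \<gamma> (a # w) < r" using \<gamma> by simp
    from forcesD[OF c_good this] obtain v1 where v1: "emb (Suc a) e c v1"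
      and same1: "const_copies (Suc a) p e (\<lambda>w. \<gamma> (a # w)) v1" by blast
    have "\<forall>w. enc (\<lambda>b. \<gamma> (b # plug a (b # w) v1)) < R"
      using colour_code_bound[OF enc] \<gamma> by simp
    from forcesD[OF e_good this] obtain v2 where v2: "emb a d e v2"
      and same2: "tail_const a (q # p) d (\<lambda>w. enc (\<lambda>b. \<gamma> (b # plug a (b # w) v1))) v2" by blast
    \<comment> \<open>the first entry is a parameter, for which an embedding that starts with a letter has that letter\<close>
    let ?v = "a # plug (Suc a) (shift a 1 v2) v1"
    have v2': "emb (Suc a) d e (shift a 1 v2)" using emb_shift[OF v2, of 1] by simp
    have v: "emb a (l # d) (l # c) ?v"
      by (intro emb_new emb_plug[OF v1 v2'])
    have v1l: "set v1 \<subseteq> {..<Suc a + length e}" using emb_letters[OF v1] .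
    have v2l: "set v2 \<subseteq> {..<a + length d}" using emb_letters[OF v2] .
    have sh: "plug (Suc a) u (shift a 1 v2) = plug a u v2" if "length u = length d" for u
      using that v2l by (auto simp: plug_def shift_def nth_append subset_iff)
    have sh': "plug a (b # u) (shift a 1 v2) = plug a u v2" if "length u = length d" for b u
      using that v2l by (auto simp: plug_def shift_def nth_append subset_iff)
    have old: "plug a (b # u) ?v = b # plug a (b # plug a u v2) v1"
      if "length u = length d" for b u
    proof -
      have "plug a (b # u) ?v = b # plug a (b # u) (plug a (a # shift a 1 v2) v1)"
        by (simp add: plug_Suc) (simp add: plug_def nth_append)
      also have "plug a (b # u) (plug a (a # shift a 1 v2) v1) =
          plug a (plug a (b # u) (a # shift a 1 v2)) v1"
        using v1l emb_length[OF v2] by (intro plug_plug) auto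
      also have "plug a (b # u) (a # shift a 1 v2) = b # plug a u v2"
        using sh'[OF that, of b] by (simp add: plug_def nth_append)
      finally show ?thesis .
    qed
    have new: "plug a (a # u) ?v = a # plug (Suc a) (plug a u v2) v1"
      if "length u = length d" for u
      using old[OF that, of a] by (simp add: plug_Suc)
    have "\<gamma> (plug a u ?v) = \<gamma> (plug a u' ?v)"
      if u: "emb a (q # p) (l # d) u" and u': "emb a (q # p) (l # d) u'"
        and pre: "takeWhile (\<lambda>x. x < a) u = takeWhile (\<lambda>x. x < a) u'" for u u'
      using u
    proof (cases rule: emb_Cons_cases)
      case o: (old b s)
      obtain s' where s': "u' = b # s'" "emb a (q # p) d s'"
        using u' pre o by (cases rule: emb_Cons_cases) auto
      have eq: "enc (\<lambda>b. \<gamma> (b # plug a (b # plug a s v2) v1)) =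
            enc (\<lambda>b. \<gamma> (b # plug a (b # plug a s' v2) v1))"
        using o s' pre by (intro tail_constD[OF same2]) auto
      have "b \<in> {..<a}" using o by simp
      from colour_code_eqD[OF enc, OF eq this]
      have "\<gamma> (b # plug a (b # plug a s v2) v1) = \<gamma> (b # plug a (b # plug a s' v2) v1)"
        using \<gamma> by simp
      then show ?thesis using o s' by (simp only: old emb_length)
    next
      case n: (new p' s)
      obtain s' where s': "u' = a # s'" "emb (Suc a) p d s'"
        using u' pre n by (cases rule: emb_Cons_cases) auto
      have "emb (Suc a) p e (plug a t v2)" if "emb (Suc a) p d t" for t
        using emb_plug[OF v2' that] sh[of t] emb_length[OF that] by simp
      then have "\<gamma> (a # plug (Suc a) (plug a s v2) v1) = \<gamma> (a # plug (Suc a) (plug a s' v2) v1)"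
        using n s' by (intro const_copiesD[OF same1]) auto
      moreover have "length s = length d" "length s' = length d"
        using n s' by (auto dest: emb_length)
      ultimately show ?thesis using n s' by (simp only: new)
    qed
    with v show "\<exists>v. emb a (l # d) (l # c) v \<and> tail_const a (q # p) (l # d) \<gamma> v"
      unfolding tail_const_def by blast
  qed
  moreover have "sorted_wrt (\<le>) (l # c)" using c e Cons.prems by auto
  moreover have "set (l # c) \<subseteq> set (l # d)" using c e by auto
  ultimately show ?case by blast
qed

text \<open>
  The parameters are put at the marked places and the letter \<open>0\<close> everywhere else.
\<close>

lemma marked_word_exists:
  assumes "0 < b"
  shows "\<exists>w. emb b (replicate (count_list bs True) l) (replicate (length bs) l) w \<and>
    (\<forall>i<count_list bs True.
       length (takeWhile (\<lambda>x. x < b + i) w) < length bs \<and> bs ! length (takeWhile (\<lambda>x. x < b + i) w))"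
  using assms
proof (induction bs arbitrary: b)
  case Nil
  then show ?case by (auto intro: emb_Nil)
next
  case (Cons x bs)
  show ?case
  proof (cases x)
    case True
    from Cons.IH[of "Suc b"] obtain w
      where w: "emb (Suc b) (replicate (count_list bs True) l) (replicate (length bs) l) w"
      "\<forall>i<count_list bs True. length (takeWhile (\<lambda>x. x < Suc b + i) w) < length bs \<and>
         bs ! length (takeWhile (\<lambda>x. x < Suc b + i) w)" by blast
    have "length (takeWhile (\<lambda>x. x < b + i) (b # w)) < length (x # bs) \<and>
         (x # bs) ! length (takeWhile (\<lambda>x. x < b + i) (b # w))" if "i < Suc (count_list bs True)" for i
      using that w(2) True by (cases i) auto
    then show ?thesis using emb_new[OF w(1), of l] True by (intro exI[of _ "b # w"]) auto
  next
    case False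
    from Cons.IH[of b] Cons.prems obtain w
      where w: "emb b (replicate (count_list bs True) l) (replicate (length bs) l) w"
      "\<forall>i<count_list bs True. length (takeWhile (\<lambda>x. x < b + i) w) < length bs \<and>
         bs ! length (takeWhile (\<lambda>x. x < b + i) w)" by blast
    then show ?thesis using emb_old[OF Cons.prems w(1), of l] False Cons.prems
      by (intro exI[of _ "0 # w"]) auto
  qed
qed


lemma sorted_split_label:
  fixes d :: "'l :: order list"
  assumes "sorted_wrt (\<le>) d"
  shows "\<exists>x s y. d = x @ replicate s l @ y \<and> l \<notin> set x \<and> l \<notin> set y"
  using assms
proof (induction d)
  case Nil
  show ?case by (intro exI[of _ "[]"] exI[of _ 0]) auto
next
  case (Cons k d)
  then obtain x s y where xy: "d = x @ replicate s l @ y" "l \<notin> set x" "l \<notin> set y" by auto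
  show ?case
  proof (cases "k = l")
    case False
    then show ?thesis using xy by (intro exI[of _ "k # x"] exI[of _ s] exI[of _ y]) auto
  next
    case True
    show ?thesis
    proof (cases "s = 0")
      case s: True
      then show ?thesis using xy True
        by (intro exI[of _ "[]"] exI[of _ 1] exI[of _ "x @ y"]) auto
    next
      case s: False
      have "x = []"
      proof (cases x)
        case (Cons h t)
        \<comment> \<open>an entry before the block would lie between two equal labels\<close>
        have "l \<le> h" "h \<le> l" using Cons.prems True xy s Cons by (auto simp: sorted_wrt_append)
        then show ?thesis using xy Cons by auto
      qed simp
      then show ?thesis using xy True
        by (intro exI[of _ "[]"] exI[of _ "Suc s"] exI[of _ y]) auto
    qed
  qed
qed

text \<open>
  In a sorted pattern the occurrences of \<open>l\<close> form one block. If this block is made \<open>r\<close> times as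
  long, then some colour class has enough places in it for all the parameters with label \<open>l\<close>. The other
  places receive a letter, for which the alphabet must not be empty.
\<close>

lemma pigeonhole_subspace:
  fixes d :: "'l :: order list"
  assumes "sorted_wrt (\<le>) d" "0 < a"
  shows "\<exists>e. sorted_wrt (\<le>) e \<and> set e \<subseteq> set d \<and>
    (\<forall>f :: nat \<Rightarrow> nat. (\<forall>n. f n < r) \<longrightarrow>
      (\<exists>v k. emb a d e v \<and>
         (\<forall>i<length d. d ! i = l \<longrightarrow> f (length (takeWhile (\<lambda>x. x < a + i) v)) = k)))"
proof -
  obtain x s y where d: "d = x @ replicate s l @ y" and lx: "l \<notin> set x" and ly: "l \<notin> set y"
    using sorted_split_label[OF assms(1)] by blast
  define e where "e = x @ replicate (s * r) l @ y"
  have "sorted_wrt (\<le>) (replicate n l)" for n by (induction n) auto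
  then have "sorted_wrt (\<le>) e" "set e \<subseteq> set d"
    using assms(1) unfolding d e_def by (auto simp: sorted_wrt_append split: if_splits)
  moreover have "\<exists>v k. emb a d e v \<and>
         (\<forall>i<length d. d ! i = l \<longrightarrow> f (length (takeWhile (\<lambda>x. x < a + i) v)) = k)"
    if f: "\<forall>n. f n < r" for f :: "nat \<Rightarrow> nat"
  proof -
    define F where "F k = {j. j < s * r \<and> f (length x + j) = k}" for k
    have "\<exists>k. s \<le> card (F k)"
    proof (rule ccontr)
      assume "\<nexists>k. s \<le> card (F k)"
      then have lt: "card (F k) < s" for k by (simp add: not_le)
      have "{..<s * r} = (\<Union>k<r. F k)" using f by (auto simp: F_def)
      then have "s * r = card (\<Union>k<r. F k)" by (metis card_lessThan)
      also have "\<dots> \<le> (\<Sum>k<r. card (F k))" by (rule card_UN_le) simp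
      also have "\<dots> < (\<Sum>k<r. s)" using lt f by (intro sum_strict_mono) (auto simp: gr_implies_not0)
      finally show False by simp
    qed
    then obtain k where k: "s \<le> card (F k)" by blast
    then obtain Q where Q: "Q \<subseteq> F k" "card Q = s" "finite Q"
      by (metis obtain_subset_with_card_n)
    define bs where "bs = map (\<lambda>j. j \<in> Q) [0..<s * r]"
    have "count_list bs True = card Q"
    proof -
      have "count_list bs True = length (filter (\<lambda>j. j \<in> Q) [0..<s * r])"
        unfolding bs_def by (simp add: count_list_eq_length_filter filter_map o_def)
      also have "\<dots> = card (set (filter (\<lambda>j. j \<in> Q) [0..<s * r]))"
        by (intro distinct_card[symmetric]) auto
      also have "set (filter (\<lambda>j. j \<in> Q) [0..<s * r]) = Q" using Q(1) by (auto simp: F_def)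
      finally show ?thesis .
    qed
    then have cnt: "count_list bs True = s" using Q by simp
    have lbs: "length bs = s * r" by (simp add: bs_def)
    have "0 < a + length x" using assms(2) by simp
    from marked_word_exists[OF this, of bs l] obtain w
      where w: "emb (a + length x) (replicate s l) (replicate (s * r) l) w"
      and wbs: "\<forall>i<s. length (takeWhile (\<lambda>z. z < a + length x + i) w) < s * r \<and>
        bs ! length (takeWhile (\<lambda>z. z < a + length x + i) w)"
      unfolding cnt lbs by (elim exE conjE) (rule that)
    have wQ: "length (takeWhile (\<lambda>z. z < a + length x + i) w) \<in> Q" if "i < s" for i
      using wbs that by (auto simp: bs_def)
    define v where "v = [a..<a + length x] @ w @ [a + length x + s..<a + length x + s + length y]"
    have "emb a d e v"
      unfolding d e_def v_def
      by (intro emb_append emb_id) (use w emb_id[of "a + length x + s" y] in auto)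
    moreover have "f (length (takeWhile (\<lambda>z. z < a + i) v)) = k"
      if i: "i < length d" "d ! i = l" for i
    proof -
      have "\<not> i < length x" using i lx nth_mem[of i x] by (auto simp: d nth_append)
      moreover have "i - length x < s"
      proof (rule ccontr)
        assume "\<not> i - length x < s"
        then have "d ! i = y ! (i - length x - s)" "i - length x - s < length y"
          using i(1) \<open>\<not> i < length x\<close> by (auto simp: d nth_append)
        with i(2) ly nth_mem show False by metis
      qed
      ultimately obtain j where j: "i = length x + j" "j < s"
        by (metis le_add_diff_inverse not_le)
      have wl: "length (takeWhile (\<lambda>z. z < a + length x + j) w) \<in> Q" using wQ j by simp
      then have "length (takeWhile (\<lambda>z. z < a + length x + j) w) < length w"
        using emb_length[OF w] Q(1) by (auto simp: F_def)
      then have "takeWhile (\<lambda>z. z < a + length x + j) (w @ t) = takeWhile (\<lambda>z. z < a + length x + j) w" for t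
        by (metis takeWhile_append1 takeWhile_eq_all_conv less_irrefl)
      then have "takeWhile (\<lambda>z. z < a + i) v =
          [a..<a + length x] @ takeWhile (\<lambda>z. z < a + length x + j) w"
        unfolding v_def j(1) by (subst takeWhile_append2) (auto simp: add.assoc)
      then show ?thesis using wl Q(1) by (auto simp: F_def)
    qed
    ultimately show ?thesis by blast
  qed
  ultimately show ?thesis by blast
qed

lemma length_first_new:
  assumes "emb a (q # p) d u"
  shows "length (takeWhile (\<lambda>x. x < a) u) < length d \<and>
         d ! length (takeWhile (\<lambda>x. x < a) u) = q"
  using assms
proof (induction d arbitrary: u)
  case (Cons l d)
  from Cons.prems show ?case
    by (cases rule: emb_Cons_cases) (use Cons.IH in auto)
qed (auto elim: emb_NilE)

text \<open>
  The first parameter of a composition comes from the first parameter of \<open>u\<close>. What precedes it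
  involves only the letters of \<open>u\<close> before that parameter.
\<close>

lemma takeWhile_plug:
  assumes "emb a d e v" "emb a (q # p) d u"
  shows "takeWhile (\<lambda>x. x < a) (plug a u v) =
    plug a (takeWhile (\<lambda>x. x < a) u)
      (takeWhile (\<lambda>x. x < a + length (takeWhile (\<lambda>x. x < a) u)) v)"
proof -
  define n where "n = length (takeWhile (\<lambda>x. x < a) u)"
  have n: "n < length u"
    using length_first_new[OF assms(2)] emb_length[OF assms(2)] by (simp add: n_def)
  then have un: "\<not> u ! n < a" unfolding n_def using nth_length_takeWhile by blast
  have pre: "u ! i < a" "takeWhile (\<lambda>x. x < a) u ! i = u ! i" if "i < n" for i
    using that unfolding n_def by (auto simp: takeWhile_nth dest: nth_mem set_takeWhileD)
      (metis nth_mem set_takeWhileD takeWhile_nth)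
  have "takeWhile (\<lambda>x. x < a) (map (\<lambda>x. ([0..<a] @ u) ! x) w) =
      map (\<lambda>x. ([0..<a] @ takeWhile (\<lambda>x. x < a) u) ! x) (takeWhile (\<lambda>x. x < a + n) w)"
    if "emb b d' e' w" "b \<le> a + n" "a \<le> b" for b d' e' w
    using that
  proof (induction rule: emb.induct)
    case (emb_old x b p c w l)
    have "([0..<a] @ u) ! x < a" "([0..<a] @ takeWhile (\<lambda>x. x < a) u) ! x = ([0..<a] @ u) ! x"
      using emb_old.hyps(1) emb_old.prems pre[of "x - a"] by (auto simp: nth_append)
    then show ?case using emb_old by auto
  next
    case (emb_new b p c w l)
    show ?case
    proof (cases "b = a + n")
      case True
      then show ?thesis using un by (simp add: nth_append)
    next
      case False
      have "([0..<a] @ u) ! b < a" "([0..<a] @ takeWhile (\<lambda>x. x < a) u) ! b = ([0..<a] @ u) ! b"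
        using False emb_new.prems pre[of "b - a"] by (auto simp: nth_append)
      then show ?thesis using emb_new False by auto
    qed
  qed simp
  from this[OF assms(1)] show ?thesis by (simp add: plug_def n_def)
qed

text \<open>
  Three steps are composed. The tail after the first parameter ceases to matter by
  \<open>uniform_tail_subspace\<close>; then the constants before it cease to matter, so that only its position is left;
  and by the pigeonhole principle the position can be confined to one colour class. Over the
  empty alphabet the first parameter is the first entry and the first step suffices.
\<close>

lemma ramsey_pattern_Cons:
  fixes q :: "'l :: order"
  assumes "ramsey_pattern p"
  shows "ramsey_pattern (q # p)"
  unfolding ramsey_pattern_def
proof (intro allI impI)
  fix a r :: nat and d :: "'l list"
  assume d: "sorted_wrt (\<le>) d"
  show "\<exists>c. sorted_wrt (\<le>) c \<and> set c \<subseteq> set d \<and> forces a d c r (const_copies a (q # p) d)"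
  proof (cases "a = 0")
    case True
    have "takeWhile (\<lambda>x. x < a) u = []" for u using True by (cases u) auto
    then have "tail_const a (q # p) d = const_copies a (q # p) d"
      by (simp add: fun_eq_iff tail_const_def const_copies_def)
    then show ?thesis using uniform_tail_subspace[OF assms d, of a r q] by simp
  next
    case False
    then have a: "0 < a" by simp
    from pigeonhole_subspace[OF d a, of r q] obtain e
      where e: "sorted_wrt (\<le>) e" "set e \<subseteq> set d"
      and e_good: "\<forall>f :: nat \<Rightarrow> nat. (\<forall>n. f n < r) \<longrightarrow>
      (\<exists>v k. emb a d e v \<and>
         (\<forall>i<length d. d ! i = q \<longrightarrow> f (length (takeWhile (\<lambda>x. x < a + i) v)) = k))"
      by (elim exE conjE) (rule that)
    from uniform_prefix_subspace[OF e(1), of a r] obtain g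
      where g: "sorted_wrt (\<le>) g" "set g \<subseteq> set e" and g_good: "forces a e g r (prefix_const a (length e))"
      by blast
    from uniform_tail_subspace[OF assms g(1), of a r q] obtain c
      where c: "sorted_wrt (\<le>) c" "set c \<subseteq> set g" and c_good: "forces a g c r (tail_const a (q # p) g)"
      by blast
    have "forces a d c r (const_copies a (q # p) d)"
    proof (rule forcesI)
      fix \<gamma> :: "nat list \<Rightarrow> nat" assume \<gamma>: "\<forall>w. \<gamma> w < r"
      from forcesD[OF c_good \<gamma>] obtain v1 where v1: "emb a g c v1"
        and same1: "tail_const a (q # p) g \<gamma> v1" by blast
      \<comment> \<open>the colour of an embedding read off from its part before the first parameter\<close>
      define \<psi> where "\<psi> t = \<gamma> (plug a (SOME u. emb a (q # p) g u \<and> takeWhile (\<lambda>x. x < a) u = t) v1)" for t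
      have \<psi>: "\<gamma> (plug a u v1) = \<psi> (takeWhile (\<lambda>x. x < a) u)" if "emb a (q # p) g u" for u
      proof -
        have "emb a (q # p) g (SOME u'. emb a (q # p) g u' \<and> takeWhile (\<lambda>x. x < a) u' = takeWhile (\<lambda>x. x < a) u) \<and>
           takeWhile (\<lambda>x. x < a) (SOME u'. emb a (q # p) g u' \<and> takeWhile (\<lambda>x. x < a) u' = takeWhile (\<lambda>x. x < a) u) = takeWhile (\<lambda>x. x < a) u"
          by (rule someI[of _ u]) (use that in simp)
        then show ?thesis unfolding \<psi>_def using tail_constD[OF same1 that] by metis
      qed
      have \<psi>_bound: "\<forall>t. \<psi> t < r" using \<gamma> by (simp add: \<psi>_def)
      from forcesD[OF g_good this] obtain v2 where v2: "emb a e g v2"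
        and same2: "prefix_const a (length e) \<psi> v2" by blast
      define f where "f n = \<psi> (plug a (replicate n 0) (takeWhile (\<lambda>x. x < a + n) v2))" for n
      have "\<forall>n. f n < r" using \<psi>_bound by (simp add: f_def)
      from e_good[THEN spec, THEN mp, OF this] obtain v3 k where v3: "emb a d e v3"
        and fk: "\<forall>i<length d. d ! i = q \<longrightarrow> f (length (takeWhile (\<lambda>x. x < a + i) v3)) = k"
        by (elim exE conjE) (rule that)
      let ?v = "plug a (plug a v3 v2) v1"
      have v32: "emb a d g (plug a v3 v2)" by (rule emb_plug[OF v2 v3])
      have v: "emb a d c ?v" by (rule emb_plug[OF v1 v32])
      have "\<gamma> (plug a u ?v) = k" if u: "emb a (q # p) d u" for u
      proof -
        define w where "w = plug a u v3"
        have w: "emb a (q # p) e w" unfolding w_def by (rule emb_plug[OF v3 u])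
        have w2: "emb a (q # p) g (plug a w v2)" by (rule emb_plug[OF v2 w])
        have "plug a u ?v = plug a (plug a u (plug a v3 v2)) v1"
          using emb_letters[OF v1] emb_length[OF v32] by (intro plug_plug) simp
        also have "plug a u (plug a v3 v2) = plug a w v2"
          using emb_letters[OF v2] emb_length[OF v3] unfolding w_def by (intro plug_plug) simp
        finally have "\<gamma> (plug a u ?v) = \<psi> (takeWhile (\<lambda>x. x < a) (plug a w v2))"
          using \<psi>[OF w2] by simp
        also have "\<dots> = f (length (takeWhile (\<lambda>x. x < a) w))"
          unfolding f_def takeWhile_plug[OF v2 w]
          using length_first_new[OF w] a
          by (intro prefix_constD[OF same2, where u' = "replicate n 0" and u = "takeWhile (\<lambda>x. x < a) w" for n])
             (auto dest: set_takeWhileD)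
        also have "length (takeWhile (\<lambda>x. x < a) w) =
            length (takeWhile (\<lambda>x. x < a + length (takeWhile (\<lambda>x. x < a) u)) v3)"
          unfolding w_def takeWhile_plug[OF v3 u] by simp
        also have "f \<dots> = k" using length_first_new[OF u] fk by blast
        finally show ?thesis .
      qed
      with v show "\<exists>v. emb a d c v \<and> const_copies a (q # p) d \<gamma> v"
        unfolding const_copies_def by metis
    qed
    then show ?thesis using c g e by blast
  qed
qed

text \<open>
  Without the labels this is the theorem of Graham and Rothschild on parameter words.
\<close>

theorem ramsey_embeddings:
  fixes d :: "'l :: order list"
  assumes "sorted_wrt (\<le>) d"
  shows "\<exists>c. sorted_wrt (\<le>) c \<and> set c \<subseteq> set d \<and> forces a d c r (const_copies a p d)"
proof -
  have "ramsey_pattern p"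
    by (induction p) (auto intro: ramsey_pattern_Nil ramsey_pattern_Cons)
  then show ?thesis using assms unfolding ramsey_pattern_def by blast
qed

text \<open>
  The description by positions translates between words and joins of atoms.
\<close>

lemma emb_iff:
  "emb a p c w \<longleftrightarrow> length w = length c \<and> set w \<subseteq> {..<a + length p} \<and>
     (\<forall>i<length p. \<exists>j<length c. w ! j = a + i \<and> c ! j = p ! i \<and> (\<forall>j'<j. w ! j' < a + i))"
proof
  assume "emb a p c w"
  then show "length w = length c \<and> set w \<subseteq> {..<a + length p} \<and>
     (\<forall>i<length p. \<exists>j<length c. w ! j = a + i \<and> c ! j = p ! i \<and> (\<forall>j'<j. w ! j' < a + i))"
  proof (induction rule: emb.induct)
    case (emb_old x a p c w l)
    have "\<exists>j<length (l # c). (x # w) ! j = a + i \<and> (l # c) ! j = p ! i \<and> (\<forall>j'<j. (x # w) ! j' < a + i)"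
      if "i < length p" for i
    proof -
      from emb_old.IH that obtain j where
        "j < length c" "w ! j = a + i" "c ! j = p ! i" "\<forall>j'<j. w ! j' < a + i" by blast
      then show ?thesis using emb_old.hyps(1)
        by (intro exI[of _ "Suc j"]) (auto simp: less_Suc_eq_0_disj)
    qed
    moreover have "set (x # w) \<subseteq> {..<a + length p}" using emb_old.IH emb_old.hyps(1) by simp
    ultimately show ?case using emb_old.IH by simp
  next
    case (emb_new a p c w l)
    have "\<exists>j<length (l # c). (a # w) ! j = a + i \<and> (l # c) ! j = (l # p) ! i \<and> (\<forall>j'<j. (a # w) ! j' < a + i)"
      if i: "i < length (l # p)" for i
    proof (cases i)
      case 0
      then show ?thesis by auto
    next
      case (Suc k)
      then have "k < length p" using i by simp
      with emb_new.IH obtain j where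
        "j < length c" "w ! j = Suc a + k" "c ! j = p ! k" "\<forall>j'<j. w ! j' < Suc a + k" by blast
      moreover have "(a # w) ! j' < a + i" if "j' < Suc j" for j'
        using that calculation(4) Suc by (cases j') auto
      ultimately have "Suc j < length (l # c) \<and> (a # w) ! Suc j = a + i \<and>
          (l # c) ! Suc j = (l # p) ! i \<and> (\<forall>j'<Suc j. (a # w) ! j' < a + i)"
        using Suc by simp
      then show ?thesis by blast
    qed
    moreover have "set (a # w) \<subseteq> {..<a + length (l # p)}" using emb_new.IH by simp
    ultimately show ?case using emb_new.IH by simp
  qed simp
next
  assume "length w = length c \<and> set w \<subseteq> {..<a + length p} \<and>
     (\<forall>i<length p. \<exists>j<length c. w ! j = a + i \<and> c ! j = p ! i \<and> (\<forall>j'<j. w ! j' < a + i))"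
  then show "emb a p c w"
  proof (induction c arbitrary: a p w)
    case Nil
    then show ?case by (cases p) (auto intro: emb_Nil)
  next
    case (Cons l c)
    then obtain x w' where w: "w = x # w'" by (cases w) auto
    have pos: "\<exists>j<length (l # c). (x # w') ! j = a + i \<and> (l # c) ! j = p ! i \<and> (\<forall>j'<j. (x # w') ! j' < a + i)"
      if "i < length p" for i
      using Cons.prems[THEN conjunct2, THEN conjunct2, rule_format, OF that] unfolding w .
    show ?case
    proof (cases "x < a")
      case True
      have "\<exists>j<length c. w' ! j = a + i \<and> c ! j = p ! i \<and> (\<forall>j'<j. w' ! j' < a + i)"
        if il: "i < length p" for i
      proof -
        obtain j where j: "j < length (l # c)" "(x # w') ! j = a + i" "(l # c) ! j = p ! i"
          "\<forall>j'<j. (x # w') ! j' < a + i" using pos[OF il] by blast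
        then obtain k where "j = Suc k" using True by (cases j) auto
        with j show ?thesis by (intro exI[of _ k]) auto
      qed
      then have "emb a p c w'" using Cons.prems w by (intro Cons.IH) auto
      with True show ?thesis unfolding w by (rule emb_old)
    next
      case False
      then have "p \<noteq> []" using Cons.prems w by auto
      obtain j where j: "(x # w') ! j = a + 0" "(l # c) ! j = p ! 0" "\<forall>j'<j. (x # w') ! j' < a + 0"
        using pos[of 0] \<open>p \<noteq> []\<close> by blast
      have "j = 0" using False j(3) by (cases j) auto
      with j obtain p' where p: "p = l # p'" and x: "x = a" using \<open>p \<noteq> []\<close> by (cases p) auto
      have "\<exists>j<length c. w' ! j = Suc a + i \<and> c ! j = p' ! i \<and> (\<forall>j'<j. w' ! j' < Suc a + i)"
        if il: "i < length p'" for i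
      proof -
        have "Suc i < length p" using il p by simp
        from pos[OF this]
        obtain j where j: "j < length (l # c)" "(x # w') ! j = a + Suc i" "(l # c) ! j = p ! Suc i"
          "\<forall>j'<j. (x # w') ! j' < a + Suc i" by blast
        then obtain k where "j = Suc k" using x by (cases j) auto
        with j p show ?thesis by (intro exI[of _ k]) auto
      qed
      then have "emb (Suc a) p' c w'" using Cons.prems w p by (intro Cons.IH) auto
      then show ?thesis unfolding w p x by (rule emb_new)
    qed
  qed
qed

section \<open>The quotient algebra on representatives\<close>

locale cardinal_quotient =
  fixes kap :: "'a rel" and lam :: "'b rel"
  assumes Cinfinite_lam: "Cinfinite lam" and Cinfinite_kap: "Cinfinite kap"
    and lam_le_kap: "lam \<le>o kap"
begin

abbreviation "K \<equiv> Field kap"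
abbreviation "B \<equiv> pow_quot lam kap"
abbreviation "P \<equiv> carrier (pow_quot lam kap)"
abbreviation "C \<equiv> cls lam kap"
abbreviation "G \<equiv> Aut lam kap"

definition small :: "'a set \<Rightarrow> bool" where
  "small X \<longleftrightarrow> |X| <o lam"

lemma lam_infinite: "\<not> finite (Field lam)" and Card_order_lam: "Card_order lam"
  using Cinfinite_lam by (auto simp: cinfinite_def)

lemma small_subset: "X \<subseteq> Y \<Longrightarrow> small Y \<Longrightarrow> small X"
  unfolding small_def using card_of_mono1 ordLeq_ordLess_trans by blast

lemma small_Un: "small X \<Longrightarrow> small Y \<Longrightarrow> small (X \<union> Y)"
  unfolding small_def using lam_infinite Card_order_lam by (rule card_of_Un_ordLess_infinite_Field)

lemma small_empty [simp]: "small {}"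
proof -
  have "Field lam \<noteq> {}" using lam_infinite by auto
  then have "|{} :: 'a set| <o |Field lam|"
    by (metis card_of_empty3 not_ordLess_iff_ordLeq card_of_Well_order)
  then show ?thesis unfolding small_def
    using card_of_Field_ordIso[OF Card_order_lam] ordLess_ordIso_trans by blast
qed

lemma small_UN: "finite I \<Longrightarrow> (\<And>i. i \<in> I \<Longrightarrow> small (X i)) \<Longrightarrow> small (\<Union>i\<in>I. X i)"
  by (induction I rule: finite_induct) (auto intro: small_Un)

lemma not_small_iff: "\<not> small X \<longleftrightarrow> lam \<le>o |X|"
  unfolding small_def using not_ordLess_iff_ordLeq Card_order_lam card_of_Well_order
  by (metis card_order_on_well_order_on)

lemma not_small_K: "\<not> small K"
  unfolding not_small_iff
  using lam_le_kap card_of_Field_ordIso[of kap] Cinfinite_kap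
  by (meson ordIso_symmetric ordLeq_ordIso_trans)

lemma small_diff_equiv: "equiv (Pow K) (small_diff lam kap)"
proof (rule equivI)
  show "small_diff lam kap \<subseteq> Pow K \<times> Pow K" by (auto simp: small_diff_def)
  show "refl_on (Pow K) (small_diff lam kap)"
    using small_empty by (auto simp: refl_on_def small_diff_def small_def)
  show "sym (small_diff lam kap)"
    by (auto simp: sym_def small_diff_def Un_commute)
  show "trans (small_diff lam kap)"
  proof (rule transI)
    fix X Y Z assume "(X, Y) \<in> small_diff lam kap" "(Y, Z) \<in> small_diff lam kap"
    then have "X \<subseteq> K" "Z \<subseteq> K" "small (sym_diff X Y \<union> sym_diff Y Z)"
      by (auto simp: small_diff_def small_def[symmetric] intro: small_Un)
    moreover have "sym_diff X Z \<subseteq> sym_diff X Y \<union> sym_diff Y Z" by auto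
    ultimately show "(X, Z) \<in> small_diff lam kap"
      using small_subset by (auto simp: small_diff_def small_def[symmetric])
  qed
qed

lemma carrier_eq: "P = C ` Pow K"
  by (auto simp: pow_quot_def quotient_def cls_def)

lemma C_in_P [simp, intro]: "X \<subseteq> K \<Longrightarrow> C X \<in> P"
  by (auto simp: carrier_eq)

lemma P_cases:
  assumes "x \<in> P"
  obtains X where "X \<subseteq> K" "x = C X"
  using assms by (auto simp: carrier_eq)

lemma C_eq_iff: "X \<subseteq> K \<Longrightarrow> Y \<subseteq> K \<Longrightarrow> C X = C Y \<longleftrightarrow> small (sym_diff X Y)"
  unfolding cls_def using eq_equiv_class_iff[OF small_diff_equiv, of X Y]
  by (auto simp: small_diff_def small_def)

lemma mem_C_iff: "X \<subseteq> K \<Longrightarrow> Y \<in> C X \<longleftrightarrow> Y \<subseteq> K \<and> C Y = C X"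
  using C_eq_iff[of Y X] by (auto simp: cls_def small_diff_def small_def Un_commute)

lemma C_Un_cong:
  assumes "C X = C X'" "C Y = C Y'" "X \<subseteq> K" "X' \<subseteq> K" "Y \<subseteq> K" "Y' \<subseteq> K"
  shows "C (X \<union> Y) = C (X' \<union> Y')"
proof -
  have "small (sym_diff X X' \<union> sym_diff Y Y')" using assms by (auto simp: C_eq_iff intro: small_Un)
  then have "small (sym_diff (X \<union> Y) (X' \<union> Y'))" by (rule small_subset[rotated]) auto
  then show ?thesis using assms by (subst C_eq_iff) auto
qed

lemma C_Int_cong:
  assumes "C X = C X'" "C Y = C Y'" "X \<subseteq> K" "X' \<subseteq> K" "Y \<subseteq> K" "Y' \<subseteq> K"
  shows "C (X \<inter> Y) = C (X' \<inter> Y')"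
proof -
  have "small (sym_diff X X' \<union> sym_diff Y Y')" using assms by (auto simp: C_eq_iff intro: small_Un)
  then have "small (sym_diff (X \<inter> Y) (X' \<inter> Y'))" by (rule small_subset[rotated]) auto
  then show ?thesis using assms by (subst C_eq_iff) auto
qed

lemma C_Compl_cong:
  assumes "C X = C X'" "X \<subseteq> K" "X' \<subseteq> K"
  shows "C (K - X) = C (K - X')"
proof -
  have "small (sym_diff X X')" using assms by (auto simp: C_eq_iff)
  then have "small (sym_diff (K - X) (K - X'))" by (rule small_subset[rotated]) auto
  then show ?thesis using assms by (subst C_eq_iff) auto
qed

lemma self_mem_C: "X \<subseteq> K \<Longrightarrow> X \<in> C X"
  by (simp add: mem_C_iff)

lemma bjoin_C [simp]: "X \<subseteq> K \<Longrightarrow> Y \<subseteq> K \<Longrightarrow> bjoin B (C X) (C Y) = C (X \<union> Y)"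
proof -
  assume XY: "X \<subseteq> K" "Y \<subseteq> K"
  have "bjoin B (C X) (C Y) = (\<Union>X'\<in>C X. \<Union>Y'\<in>C Y. C (X \<union> Y))"
    unfolding pow_quot_def bool_alg.simps using XY
    by (intro SUP_cong refl C_Un_cong) (auto simp: mem_C_iff)
  then show ?thesis using self_mem_C[OF XY(1)] self_mem_C[OF XY(2)] by auto
qed

lemma bmeet_C [simp]: "X \<subseteq> K \<Longrightarrow> Y \<subseteq> K \<Longrightarrow> bmeet B (C X) (C Y) = C (X \<inter> Y)"
proof -
  assume XY: "X \<subseteq> K" "Y \<subseteq> K"
  have "bmeet B (C X) (C Y) = (\<Union>X'\<in>C X. \<Union>Y'\<in>C Y. C (X \<inter> Y))"
    unfolding pow_quot_def bool_alg.simps using XY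
    by (intro SUP_cong refl C_Int_cong) (auto simp: mem_C_iff)
  then show ?thesis using self_mem_C[OF XY(1)] self_mem_C[OF XY(2)] by auto
qed

lemma bcompl_C [simp]: "X \<subseteq> K \<Longrightarrow> bcompl B (C X) = C (K - X)"
proof -
  assume X: "X \<subseteq> K"
  have "bcompl B (C X) = (\<Union>X'\<in>C X. C (K - X))"
    unfolding pow_quot_def bool_alg.simps using X
    by (intro SUP_cong refl C_Compl_cong) (auto simp: mem_C_iff)
  then show ?thesis using self_mem_C[OF X] by auto
qed

lemma bbot_eq: "bbot B = C {}" and btop_eq: "btop B = C K"
  by (simp_all add: pow_quot_def)

lemma bool_le_C: "X \<subseteq> K \<Longrightarrow> Y \<subseteq> K \<Longrightarrow> bool_le B (C X) (C Y) \<longleftrightarrow> small (X - Y)"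
proof -
  assume XY: "X \<subseteq> K" "Y \<subseteq> K"
  have "sym_diff (X \<inter> Y) X = X - Y" by auto
  then show ?thesis using XY C_eq_iff[of "X \<inter> Y" X] by (auto simp: bool_le_def)
qed

lemma C_eq_bot: "X \<subseteq> K \<Longrightarrow> C X = C {} \<longleftrightarrow> small X"
  by (subst C_eq_iff) auto

lemma C_UN_cong:
  assumes "finite I" "\<And>i. i \<in> I \<Longrightarrow> X i \<subseteq> K" "\<And>i. i \<in> I \<Longrightarrow> Y i \<subseteq> K"
    "\<And>i. i \<in> I \<Longrightarrow> C (X i) = C (Y i)"
  shows "C (\<Union>i\<in>I. X i) = C (\<Union>i\<in>I. Y i)"
  using assms
proof (induction I rule: finite_induct)
  case (insert i I)
  then have "C (X i \<union> (\<Union>i\<in>I. X i)) = C (Y i \<union> (\<Union>i\<in>I. Y i))"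
    by (intro C_Un_cong UN_least insertI2) (simp_all add: insertI2)
  then show ?case by simp
qed simp

section \<open>Sizes of classes\<close>

text \<open>
  The size of a set, coded by the levels to which its class belongs. Larger sets have fewer levels.
  Automorphisms preserve it by definition.
\<close>

definition lab :: "'a set \<Rightarrow> 'a rel set" where
  "lab X = {mu \<in> cards_between lam kap. |X| \<le>o mu}"

lemma cards_between_infinite:
  assumes "mu \<in> cards_between lam kap"
  shows "\<not> finite (Field mu)" "Card_order mu"
  using assms cinfinite_mono[of lam mu] Cinfinite_lam
  by (auto simp: cards_between_def cinfinite_def)

lemma small_le_card: "small X \<Longrightarrow> mu \<in> cards_between lam kap \<Longrightarrow> |X| \<le>o mu"
  unfolding small_def cards_between_def
  by (auto intro: ordLess_imp_ordLeq ordLess_ordLeq_trans)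

lemma card_Un_le_iff:
  assumes "mu \<in> cards_between lam kap"
  shows "|X \<union> Y| \<le>o mu \<longleftrightarrow> |X| \<le>o mu \<and> |Y| \<le>o mu"
  using card_of_Un_ordLeq_infinite_Field[OF cards_between_infinite(1)[OF assms] _ _ cards_between_infinite(2)[OF assms]]
  by (meson Un_upper1 Un_upper2 card_of_mono1 ordLeq_transitive)

lemma lab_Un: "lab (X \<union> Y) = lab X \<inter> lab Y"
  unfolding lab_def using card_Un_le_iff by auto

lemma lab_small: "small X \<Longrightarrow> lab X = cards_between lam kap"
  unfolding lab_def using small_le_card by auto

lemma lab_sub: "lab X \<subseteq> cards_between lam kap"
  by (auto simp: lab_def)

lemma lab_mono: "X \<subseteq> Y \<Longrightarrow> lab Y \<subseteq> lab X"
  using lab_Un[of X Y] by (simp add: Un_absorb1) blast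

lemma lab_cong:
  assumes "X \<subseteq> K" "Y \<subseteq> K" "C X = C Y"
  shows "lab X = lab Y"
proof -
  have s: "small (sym_diff X Y)" using assms C_eq_iff by blast
  have "X \<union> sym_diff X Y = Y \<union> sym_diff X Y" by auto
  then have "lab X \<inter> lab (sym_diff X Y) = lab Y \<inter> lab (sym_diff X Y)" by (simp flip: lab_Un)
  then show ?thesis using lab_small[OF s] lab_sub by blast
qed

lemma level_iff:
  assumes "X \<subseteq> K" "mu \<in> cards_between lam kap"
  shows "C X \<in> level lam kap mu \<longleftrightarrow> mu \<in> lab X"
proof
  assume "C X \<in> level lam kap mu"
  then obtain Y where "C X = C Y" "Y \<subseteq> K" "|Y| \<le>o mu" by (auto simp: level_def)
  then show "mu \<in> lab X" using lab_cong[of X Y] assms by (auto simp: lab_def)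
qed (use assms in \<open>auto simp: level_def lab_def\<close>)

lemma lab_linear: "lab X \<subseteq> lab Y \<or> lab Y \<subseteq> lab X"
proof -
  have "|X| \<le>o |Y| \<or> |Y| \<le>o |X|"
    using ordLeq_total card_of_Well_order by blast
  then show ?thesis by (auto simp: lab_def intro: ordLeq_transitive)
qed

lemma card_of_le_kap: "X \<subseteq> K \<Longrightarrow> |X| \<le>o kap"
  using card_of_mono1[of X K] card_of_Field_ordIso[of kap] Cinfinite_kap
  by (meson ordLeq_ordIso_trans)

lemma card_of_mem_lab:
  assumes "X \<subseteq> K" "\<not> small X"
  shows "|X| \<in> lab X"
  using assms card_of_le_kap not_small_iff ordLeq_refl[OF card_of_Card_order, of X] card_of_Card_order[of X]
  by (auto simp: lab_def cards_between_def)

text \<open>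
  The size of a large set is itself an index of a level.
\<close>

lemma lab_eq_imp_card_eq:
  assumes "X \<subseteq> K" "\<not> small X" "Y \<subseteq> K" "\<not> small Y" "lab X = lab Y"
  shows "|X| =o |Y|"
  using card_of_mem_lab[OF assms(1,2)] card_of_mem_lab[OF assms(3,4)] assms(5)
  unfolding ordIso_iff_ordLeq by (auto simp: lab_def)

lemma lab_image: "inj_on f X \<Longrightarrow> lab (f ` X) = lab X"
proof -
  assume "inj_on f X"
  then have "|f ` X| =o |X|"
    by (metis card_of_ordIsoI inj_on_imp_bij_betw ordIso_symmetric)
  then show ?thesis unfolding lab_def
    by (auto intro: ordIso_ordLeq_trans dest: ordIso_symmetric)
qed

lemma lab_UN:
  assumes "finite I" "i0 \<in> I" "\<And>i. i \<in> I \<Longrightarrow> lab (X i0) \<subseteq> lab (X i)"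
  shows "lab (\<Union>i\<in>I. X i) = lab (X i0)"
proof -
  have "lab (X i0) \<subseteq> lab (\<Union>i\<in>J. X i)" if "finite J" "J \<subseteq> I" for J
    using that
  proof (induction J rule: finite_induct)
    case empty
    then show ?case using lab_sub lab_small by fastforce
  next
    case (insert j J)
    then show ?case using assms(3) by (simp add: lab_Un)
  qed
  then show ?thesis using assms lab_mono[of "X i0" "\<Union>i\<in>I. X i"] by blast
qed

section \<open>Finite subalgebras as partitions\<close>

text \<open>
  The pieces are large, so they represent the atoms of a subalgebra, which is \<open>span\<close> below.
\<close>

definition part :: "'a set list \<Rightarrow> bool" where
  "part Xs \<longleftrightarrow> (\<forall>X\<in>set Xs. \<not> small X) \<and>
     (\<forall>i<length Xs. \<forall>j<length Xs. i \<noteq> j \<longrightarrow> Xs ! i \<inter> Xs ! j = {}) \<and> \<Union> (set Xs) = K"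

definition U :: "'a set list \<Rightarrow> nat set \<Rightarrow> 'a set" where
  "U Xs S = (\<Union>i\<in>S. Xs ! i)"

definition span :: "'a set list \<Rightarrow> 'a set set set" where
  "span Xs = {C (U Xs S) | S. S \<subseteq> {..<length Xs}}"

lemma part_nth: 
  assumes "part Xs" "i < length Xs"
  shows "Xs ! i \<subseteq> K" "\<not> small (Xs ! i)" "Xs ! i \<noteq> {}"
proof -
  have "Xs ! i \<in> set Xs" using assms(2) by simp
  then show "Xs ! i \<subseteq> K" "\<not> small (Xs ! i)" using assms(1) by (auto simp: part_def)
  then show "Xs ! i \<noteq> {}" using small_empty by metis
qed

lemma part_disjoint: "part Xs \<Longrightarrow> i < length Xs \<Longrightarrow> j < length Xs \<Longrightarrow> i \<noteq> j \<Longrightarrow> Xs ! i \<inter> Xs ! j = {}"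
  by (auto simp: part_def)

lemma Union_set_nth: "\<Union> (set Xs) = (\<Union>i<length Xs. Xs ! i)"
  by (auto simp: set_conv_nth)

lemma part_U_all: "part Xs \<Longrightarrow> U Xs {..<length Xs} = K"
  by (simp add: part_def U_def flip: Union_set_nth)

lemma U_sub: "part Xs \<Longrightarrow> S \<subseteq> {..<length Xs} \<Longrightarrow> U Xs S \<subseteq> K"
  by (auto simp: U_def dest: part_nth(1))

lemma U_Un: "U Xs (S \<union> T) = U Xs S \<union> U Xs T"
  by (auto simp: U_def)

lemma U_UN: "U Xs (\<Union>i\<in>I. S i) = (\<Union>i\<in>I. U Xs (S i))"
  by (auto simp: U_def)

lemma U_empty [simp]: "U Xs {} = {}" and U_single [simp]: "U Xs {i} = Xs ! i"
  by (auto simp: U_def)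

lemma U_disjoint:
  assumes "part Xs" "S \<subseteq> {..<length Xs}" "T \<subseteq> {..<length Xs}" "S \<inter> T = {}"
  shows "U Xs S \<inter> U Xs T = {}"
proof -
  have "Xs ! i \<inter> Xs ! j = {}" if "i \<in> S" "j \<in> T" for i j
    using that assms by (intro part_disjoint[OF assms(1)]) auto
  then show ?thesis by (auto simp: U_def)
qed

lemma
  assumes "part Xs" "S \<subseteq> {..<length Xs}" "T \<subseteq> {..<length Xs}"
  shows U_Diff: "U Xs (S - T) = U Xs S - U Xs T"
    and U_Int: "U Xs (S \<inter> T) = U Xs S \<inter> U Xs T"
proof -
  have "U Xs S = U Xs (S - T) \<union> U Xs (S \<inter> T)" by (auto simp: U_def)
  moreover have "U Xs (S - T) \<inter> U Xs T = {}" using assms by (intro U_disjoint) auto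
  moreover have "U Xs (S \<inter> T) \<subseteq> U Xs T" by (auto simp: U_def)
  ultimately show "U Xs (S - T) = U Xs S - U Xs T" "U Xs (S \<inter> T) = U Xs S \<inter> U Xs T" by auto
qed

lemma U_Compl:
  assumes "part Xs" "S \<subseteq> {..<length Xs}"
  shows "U Xs ({..<length Xs} - S) = K - U Xs S"
  using U_Diff[OF assms(1) _ assms(2)] part_U_all[OF assms(1)] by auto

lemma small_U_iff:
  assumes "part Xs" "S \<subseteq> {..<length Xs}"
  shows "small (U Xs S) \<longleftrightarrow> S = {}"
proof
  assume s: "small (U Xs S)"
  show "S = {}"
  proof (rule ccontr)
    assume "S \<noteq> {}"
    then obtain i where i: "i \<in> S" by auto
    then have "small (Xs ! i)" using s by (auto simp: U_def intro: small_subset)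
    then show False using part_nth(2)[OF assms(1)] i assms(2) by auto
  qed
qed simp

lemma bool_le_U:
  assumes "part Xs" "S \<subseteq> {..<length Xs}" "T \<subseteq> {..<length Xs}"
  shows "bool_le B (C (U Xs S)) (C (U Xs T)) \<longleftrightarrow> S \<subseteq> T"
proof -
  have "bool_le B (C (U Xs S)) (C (U Xs T)) \<longleftrightarrow> small (U Xs (S - T))"
    using assms by (simp add: bool_le_C U_sub U_Diff)
  also have "\<dots> \<longleftrightarrow> S - T = {}" using assms by (intro small_U_iff) auto
  finally show ?thesis by auto
qed

lemma C_U_eq_iff:
  assumes "part Xs" "S \<subseteq> {..<length Xs}" "T \<subseteq> {..<length Xs}"
  shows "C (U Xs S) = C (U Xs T) \<longleftrightarrow> S = T"
proof
  assume "C (U Xs S) = C (U Xs T)"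
  then have "bool_le B (C (U Xs S)) (C (U Xs T))" "bool_le B (C (U Xs T)) (C (U Xs S))"
    using bool_le_U[OF assms(1,2,2)] bool_le_U[OF assms(1,3,3)] by auto
  then show "S = T" using bool_le_U[OF assms] bool_le_U[OF assms(1,3,2)] by auto
qed simp

lemma span_finite_subalgebra:
  assumes "part Xs"
  shows "finite_subalgebra B (span Xs)"
  unfolding finite_subalgebra_def
proof (intro conjI ballI)
  have "span Xs = (\<lambda>S. C (U Xs S)) ` Pow {..<length Xs}" by (auto simp: span_def)
  then show "finite (span Xs)" by simp
  show "span Xs \<subseteq> P" using assms by (auto simp: span_def U_sub)
  show "bbot B \<in> span Xs" unfolding span_def bbot_eq
    by (auto intro!: exI[of _ "{}"])
  show "btop B \<in> span Xs" unfolding span_def btop_eq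
    using part_U_all[OF assms] by (auto intro!: exI[of _ "{..<length Xs}"])
next
  fix x assume "x \<in> span Xs"
  then obtain S where S: "S \<subseteq> {..<length Xs}" "x = C (U Xs S)" by (auto simp: span_def)
  then have "bcompl B x = C (U Xs ({..<length Xs} - S))"
    using assms by (simp add: U_sub U_Compl)
  then show "bcompl B x \<in> span Xs" by (auto simp: span_def)
next
  fix x y assume "x \<in> span Xs" "y \<in> span Xs"
  then obtain S T where S: "S \<subseteq> {..<length Xs}" "x = C (U Xs S)"
    and T: "T \<subseteq> {..<length Xs}" "y = C (U Xs T)" by (auto simp: span_def)
  have "bjoin B x y = C (U Xs (S \<union> T))" using assms S T by (simp add: U_sub U_Un)
  then show "bjoin B x y \<in> span Xs" using S T by (auto simp: span_def)
  have "bmeet B x y = C (U Xs (S \<inter> T))" using assms S T by (simp add: U_sub U_Int)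
  then show "bmeet B x y \<in> span Xs" using S T by (auto simp: span_def)
qed

lemma atoms_of_span:
  assumes "part Xs"
  shows "atoms_of B (span Xs) = (\<lambda>i. C (Xs ! i)) ` {..<length Xs}"
proof (intro equalityI subsetI)
  fix a assume a: "a \<in> atoms_of B (span Xs)"
  then obtain S where S: "S \<subseteq> {..<length Xs}" "a = C (U Xs S)" by (auto simp: atoms_of_def span_def)
  have "S \<noteq> {}" using a S by (auto simp: atoms_of_def bbot_eq)
  then obtain i where i: "i \<in> S" by auto
  then have "C (U Xs {i}) \<in> span Xs" "bool_le B (C (U Xs {i})) a"
    using S bool_le_U[OF assms, of "{i}" S] unfolding span_def by blast+
  then have "C (U Xs {i}) = C (U Xs {}) \<or> C (U Xs {i}) = a"
    using a by (auto simp: atoms_of_def bbot_eq)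
  moreover have "C (U Xs {i}) \<noteq> C (U Xs {})"
    using C_U_eq_iff[OF assms, of "{i}" "{}"] i S by auto
  ultimately show "a \<in> (\<lambda>i. C (Xs ! i)) ` {..<length Xs}" using i S by auto
next
  fix a assume "a \<in> (\<lambda>i. C (Xs ! i)) ` {..<length Xs}"
  then obtain i where i: "i < length Xs" "a = C (U Xs {i})" by auto
  have "a \<noteq> bbot B" using C_U_eq_iff[OF assms, of "{i}" "{}"] i by (auto simp: bbot_eq)
  moreover have "b = bbot B \<or> b = a" if "b \<in> span Xs" "bool_le B b a" for b
  proof -
    obtain T where T: "T \<subseteq> {..<length Xs}" "b = C (U Xs T)" using \<open>b \<in> span Xs\<close> by (auto simp: span_def)
    then have "T \<subseteq> {i}" using bool_le_U[OF assms, of T "{i}"] that i by auto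
    then have "T = {} \<or> T = {i}" by auto
    then show ?thesis using T i by (auto simp: bbot_eq)
  qed
  moreover have "a \<in> span Xs" unfolding span_def i(2) using i(1) by blast
  ultimately show "a \<in> atoms_of B (span Xs)" by (auto simp: atoms_of_def)
qed

text \<open>
  Each set loses its small intersections with the earlier ones, and the first set also receives the
  small remainder of \<open>K\<close>.
\<close>

lemma disjointify:
  fixes n :: nat
  assumes sub: "\<And>i. i < n \<Longrightarrow> X i \<subseteq> K" and large: "\<And>i. i < n \<Longrightarrow> \<not> small (X i)"
    and disj: "\<And>i j. i < n \<Longrightarrow> j < n \<Longrightarrow> i \<noteq> j \<Longrightarrow> small (X i \<inter> X j)"
    and cover: "small (K - (\<Union>i<n. X i))"
  shows "\<exists>Ys. part Ys \<and> length Ys = n \<and> (\<forall>i<n. C (Ys ! i) = C (X i))"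
proof -
  have "0 < n" using cover not_small_K by (cases n) auto
  define Y where "Y i = (X i - (\<Union>j<i. X j)) \<union> (if i = 0 then K - (\<Union>i<n. X i) else {})" for i
  have Ysub: "Y i \<subseteq> K" if "i < n" for i using sub[OF that] by (auto simp: Y_def)
  have eq: "C (Y i) = C (X i)" if "i < n" for i
  proof -
    have "sym_diff (Y i) (X i) \<subseteq> (\<Union>j<i. X i \<inter> X j) \<union> (K - (\<Union>i<n. X i))"
      by (auto simp: Y_def split: if_splits)
    moreover have "small (\<Union>j<i. X i \<inter> X j)" using that by (intro small_UN disj) auto
    ultimately have "small (sym_diff (Y i) (X i))"
      using cover small_Un small_subset by blast
    then show ?thesis using C_eq_iff[OF Ysub[OF that] sub[OF that]] by blast
  qed
  define Ys where "Ys = map Y [0..<n]"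
  have len: "length Ys = n" and nth: "\<And>i. i < n \<Longrightarrow> Ys ! i = Y i" by (auto simp: Ys_def)
  have dis: "Y i \<inter> Y j = {}" if "i < j" "j < n" for i j
    using that by (auto simp: Y_def)
  have "part Ys"
    unfolding part_def
  proof (intro conjI ballI allI impI)
    fix Z assume "Z \<in> set Ys"
    then obtain i where "i < n" "Z = Y i" by (auto simp: Ys_def)
    then show "\<not> small Z" using eq[of i] large[of i] sub[of i] Ysub[of i] C_eq_bot by metis
  next
    fix i j assume "i < length Ys" "j < length Ys" "i \<noteq> j"
    then show "Ys ! i \<inter> Ys ! j = {}" using dis[of i j] dis[of j i] len nth
      by (metis inf_commute linorder_neqE_nat)
  next
    have "x \<in> \<Union> (set Ys)" if "x \<in> K" for x
    proof (cases "\<exists>i<n. x \<in> X i")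
      case True
      define i where "i = (LEAST i. i < n \<and> x \<in> X i)"
      have "i < n" "x \<in> X i" using LeastI_ex[OF True] by (auto simp: i_def)
      moreover have "x \<notin> X j" if "j < i" for j
        using not_less_Least[of j "\<lambda>i. i < n \<and> x \<in> X i"] that \<open>i < n\<close> by (auto simp: i_def)
      ultimately have "x \<in> Y i" by (auto simp: Y_def)
      then show ?thesis using \<open>i < n\<close> by (auto simp: Ys_def)
    next
      case False
      then have "x \<in> Y 0" using that by (auto simp: Y_def)
      then show ?thesis using \<open>0 < n\<close> by (auto simp: Ys_def)
    qed
    moreover have "\<Union> (set Ys) \<subseteq> K" using Ysub by (force simp: Ys_def)
    ultimately show "\<Union> (set Ys) = K" by blast
  qed
  then show ?thesis using len eq nth by auto
qed

lemma subalgebra_Inter: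
  assumes A: "finite_subalgebra B A" and "finite F" "\<And>a. a \<in> F \<Longrightarrow> R a \<subseteq> K" "\<And>a. a \<in> F \<Longrightarrow> C (R a) \<in> A"
  shows "C (K \<inter> (\<Inter>a\<in>F. R a)) \<in> A"
  using assms(2-)
proof (induction F rule: finite_induct)
  case empty
  then show ?case using A by (auto simp: finite_subalgebra_def btop_eq)
next
  case (insert a F)
  have "bmeet B (C (R a)) (C (K \<inter> (\<Inter>a\<in>F. R a))) \<in> A"
    using insert A unfolding finite_subalgebra_def by blast
  also have "bmeet B (C (R a)) (C (K \<inter> (\<Inter>a\<in>F. R a))) = C (R a \<inter> (K \<inter> (\<Inter>a\<in>F. R a)))"
    using insert by (intro bmeet_C) auto
  also have "R a \<inter> (K \<inter> (\<Inter>a\<in>F. R a)) = K \<inter> (\<Inter>a\<in>insert a F. R a)" by auto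
  finally show ?case .
qed

lemma subalgebra_Union:
  assumes A: "finite_subalgebra B A" and "finite F" "\<And>a. a \<in> F \<Longrightarrow> R a \<subseteq> K" "\<And>a. a \<in> F \<Longrightarrow> C (R a) \<in> A"
  shows "C (\<Union>a\<in>F. R a) \<in> A"
  using assms(2-)
proof (induction F rule: finite_induct)
  case empty
  then show ?case using A by (auto simp: finite_subalgebra_def bbot_eq)
next
  case (insert a F)
  have "bjoin B (C (R a)) (C (\<Union>a\<in>F. R a)) \<in> A"
    using insert A unfolding finite_subalgebra_def by blast
  also have "bjoin B (C (R a)) (C (\<Union>a\<in>F. R a)) = C (R a \<union> (\<Union>a\<in>F. R a))"
    using insert by (intro bjoin_C) auto
  finally show ?case by simp
qed

text \<open>
  Representatives of the classes in \<open>F\<close> cut \<open>K\<close> into finitely many cells. The large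
  cells, after a small correction, form the partition. They are Boolean combinations of the
  representatives and so belong to every subalgebra that contains \<open>F\<close>.
\<close>

lemma finite_subset_in_span:
  assumes F: "finite F" "F \<subseteq> P"
  shows "\<exists>Ys. part Ys \<and> F \<subseteq> span Ys \<and> (\<forall>A. finite_subalgebra B A \<longrightarrow> F \<subseteq> A \<longrightarrow> span Ys \<subseteq> A)"
proof -
  have "\<forall>x\<in>F. \<exists>X. X \<subseteq> K \<and> C X = x" using F(2) by (auto simp: carrier_eq)
  then obtain R where R: "\<And>x. x \<in> F \<Longrightarrow> R x \<subseteq> K" "\<And>x. x \<in> F \<Longrightarrow> C (R x) = x" by metis
  define Q where "Q T a = (if a \<in> T then R a else K - R a)" for T a
  define cell where "cell T = K \<inter> (\<Inter>a\<in>F. Q T a)" for T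
  have cell_sub: "cell T \<subseteq> K" for T by (auto simp: cell_def)
  define L where "L = {T \<in> Pow F. \<not> small (cell T)}"
  have "finite L" using F by (auto simp: L_def)
  then obtain Ts where Ts: "set Ts = L" "distinct Ts" using finite_distinct_list by blast
  have cell_iff: "a \<in> T \<longleftrightarrow> x \<in> R a" if "x \<in> cell T" "a \<in> F" for a x T
    using that by (auto simp: cell_def Q_def split: if_splits)
  have cells_disj: "cell T \<inter> cell T' = {}" if "T \<subseteq> F" "T' \<subseteq> F" "T \<noteq> T'" for T T'
    using that cell_iff by blast
  have cell_at: "x \<in> cell {a\<in>F. x \<in> R a}" if "x \<in> K" for x
    using that by (auto simp: cell_def Q_def)
  have cover: "K - (\<Union>i<length Ts. cell (Ts ! i)) \<subseteq> (\<Union>T\<in>Pow F - L. cell T)"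
  proof
    fix x assume x: "x \<in> K - (\<Union>i<length Ts. cell (Ts ! i))"
    then have c: "x \<in> cell {a\<in>F. x \<in> R a}" using cell_at by auto
    have "{a\<in>F. x \<in> R a} \<notin> set Ts"
    proof
      assume "{a\<in>F. x \<in> R a} \<in> set Ts"
      then obtain i where i: "i < length Ts" "Ts ! i = {a\<in>F. x \<in> R a}"
        by (auto simp: in_set_conv_nth)
      have "x \<in> cell (Ts ! i)" unfolding i(2) by (rule c)
      then show False using x i(1) by blast
    qed
    then show "x \<in> (\<Union>T\<in>Pow F - L. cell T)" using c Ts by auto
  qed
  have "small (\<Union>T\<in>Pow F - L. cell T)"
    using F by (intro small_UN) (auto simp: L_def)
  with cover have "small (K - (\<Union>i<length Ts. cell (Ts ! i)))" using small_subset by blast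
  moreover have mem: "Ts ! i \<in> L" if "i < length Ts" for i using that Ts nth_mem by blast
  ultimately have "\<exists>Ys. part Ys \<and> length Ys = length Ts \<and> (\<forall>i<length Ts. C (Ys ! i) = C (cell (Ts ! i)))"
  proof (intro disjointify)
    fix i j assume ij: "i < length Ts" "j < length Ts" "i \<noteq> j"
    then have "Ts ! i \<noteq> Ts ! j" using Ts by (simp add: nth_eq_iff_index_eq)
    then have "cell (Ts ! i) \<inter> cell (Ts ! j) = {}"
      using mem[OF ij(1)] mem[OF ij(2)] by (intro cells_disj) (auto simp: L_def)
    then show "small (cell (Ts ! i) \<inter> cell (Ts ! j))" by simp
  qed (auto simp: L_def cell_sub)
  then obtain Ys where Ys: "part Ys" "length Ys = length Ts"
    "\<And>i. i < length Ts \<Longrightarrow> C (Ys ! i) = C (cell (Ts ! i))" by blast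
  have "a \<in> span Ys" if a: "a \<in> F" for a
  proof -
    define S where "S = {i. i < length Ts \<and> a \<in> Ts ! i}"
    have "finite S" by (simp add: S_def)
    have "C (U Ys S) = C (\<Union>i\<in>S. cell (Ts ! i))"
      unfolding U_def using Ys part_nth(1)[OF Ys(1)] cell_sub \<open>finite S\<close>
      by (intro C_UN_cong) (auto simp: S_def)
    also have "\<dots> = C (R a)"
    proof -
      have "(\<Union>i\<in>S. cell (Ts ! i)) \<subseteq> R a" using a by (auto simp: S_def cell_def Q_def split: if_splits)
      moreover have "R a - (\<Union>i\<in>S. cell (Ts ! i)) \<subseteq> K - (\<Union>i<length Ts. cell (Ts ! i))"
      proof
        fix x assume x: "x \<in> R a - (\<Union>i\<in>S. cell (Ts ! i))"
        then have "x \<notin> cell (Ts ! i)" if "i < length Ts" for i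
          using that a R(1)[OF a] by (cases "a \<in> Ts ! i") (auto simp: S_def cell_def Q_def)
        then show "x \<in> K - (\<Union>i<length Ts. cell (Ts ! i))" using x R(1)[OF a] by auto
      qed
      ultimately have "sym_diff (\<Union>i\<in>S. cell (Ts ! i)) (R a) \<subseteq> K - (\<Union>i<length Ts. cell (Ts ! i))"
        by blast
      then have "small (sym_diff (\<Union>i\<in>S. cell (Ts ! i)) (R a))"
        using \<open>small (K - _)\<close> small_subset by blast
      moreover have "(\<Union>i\<in>S. cell (Ts ! i)) \<subseteq> K" by (rule UN_least) (rule cell_sub)
      ultimately show ?thesis using R(1)[OF a] C_eq_iff by blast
    qed
    finally have "a = C (U Ys S)" using R(2)[OF a] by simp
    moreover have "S \<subseteq> {..<length Ys}" using Ys by (auto simp: S_def)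
    ultimately show ?thesis by (auto simp: span_def)
  qed
  moreover have "span Ys \<subseteq> A" if A: "finite_subalgebra B A" and FA: "F \<subseteq> A" for A
  proof
    have cellA: "C (cell T) \<in> A" for T
      unfolding cell_def
    proof (rule subalgebra_Inter[OF A F(1)])
      fix a assume a: "a \<in> F"
      show "Q T a \<subseteq> K" using R(1)[OF a] by (auto simp: Q_def)
      have "C (R a) \<in> A" using R(2)[OF a] a FA by auto
      moreover have "bcompl B (C (R a)) \<in> A" using calculation A by (auto simp: finite_subalgebra_def)
      ultimately show "C (Q T a) \<in> A" using R(1)[OF a] by (auto simp: Q_def)
    qed
    fix x assume "x \<in> span Ys"
    then obtain S where S: "S \<subseteq> {..<length Ys}" "x = C (U Ys S)" by (auto simp: span_def)
    have "finite S" using S(1) finite_subset by blast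
    show "x \<in> A" unfolding S(2) U_def
    proof (rule subalgebra_Union[OF A \<open>finite S\<close>])
      fix i assume "i \<in> S"
      then have "i < length Ys" using S(1) by auto
      then show "Ys ! i \<subseteq> K" "C (Ys ! i) \<in> A"
        using part_nth(1)[OF Ys(1)] Ys(2,3) cellA by simp_all
    qed
  qed
  ultimately show ?thesis using Ys(1) by blast
qed

lemma finite_subalgebra_eq_span:
  assumes "finite_subalgebra B A"
  shows "\<exists>Ys. part Ys \<and> A = span Ys"
  using finite_subset_in_span[of A] assms by (auto simp: finite_subalgebra_def)


section \<open>Automorphisms and homogeneity\<close>

lemma bool_ops_closed:
  "x \<in> P \<Longrightarrow> bcompl B x \<in> P" "x \<in> P \<Longrightarrow> y \<in> P \<Longrightarrow> bjoin B x y \<in> P"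
  "x \<in> P \<Longrightarrow> y \<in> P \<Longrightarrow> bmeet B x y \<in> P" "bbot B \<in> P" "btop B \<in> P"
  by (auto elim!: P_cases simp: bbot_eq btop_eq intro!: C_in_P)

lemma carrier_G: "carrier G = automorphisms lam kap"
  by (simp add: Aut_def)

lemma automorphisms_Bij: "f \<in> automorphisms lam kap \<Longrightarrow> f \<in> Bij P"
  by (simp add: automorphisms_def bool_automorphisms_def)

lemma automorphisms_subgroup: "subgroup (automorphisms lam kap) (BijGroup P)"
proof (rule group.subgroupI[OF group_BijGroup])
  show "automorphisms lam kap \<subseteq> carrier (BijGroup P)"
    using automorphisms_Bij by (auto simp: BijGroup_def)
  have "(\<lambda>x\<in>P. x) \<in> automorphisms lam kap"
    using bool_ops_closed by (auto simp: automorphisms_def bool_automorphisms_def id_Bij)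
  then show "automorphisms lam kap \<noteq> {}" by auto
next
  fix f assume f: "f \<in> automorphisms lam kap"
  have fB: "f \<in> Bij P" by (rule automorphisms_Bij[OF f])
  then have bij: "bij_betw f P P" by (simp add: Bij_def)
  define h where "h = inv_into P f"
  have fh: "f (h x) = x" "h x \<in> P" if "x \<in> P" for x
    using that bij by (auto simp: h_def bij_betw_inv_into_right bij_betw_def inv_into_into)
  have eqI: "h x = y" if "y \<in> P" "f y = x" for x y
    using that bij by (auto simp: h_def bij_betw_inv_into_left)
  have "restrict h P \<in> automorphisms lam kap"
    unfolding automorphisms_def bool_automorphisms_def mem_Collect_eq
  proof (intro conjI ballI)
    show "restrict h P \<in> Bij P" unfolding h_def using fB by (rule restrict_inv_into_Bij)
    have f_ops: "f (bbot B) = bbot B" "f (btop B) = btop B"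
      "\<And>x. x \<in> P \<Longrightarrow> f (bcompl B x) = bcompl B (f x)"
      "\<And>x y. x \<in> P \<Longrightarrow> y \<in> P \<Longrightarrow> f (bjoin B x y) = bjoin B (f x) (f y)"
      "\<And>x y. x \<in> P \<Longrightarrow> y \<in> P \<Longrightarrow> f (bmeet B x y) = bmeet B (f x) (f y)"
      using f by (auto simp: automorphisms_def bool_automorphisms_def)
    show "restrict h P (bbot B) = bbot B" "restrict h P (btop B) = btop B"
      using bool_ops_closed f_ops by (auto intro!: eqI)
    show "restrict h P (bcompl B x) = bcompl B (restrict h P x)" if "x \<in> P" for x
      using bool_ops_closed f_ops that fh by (auto intro!: eqI)
    show "restrict h P (bjoin B x y) = bjoin B (restrict h P x) (restrict h P y)"
      "restrict h P (bmeet B x y) = bmeet B (restrict h P x) (restrict h P y)"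
      if "x \<in> P" "y \<in> P" for x y
      using bool_ops_closed f_ops that fh by (auto intro!: eqI)
    show "restrict h P x \<in> level lam kap mu \<longleftrightarrow> x \<in> level lam kap mu"
      if "mu \<in> cards_between lam kap" "x \<in> P" for mu x
    proof -
      have "f (h x) \<in> level lam kap mu \<longleftrightarrow> h x \<in> level lam kap mu"
        using f that(1) fh(2)[OF that(2)] unfolding automorphisms_def by blast
      then show ?thesis using that fh[OF that(2)] by simp
    qed
  qed
  then show "inv\<^bsub>BijGroup P\<^esub> f \<in> automorphisms lam kap"
    using inv_BijGroup[OF fB] by (simp add: h_def restrict_def)
next
  fix f g assume f: "f \<in> automorphisms lam kap" and g: "g \<in> automorphisms lam kap"
  have fg: "f \<in> Bij P" "g \<in> Bij P" using f g automorphisms_Bij by auto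
  then have gP: "g x \<in> P" if "x \<in> P" for x using that Bij_imp_funcset by fastforce
  have "compose P f g \<in> automorphisms lam kap"
    using f g gP bool_ops_closed compose_Bij[OF fg]
    by (simp add: automorphisms_def bool_automorphisms_def compose_eq)
  then show "f \<otimes>\<^bsub>BijGroup P\<^esub> g \<in> automorphisms lam kap"
    using fg by (simp add: BijGroup_def)
qed

lemma group_G: "group G"
  unfolding Aut_def
  by (rule subgroup.subgroup_is_group[OF automorphisms_subgroup group_BijGroup])

lemma G_Bij: "g \<in> carrier G \<Longrightarrow> g \<in> Bij P"
  unfolding carrier_G by (rule automorphisms_Bij)

lemma G_closed [simp]: "g \<in> carrier G \<Longrightarrow> x \<in> P \<Longrightarrow> g x \<in> P"
  using G_Bij Bij_imp_funcset by fastforce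

lemma G_mult: "g \<in> carrier G \<Longrightarrow> h \<in> carrier G \<Longrightarrow> g \<otimes>\<^bsub>G\<^esub> h = compose P g h"
  using G_Bij[of g] G_Bij[of h] unfolding Aut_def BijGroup_def by simp

lemma G_mult_apply: "g \<in> carrier G \<Longrightarrow> h \<in> carrier G \<Longrightarrow> x \<in> P \<Longrightarrow> (g \<otimes>\<^bsub>G\<^esub> h) x = g (h x)"
  by (simp add: G_mult compose_eq)

lemma G_one_apply: "x \<in> P \<Longrightarrow> \<one>\<^bsub>G\<^esub> x = x"
  by (simp add: Aut_def BijGroup_def)

lemma G_inv_closed [simp]: "g \<in> carrier G \<Longrightarrow> inv\<^bsub>G\<^esub> g \<in> carrier G"
  by (rule group.inv_closed[OF group_G])

lemma G_mult_closed [simp]: "g \<in> carrier G \<Longrightarrow> h \<in> carrier G \<Longrightarrow> g \<otimes>\<^bsub>G\<^esub> h \<in> carrier G"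
  using group.is_monoid[OF group_G] by (rule monoid.m_closed)

lemma G_one_closed [simp]: "\<one>\<^bsub>G\<^esub> \<in> carrier G"
  using group.is_monoid[OF group_G] by (rule monoid.one_closed)

lemma G_inv_left: "g \<in> carrier G \<Longrightarrow> x \<in> P \<Longrightarrow> (inv\<^bsub>G\<^esub> g) (g x) = x"
  using G_mult_apply[of "inv\<^bsub>G\<^esub> g" g x] group.l_inv[OF group_G, of g] by (simp add: G_one_apply)

lemma G_inv_right: "g \<in> carrier G \<Longrightarrow> x \<in> P \<Longrightarrow> g ((inv\<^bsub>G\<^esub> g) x) = x"
  using G_mult_apply[of g "inv\<^bsub>G\<^esub> g" x] group.r_inv[OF group_G, of g] by (simp add: G_one_apply)

lemma G_Un:
  assumes "g \<in> carrier G" "X \<subseteq> K" "Y \<subseteq> K" "X' \<subseteq> K" "Y' \<subseteq> K" "g (C X) = C X'" "g (C Y) = C Y'"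
  shows "g (C (X \<union> Y)) = C (X' \<union> Y')"
proof -
  have "g (bjoin B (C X) (C Y)) = bjoin B (g (C X)) (g (C Y))"
    using assms(1-3) C_in_P by (auto simp: carrier_G automorphisms_def bool_automorphisms_def simp del: bjoin_C)
  then show ?thesis using assms by simp
qed

lemma G_Int:
  assumes "g \<in> carrier G" "X \<subseteq> K" "Y \<subseteq> K" "X' \<subseteq> K" "Y' \<subseteq> K" "g (C X) = C X'" "g (C Y) = C Y'"
  shows "g (C (X \<inter> Y)) = C (X' \<inter> Y')"
proof -
  have "g (bmeet B (C X) (C Y)) = bmeet B (g (C X)) (g (C Y))"
    using assms(1-3) C_in_P by (auto simp: carrier_G automorphisms_def bool_automorphisms_def simp del: bmeet_C)
  then show ?thesis using assms by simp
qed

lemma G_Compl: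
  assumes "g \<in> carrier G" "X \<subseteq> K" "X' \<subseteq> K" "g (C X) = C X'"
  shows "g (C (K - X)) = C (K - X')"
proof -
  have "g (bcompl B (C X)) = bcompl B (g (C X))"
    using assms(1,2) C_in_P by (auto simp: carrier_G automorphisms_def bool_automorphisms_def simp del: bcompl_C)
  then show ?thesis using assms by simp
qed

lemma G_Diff:
  assumes "g \<in> carrier G" "X \<subseteq> K" "Y \<subseteq> K" "X' \<subseteq> K" "Y' \<subseteq> K" "g (C X) = C X'" "g (C Y) = C Y'"
  shows "g (C (X - Y)) = C (X' - Y')"
proof -
  have "X - Y = X \<inter> (K - Y)" "X' - Y' = X' \<inter> (K - Y')" using assms by auto
  then show ?thesis using assms G_Compl[of g Y Y'] by (metis Diff_subset G_Int)
qed

lemma G_empty: "g \<in> carrier G \<Longrightarrow> g (C {}) = C {}"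
  by (simp add: carrier_G automorphisms_def bool_automorphisms_def bbot_eq)

lemma G_top: "g \<in> carrier G \<Longrightarrow> g (C K) = C K"
  by (simp add: carrier_G automorphisms_def bool_automorphisms_def btop_eq)

lemma G_inj: "g \<in> carrier G \<Longrightarrow> x \<in> P \<Longrightarrow> y \<in> P \<Longrightarrow> g x = g y \<longleftrightarrow> x = y"
  using G_inv_left by metis

lemma G_UN:
  assumes "g \<in> carrier G" "finite I" "\<And>i. i \<in> I \<Longrightarrow> X i \<subseteq> K" "\<And>i. i \<in> I \<Longrightarrow> Y i \<subseteq> K"
    "\<And>i. i \<in> I \<Longrightarrow> g (C (X i)) = C (Y i)"
  shows "g (C (\<Union>i\<in>I. X i)) = C (\<Union>i\<in>I. Y i)"
  using assms(2-)
proof (induction I rule: finite_induct)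
  case (insert i I)
  then have "g (C (X i \<union> (\<Union>i\<in>I. X i))) = C (Y i \<union> (\<Union>i\<in>I. Y i))"
    by (intro G_Un[OF assms(1)] UN_least) (simp_all add: insertI2)
  then show ?case by simp
qed (use G_empty[OF assms(1)] in simp)

lemma G_lab:
  assumes "g \<in> carrier G" "X \<subseteq> K" "Y \<subseteq> K" "g (C X) = C Y"
  shows "lab Y = lab X"
proof -
  have "mu \<in> lab Y \<longleftrightarrow> mu \<in> lab X" if "mu \<in> cards_between lam kap" for mu
  proof -
    have "g (C X) \<in> level lam kap mu \<longleftrightarrow> C X \<in> level lam kap mu"
      using assms(1) that C_in_P[OF assms(2)] by (simp add: carrier_G automorphisms_def)
    then show ?thesis
      using level_iff[OF assms(2) that] level_iff[OF assms(3) that] assms(4) by simp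
  qed
  then show ?thesis using lab_sub by blast
qed

lemma G_small: "g \<in> carrier G \<Longrightarrow> X \<subseteq> K \<Longrightarrow> Y \<subseteq> K \<Longrightarrow> g (C X) = C Y \<Longrightarrow> small Y \<longleftrightarrow> small X"
  using G_inj[of g "C X" "C {}"] G_empty[of g] C_eq_bot[of X] C_eq_bot[of Y] by auto

lemma automorphism_of_bij:
  assumes F: "bij_betw F K K"
  shows "\<exists>g\<in>carrier G. \<forall>X. X \<subseteq> K \<longrightarrow> g (C X) = C (F ` X)"
proof -
  have img: "F ` X \<subseteq> K" if "X \<subseteq> K" for X using F that by (auto simp: bij_betw_def)
  have injF: "inj_on F K" using F by (simp add: bij_betw_def)
  have small_img: "small (F ` X) \<longleftrightarrow> small X" if "X \<subseteq> K" for X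
  proof -
    have "|F ` X| =o |X|"
      using that injF by (metis card_of_ordIsoI inj_on_imp_bij_betw inj_on_subset ordIso_symmetric)
    then show ?thesis unfolding small_def
      by (meson ordIso_ordLess_trans ordIso_symmetric)
  qed
  have sd: "F ` (sym_diff X Y) = sym_diff (F ` X) (F ` Y)" if "X \<subseteq> K" "Y \<subseteq> K" for X Y
    using that injF inj_on_image_set_diff[of F K X Y] inj_on_image_set_diff[of F K Y X]
    by (simp add: image_Un Diff_subset[THEN subset_trans])
  have eq: "C (F ` X) = C (F ` Y) \<longleftrightarrow> C X = C Y" if "X \<subseteq> K" "Y \<subseteq> K" for X Y
  proof -
    have "sym_diff X Y \<subseteq> K" using that by auto
    then show ?thesis
      using small_img[of "sym_diff X Y"] C_eq_iff[OF img[OF that(1)] img[OF that(2)]] C_eq_iff[OF that]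
      unfolding sd[OF that] by blast
  qed
  define g where "g = (\<lambda>x\<in>P. C (F ` (SOME X. X \<subseteq> K \<and> C X = x)))"
  have g: "g (C X) = C (F ` X)" if "X \<subseteq> K" for X
  proof -
    have "(SOME Y. Y \<subseteq> K \<and> C Y = C X) \<subseteq> K \<and> C (SOME Y. Y \<subseteq> K \<and> C Y = C X) = C X"
      by (rule someI[of _ X]) (use that in simp)
    then show ?thesis using that eq by (simp add: g_def)
  qed
  have "bij_betw g P P"
    unfolding bij_betw_def
  proof
    show "inj_on g P"
      using g eq by (auto simp: inj_on_def elim!: P_cases)
    have "C Y \<in> g ` P" if "Y \<subseteq> K" for Y
    proof -
      have "Y = F ` (inv_into K F ` Y)" "inv_into K F ` Y \<subseteq> K"
        using F that by (auto simp: bij_betw_def image_inv_into_cancel inv_into_into subset_iff)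
      then show ?thesis using g C_in_P by (metis imageI)
    qed
    then show "g ` P = P" using g img by (auto elim!: P_cases)
  qed
  then have "g \<in> Bij P" by (simp add: Bij_def g_def)
  moreover have "F ` (K - X) = K - F ` X" if "X \<subseteq> K" for X
    using inj_on_image_set_diff[OF injF, of K X] that F by (simp add: bij_betw_def)
  moreover have "F ` (X \<inter> Y) = F ` X \<inter> F ` Y" if "X \<subseteq> K" "Y \<subseteq> K" for X Y
    using that injF by (rule inj_on_image_Int[rotated])
  moreover have "F ` K = K" using F by (simp add: bij_betw_def)
  moreover have "lab (F ` X) = lab X" if "X \<subseteq> K" for X
    by (rule lab_image[OF inj_on_subset[OF injF that]])
  ultimately have "g \<in> automorphisms lam kap"
    unfolding automorphisms_def bool_automorphisms_def
    by (auto elim!: P_cases simp: g img bbot_eq btop_eq level_iff image_Un Int_lower1 le_infI1)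
  then show ?thesis using g carrier_G by blast
qed

text \<open>
  Pieces with the same label have the same cardinality. Bijections between corresponding pieces
  unite to a permutation of \<open>K\<close>, and this permutation induces the automorphism.
\<close>

lemma homogeneous:
  assumes "part Xs" "part Ys" "map lab Xs = map lab Ys"
  shows "\<exists>g\<in>carrier G. \<forall>S\<subseteq>{..<length Xs}. g (C (U Xs S)) = C (U Ys S)"
proof -
  have len: "length Ys = length Xs" using assms(3) by (metis length_map)
  have "\<exists>f. bij_betw f (Xs ! i) (Ys ! i)" if "i < length Xs" for i
  proof -
    have "lab (Xs ! i) = lab (Ys ! i)" using assms(3) that len by (metis nth_map)
    then have "|Xs ! i| =o |Ys ! i|"
      using that len part_nth[OF assms(1)] part_nth[OF assms(2)] by (intro lab_eq_imp_card_eq) auto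
    then show ?thesis by (simp add: card_of_ordIso)
  qed
  then obtain f where f: "\<And>i. i < length Xs \<Longrightarrow> bij_betw (f i) (Xs ! i) (Ys ! i)" by metis
  define ix where "ix x = (THE i. i < length Xs \<and> x \<in> Xs ! i)" for x
  have ix: "ix x = i" if "i < length Xs" "x \<in> Xs ! i" for i x
    unfolding ix_def using that part_disjoint[OF assms(1)] by (intro the_equality) auto
  define F where "F x = f (ix x) x" for x
  have F: "F ` (Xs ! i) = Ys ! i" "inj_on F (Xs ! i)" if "i < length Xs" for i
  proof -
    have "bij_betw F (Xs ! i) (Ys ! i)"
      using f[OF that] ix[OF that] by (subst bij_betw_cong[where g = "f i"]) (auto simp: F_def)
    then show "F ` (Xs ! i) = Ys ! i" "inj_on F (Xs ! i)" by (auto simp: bij_betw_def)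
  qed
  have FU: "F ` U Xs S = U Ys S" if "S \<subseteq> {..<length Xs}" for S
    using that F(1) unfolding U_def image_UN by (intro SUP_cong) auto
  have "inj_on F K"
  proof (rule inj_onI)
    fix x y assume xy: "x \<in> K" "y \<in> K" "F x = F y"
    then obtain i j where ij: "i < length Xs" "x \<in> Xs ! i" "j < length Xs" "y \<in> Xs ! j"
      using part_U_all[OF assms(1)] unfolding U_def by blast
    then have "F x \<in> Ys ! i" "F y \<in> Ys ! j" using F(1) by blast+
    then have "F x \<in> Ys ! i" "F x \<in> Ys ! j" using xy(3) by simp_all
    then have "i = j" using part_disjoint[OF assms(2)] ij len by auto
    then show "x = y" using F(2) ij xy(3) by (auto simp: inj_on_def)
  qed
  moreover have "F ` K = K"
    using FU[of "{..<length Xs}"] part_U_all[OF assms(1)] part_U_all[OF assms(2)] len by simp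
  ultimately have "bij_betw F K K" by (simp add: bij_betw_def)
  from automorphism_of_bij[OF this] obtain g
    where g: "g \<in> carrier G" "\<And>X. X \<subseteq> K \<Longrightarrow> g (C X) = C (F ` X)" by blast
  then have "\<forall>S\<subseteq>{..<length Xs}. g (C (U Xs S)) = C (U Ys S)"
    using U_sub[OF assms(1)] FU by simp
  with g(1) show ?thesis by blast
qed

text \<open>
  Disjoint copies of finitely many subsets of the infinite set \<open>K\<close> fit into \<open>K\<close>. Some piece of
  a finite partition has full size; by convention it is the first one.
\<close>

lemma realize_labels:
  assumes "c \<noteq> []" "c ! 0 = lab K" "\<And>l. l \<in> set c \<Longrightarrow> \<exists>Z\<subseteq>K. \<not> small Z \<and> lab Z = l"
  shows "\<exists>Xs. part Xs \<and> map lab Xs = c"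
proof -
  let ?n = "length c"
  have "\<exists>Z. \<forall>i<?n. Z i \<subseteq> K \<and> \<not> small (Z i) \<and> lab (Z i) = c ! i"
    by (intro choice allI) (meson assms(3) nth_mem)
  then obtain Z where Z: "\<And>i. i < ?n \<Longrightarrow> Z i \<subseteq> K" "\<And>i. i < ?n \<Longrightarrow> \<not> small (Z i)"
    "\<And>i. i < ?n \<Longrightarrow> lab (Z i) = c ! i" by metis
  have infK: "\<not> finite K" using Cinfinite_kap by (auto simp: cinfinite_def)
  have "|{..<?n}| \<le>o |K|"
    using infK by (meson card_of_ordLeq_infinite finite_lessThan ordLeq_total card_of_Well_order)
  then have "|{..<?n} \<times> K| =o |K|"
    using card_of_Times_infinite[OF infK, of "{..<?n}"] assms(1) by auto
  then obtain b where b: "bij_betw b ({..<?n} \<times> K) K" by (auto simp: card_of_ordIso[symmetric])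
  have inj: "inj_on (\<lambda>x. b (i, x)) K" if "i < ?n" for i
    using b that by (auto simp: bij_betw_def inj_on_def)
  define W where "W i = (\<lambda>x. b (i, x)) ` Z i" for i
  have WK: "W i \<subseteq> K" if "i < ?n" for i
    using b Z(1)[OF that] that by (auto simp: W_def bij_betw_def)
  have labW: "lab (W i) = c ! i" if "i < ?n" for i
    unfolding W_def using Z that inj by (metis inj_on_subset lab_image)
  have disjW: "W i \<inter> W j = {}" if "i < ?n" "j < ?n" "i \<noteq> j" for i j
  proof -
    have "b (i, x) \<noteq> b (j, y)" if "x \<in> Z i" "y \<in> Z j" for x y
      using b that Z(1) \<open>i < ?n\<close> \<open>j < ?n\<close> \<open>i \<noteq> j\<close> unfolding bij_betw_def inj_on_def by blast
    then show ?thesis by (auto simp: W_def)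
  qed
  have smallW: "\<not> small (W i)" if "i < ?n" for i
  proof
    assume "small (W i)"
    then have "lab (W i) = cards_between lam kap" by (rule lab_small)
    moreover have "|Z i| \<in> lab (Z i)" "|Z i| \<le>o |W i|"
      using card_of_mem_lab[OF Z(1,2)[OF that]] inj_on_subset[OF inj[OF that] Z(1)[OF that]]
      by (auto simp: W_def intro!: card_of_ordLeqI)
    ultimately show False using \<open>small (W i)\<close> Z(2)[OF that]
      unfolding small_def using ordLeq_ordLess_trans by blast
  qed
  \<comment> \<open>the largest piece also absorbs what the other pieces leave over\<close>
  define X where "X i = (if i = 0 then K - (\<Union>j\<in>{0<..<?n}. W j) else W i)" for i
  have n0: "0 < ?n" using assms(1) by auto
  have W0: "W 0 \<subseteq> X 0" using WK[OF n0] disjW[OF n0] by (fastforce simp: X_def)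
  have "lab (X 0) = lab K"
    using lab_mono[OF W0] lab_mono[of "X 0" K] labW[OF n0] assms(2) by (auto simp: X_def)
  then have labX: "lab (X i) = c ! i" if "i < ?n" for i
    using that labW assms(2) by (cases "i = 0") (auto simp: X_def)
  define Xs where "Xs = map X [0..<?n]"
  have "part Xs"
    unfolding part_def
  proof (intro conjI ballI allI impI)
    fix Y assume "Y \<in> set Xs"
    then obtain i where i: "i < ?n" "Y = X i" by (auto simp: Xs_def)
    then have "W i \<subseteq> Y" using W0 by (auto simp: X_def split: if_splits)
    then show "\<not> small Y" using smallW[OF i(1)] small_subset by blast
  next
    fix i j assume "i < length Xs" "j < length Xs" "i \<noteq> j"
    then show "Xs ! i \<inter> Xs ! j = {}" using disjW[of i j] by (auto simp: Xs_def X_def)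
  next
    have "K \<subseteq> (\<Union>i<?n. X i)"
    proof
      fix x assume x: "x \<in> K"
      show "x \<in> (\<Union>i<?n. X i)"
      proof (cases "x \<in> X 0")
        case False
        then obtain j where "j \<in> {0<..<?n}" "x \<in> W j" using x by (auto simp: X_def)
        then show ?thesis by (auto simp: X_def intro!: bexI[of _ j])
      qed (use n0 in auto)
    qed
    moreover have "X i \<subseteq> K" if "i < ?n" for i using WK[OF that] by (auto simp: X_def)
    ultimately show "\<Union> (set Xs) = K" by (fastforce simp: Xs_def)
  qed
  moreover have "map lab Xs = c"
    using labX by (intro nth_equalityI) (auto simp: Xs_def)
  ultimately show ?thesis by blast
qed

end

section \<open>Natural orderings\<close>

lemma sorted_enumeration:
  assumes "finite S" "\<And>x y z. x \<in> S \<Longrightarrow> y \<in> S \<Longrightarrow> z \<in> S \<Longrightarrow> R x y \<Longrightarrow> R y z \<Longrightarrow> R x z"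
    "\<And>x y. x \<in> S \<Longrightarrow> y \<in> S \<Longrightarrow> x \<noteq> y \<Longrightarrow> R x y \<or> R y x"
  shows "\<exists>xs. distinct xs \<and> set xs = S \<and> sorted_wrt R xs"
  using assms
proof (induction S rule: finite_induct)
  case (insert x S)
  have "\<exists>xs. distinct xs \<and> set xs = S \<and> sorted_wrt R xs"
    by (rule insert.IH) (use insert.prems in blast)+
  then obtain xs where xs: "distinct xs" "set xs = S" "sorted_wrt R xs" by blast
  let ?ys = "filter (\<lambda>y. R y x) xs @ [x] @ filter (\<lambda>y. \<not> R y x) xs"
  have *: "R x y" if "y \<in> S" "\<not> R y x" for y
    using insert.prems(2)[of x y] insert.hyps that by auto
  have "R y z" if "y \<in> S" "R y x" "z \<in> S" "\<not> R z x" for y z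
    using insert.prems(1)[of y x z] *[of z] that by auto
  then have "sorted_wrt R ?ys"
    using xs * by (auto simp: sorted_wrt_append sorted_wrt_filter)
  moreover have "distinct ?ys" "set ?ys = insert x S" using xs insert.hyps by auto
  ultimately show ?case by blast
qed simp

lemma sorted_wrt_le_unique:
  fixes xs ys :: "'l :: order list"
  assumes "sorted_wrt (\<le>) xs" "sorted_wrt (\<le>) ys" "mset xs = mset ys"
  shows "xs = ys"
  using assms
proof (induction xs arbitrary: ys)
  case (Cons x xs)
  then obtain y ys' where ys: "ys = y # ys'" by (cases ys) auto
  have "x \<in> set ys" "y \<in> set (x # xs)"
    using Cons.prems(3) ys by (metis list.set_intros(1) set_mset_mset)+
  then have "x \<le> y" "y \<le> x" using Cons.prems(1,2) ys by auto
  then have "x = y" by simp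
  then show ?case using Cons ys by auto
qed simp

text \<open>
  The antilexicographical ordering for the sets of indices of the atoms below two elements.
\<close>

definition antilex_less :: "nat set \<Rightarrow> nat set \<Rightarrow> bool" where
  "antilex_less S T \<longleftrightarrow> (\<exists>m. m \<in> T \<and> m \<notin> S \<and> (\<forall>k>m. k \<in> S \<longleftrightarrow> k \<in> T))"

lemma antilex_less_iff_Max:
  assumes "finite S" "finite T"
  shows "antilex_less S T \<longleftrightarrow> S \<noteq> T \<and> Max (sym_diff S T) \<in> T"
proof
  assume "antilex_less S T"
  then obtain m where m: "m \<in> T" "m \<notin> S" "\<And>k. k > m \<Longrightarrow> k \<in> S \<longleftrightarrow> k \<in> T"
    by (auto simp: antilex_less_def)
  have "Max (sym_diff S T) = m"
    using assms m by (intro Max_eqI) (auto simp: not_less[symmetric])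
  then show "S \<noteq> T \<and> Max (sym_diff S T) \<in> T" using m by auto
next
  assume ST: "S \<noteq> T \<and> Max (sym_diff S T) \<in> T"
  have fin: "finite (sym_diff S T)" and ne: "sym_diff S T \<noteq> {}" using assms ST by auto
  have "Max (sym_diff S T) \<in> sym_diff S T" using Max_in[OF fin ne] .
  moreover have "k \<notin> sym_diff S T" if "k > Max (sym_diff S T)" for k
    using Max_ge[OF fin, of k] that by auto
  ultimately show "antilex_less S T" unfolding antilex_less_def using ST by blast
qed

lemma antilex_less_linear:
  assumes "finite S" "finite T" "S \<noteq> T"
  shows "antilex_less S T \<or> antilex_less T S"
proof -
  have "Max (sym_diff S T) \<in> sym_diff S T" using assms by (intro Max_in) auto
  then show ?thesis using assms antilex_less_iff_Max[of S T] antilex_less_iff_Max[of T S]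
    by (auto simp: Un_commute)
qed

lemma antilex_less_irrefl: "\<not> antilex_less S S"
  by (auto simp: antilex_less_def)

lemma antilex_less_trans: "antilex_less S T \<Longrightarrow> antilex_less T V \<Longrightarrow> antilex_less S V"
proof -
  assume "antilex_less S T" "antilex_less T V"
  then obtain m n where m: "m \<in> T" "m \<notin> S" "\<And>k. k > m \<Longrightarrow> k \<in> S \<longleftrightarrow> k \<in> T"
    and n: "n \<in> V" "n \<notin> T" "\<And>k. k > n \<Longrightarrow> k \<in> T \<longleftrightarrow> k \<in> V"
    unfolding antilex_less_def by blast
  have "max m n \<in> V" "max m n \<notin> S"
    using m n by (cases m n rule: linorder_cases; auto simp: max_def)+
  moreover have "k \<in> S \<longleftrightarrow> k \<in> V" if "k > max m n" for k using that m(3) n(3) by simp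
  ultimately show ?thesis unfolding antilex_less_def by blast
qed

context cardinal_quotient
begin

lemma C_Diff_cong:
  assumes "C X = C X'" "C Y = C Y'" "X \<subseteq> K" "X' \<subseteq> K" "Y \<subseteq> K" "Y' \<subseteq> K"
  shows "C (X - Y) = C (X' - Y')"
proof -
  have "X - Y = X \<inter> (K - Y)" "X' - Y' = X' \<inter> (K - Y')" using assms by auto
  then show ?thesis using C_Int_cong[OF assms(1) C_Compl_cong[OF assms(2,5,6)]] assms by auto
qed

lemma part_iff_set:
  "part Xs \<longleftrightarrow> distinct Xs \<and> (\<forall>X\<in>set Xs. \<not> small X) \<and>
     (\<forall>X\<in>set Xs. \<forall>Y\<in>set Xs. X \<noteq> Y \<longrightarrow> X \<inter> Y = {}) \<and> \<Union> (set Xs) = K"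
proof
  assume p: "part Xs"
  have "distinct Xs"
    using part_disjoint[OF p] part_nth(3)[OF p] by (fastforce simp: distinct_conv_nth)
  moreover have "X \<inter> Y = {}" if XY: "X \<in> set Xs" "Y \<in> set Xs" "X \<noteq> Y" for X Y
  proof -
    obtain i j where "i < length Xs" "X = Xs ! i" "j < length Xs" "Y = Xs ! j"
      using XY by (metis in_set_conv_nth)
    then show ?thesis using part_disjoint[OF p, of i j] XY(3) by auto
  qed
  ultimately show "distinct Xs \<and> (\<forall>X\<in>set Xs. \<not> small X) \<and>
     (\<forall>X\<in>set Xs. \<forall>Y\<in>set Xs. X \<noteq> Y \<longrightarrow> X \<inter> Y = {}) \<and> \<Union> (set Xs) = K"
    using p by (auto simp: part_def)
next
  assume "distinct Xs \<and> (\<forall>X\<in>set Xs. \<not> small X) \<and>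
     (\<forall>X\<in>set Xs. \<forall>Y\<in>set Xs. X \<noteq> Y \<longrightarrow> X \<inter> Y = {}) \<and> \<Union> (set Xs) = K"
  then show "part Xs" unfolding part_def by (metis nth_eq_iff_index_eq nth_mem)
qed

lemma part_perm: "part Xs \<Longrightarrow> distinct Ys \<Longrightarrow> set Ys = set Xs \<Longrightarrow> part Ys"
  by (simp add: part_iff_set)

lemma span_set: "span Xs = {C (\<Union> F) | F. F \<subseteq> set Xs}"
proof -
  have 1: "U Xs S = \<Union> ((!) Xs ` S)" for S by (simp add: U_def)
  have 2: "(!) Xs ` S \<subseteq> set Xs" if "S \<subseteq> {..<length Xs}" for S using that by auto
  have 3: "\<exists>S\<subseteq>{..<length Xs}. (!) Xs ` S = F" if "F \<subseteq> set Xs" for F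
  proof -
    have "set Xs = (!) Xs ` {..<length Xs}" by (auto simp: set_conv_nth)
    then have "F \<subseteq> (!) Xs ` {..<length Xs}" using that by simp
    then show ?thesis unfolding subset_image_iff by blast
  qed
  show ?thesis
  proof (intro equalityI subsetI)
    fix x assume "x \<in> span Xs"
    then obtain S where S: "S \<subseteq> {..<length Xs}" "x = C (\<Union> ((!) Xs ` S))"
      unfolding span_def 1 by blast
    then show "x \<in> {C (\<Union> F) | F. F \<subseteq> set Xs}" using 2[OF S(1)] by blast
  next
    fix x assume "x \<in> {C (\<Union> F) | F. F \<subseteq> set Xs}"
    then obtain F where F: "F \<subseteq> set Xs" "x = C (\<Union> F)" by blast
    from 3[OF F(1)] obtain S where "S \<subseteq> {..<length Xs}" "(!) Xs ` S = F" by blast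
    then show "x \<in> span Xs" unfolding span_def 1 F(2) by blast
  qed
qed

lemma span_perm: "set Ys = set Xs \<Longrightarrow> span Ys = span Xs"
  by (simp add: span_set)

lemma inj_C_part:
  assumes "part Xs" shows "inj_on C (set Xs)"
proof (rule inj_onI)
  fix X Y assume XY: "X \<in> set Xs" "Y \<in> set Xs" "C X = C Y"
  obtain i j where ij: "i < length Xs" "X = Xs ! i" "j < length Xs" "Y = Xs ! j"
    using XY by (metis in_set_conv_nth)
  then have "C (U Xs {i}) = C (U Xs {j})" using XY(3) by simp
  then show "X = Y" using C_U_eq_iff[OF assms, of "{i}" "{j}"] ij by auto
qed

lemma finite_idx: "S \<subseteq> {..<length Xs} \<Longrightarrow> finite S"
  using finite_subset by blast

text \<open>
  Naturality on all finite subalgebras is equivalent to these conditions on at most three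
  elements. In this form it is evidently a closed and invariant property of an ordering.
\<close>

definition natural_at :: "('a set set \<times> 'a set set \<Rightarrow> bool) \<Rightarrow> 'a set \<Rightarrow> 'a set \<Rightarrow> 'a set \<Rightarrow> bool" where
  "natural_at r X Y Z \<longleftrightarrow>
     \<not> r (C X, C X) \<and>
     (r (C X, C Y) \<longrightarrow> r (C Y, C Z) \<longrightarrow> r (C X, C Z)) \<and>
     (C X \<noteq> C Y \<longrightarrow> r (C X, C Y) \<or> r (C Y, C X)) \<and>
     (\<not> small X \<longrightarrow> r (C {}, C X)) \<and>
     (r (C X, C Y) \<longleftrightarrow> r (C (X - Y), C (Y - X))) \<and>
     (X \<inter> Z = {} \<longrightarrow> Y \<inter> Z = {} \<longrightarrow> r (C X, C Z) \<longrightarrow> r (C Y, C Z) \<longrightarrow> r (C (X \<union> Y), C Z)) \<and>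
     (\<not> lab X \<subseteq> lab Y \<longrightarrow> r (C X, C Y))"

definition natural :: "('a set set \<times> 'a set set \<Rightarrow> bool) \<Rightarrow> bool" where
  "natural r \<longleftrightarrow> (\<forall>X Y Z. X \<subseteq> K \<longrightarrow> Y \<subseteq> K \<longrightarrow> Z \<subseteq> K \<longrightarrow> natural_at r X Y Z)"

lemma natural_atD: "natural r \<Longrightarrow> X \<subseteq> K \<Longrightarrow> Y \<subseteq> K \<Longrightarrow> Z \<subseteq> K \<Longrightarrow> natural_at r X Y Z"
  by (simp add: natural_def)

lemma natural_irrefl: "natural r \<Longrightarrow> X \<subseteq> K \<Longrightarrow> \<not> r (C X, C X)"
  using natural_atD[of r X X X] by (simp add: natural_at_def)

lemma natural_trans:
  "natural r \<Longrightarrow> X \<subseteq> K \<Longrightarrow> Y \<subseteq> K \<Longrightarrow> Z \<subseteq> K \<Longrightarrow> r (C X, C Y) \<Longrightarrow> r (C Y, C Z) \<Longrightarrow> r (C X, C Z)"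
  using natural_atD[of r X Y Z] by (simp add: natural_at_def)

lemma natural_asym: "natural r \<Longrightarrow> X \<subseteq> K \<Longrightarrow> Y \<subseteq> K \<Longrightarrow> r (C X, C Y) \<Longrightarrow> \<not> r (C Y, C X)"
  using natural_trans[of r X Y X] natural_irrefl[of r X] by blast

lemma natural_total:
  "natural r \<Longrightarrow> X \<subseteq> K \<Longrightarrow> Y \<subseteq> K \<Longrightarrow> C X \<noteq> C Y \<Longrightarrow> r (C X, C Y) \<or> r (C Y, C X)"
  using natural_atD[of r X Y Y] unfolding natural_at_def by blast

lemma natural_bot: "natural r \<Longrightarrow> X \<subseteq> K \<Longrightarrow> \<not> small X \<Longrightarrow> r (C {}, C X)"
  using natural_atD[of r X X X] by (simp add: natural_at_def)

lemma natural_diff: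
  "natural r \<Longrightarrow> X \<subseteq> K \<Longrightarrow> Y \<subseteq> K \<Longrightarrow> r (C X, C Y) \<longleftrightarrow> r (C (X - Y), C (Y - X))"
  using natural_atD[of r X Y Y] unfolding natural_at_def by blast

lemma natural_join:
  "natural r \<Longrightarrow> X \<subseteq> K \<Longrightarrow> Y \<subseteq> K \<Longrightarrow> Z \<subseteq> K \<Longrightarrow> X \<inter> Z = {} \<Longrightarrow> Y \<inter> Z = {} \<Longrightarrow>
     r (C X, C Z) \<Longrightarrow> r (C Y, C Z) \<Longrightarrow> r (C (X \<union> Y), C Z)"
  using natural_atD[of r X Y Z] by (simp add: natural_at_def)

lemma natural_size: "natural r \<Longrightarrow> X \<subseteq> K \<Longrightarrow> Y \<subseteq> K \<Longrightarrow> \<not> lab X \<subseteq> lab Y \<Longrightarrow> r (C X, C Y)"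
  using natural_atD[of r X Y Y] unfolding natural_at_def by blast

lemma natural_UN:
  assumes "natural r" "finite I" "M \<subseteq> K" "\<not> small M" "\<And>i. i \<in> I \<Longrightarrow> X i \<subseteq> K"
    "\<And>i. i \<in> I \<Longrightarrow> X i \<inter> M = {}" "\<And>i. i \<in> I \<Longrightarrow> r (C (X i), C M)"
  shows "r (C (\<Union>i\<in>I. X i), C M)"
  using assms(2,5-)
proof (induction I rule: finite_induct)
  case empty
  then show ?case using natural_bot[OF assms(1,3,4)] by simp
next
  case (insert i I)
  have "r (C (X i \<union> (\<Union>i\<in>I. X i)), C M)"
  proof (rule natural_join[OF assms(1)])
    show "(\<Union>i\<in>I. X i) \<subseteq> K" by (rule UN_least) (use insert.prems in simp)
    show "(\<Union>i\<in>I. X i) \<inter> M = {}" using insert.prems(2) by blast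
    show "r (C (\<Union>i\<in>I. X i), C M)" using insert by simp
  qed (use insert.prems assms(3) in simp_all)
  then show ?case by simp
qed

text \<open>
  Only the differences matter. The join of the pieces of \<open>S - T\<close> stays below the piece \<open>m\<close> by the
  join condition, and joining further pieces to \<open>m\<close> makes it larger.
\<close>

lemma natural_U:
  assumes r: "natural r" and p: "part Xs" and ST: "S \<subseteq> {..<length Xs}" "T \<subseteq> {..<length Xs}"
    and m: "m \<in> T" "m \<notin> S" and dom: "\<And>s. s \<in> S - T \<Longrightarrow> r (C (Xs ! s), C (Xs ! m))"
  shows "r (C (U Xs S), C (U Xs T))"
proof -
  have mn: "m < length Xs" using m ST by auto
  note M = part_nth[OF p mn]
  have below: "r (C (U Xs (S - T)), C (Xs ! m))"
    unfolding U_def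
  proof (rule natural_UN[OF r])
    show "finite (S - T)" using finite_idx[OF ST(1)] by simp
    fix i assume i: "i \<in> S - T"
    then have "i < length Xs" "i \<noteq> m" using ST m by auto
    then show "Xs ! i \<subseteq> K" "Xs ! i \<inter> Xs ! m = {}" using part_nth(1)[OF p] part_disjoint[OF p] mn by auto
    show "r (C (Xs ! i), C (Xs ! m))" by (rule dom[OF i])
  qed (use M in auto)
  let ?E = "U Xs (T - S - {m})"
  have E: "?E \<subseteq> K" using ST by (intro U_sub[OF p]) auto
  have TS: "U Xs (T - S) = Xs ! m \<union> ?E" using m by (auto simp: U_def)
  have dis: "Xs ! m \<inter> ?E = {}"
    using U_disjoint[OF p, of "{m}" "T - S - {m}"] mn ST by auto
  have "r (C (U Xs (S - T)), C (U Xs (T - S)))"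
  proof (cases "T - S - {m} = {}")
    case True
    then have "U Xs (T - S) = Xs ! m" using TS by (metis U_empty Un_empty_right)
    then show ?thesis using below by simp
  next
    case False
    then have "\<not> small ?E" using small_U_iff[OF p, of "T - S - {m}"] ST by auto
    then have "r (C {}, C ?E)" by (rule natural_bot[OF r E])
    have e: "Xs ! m - U Xs (T - S) = {}" "U Xs (T - S) - Xs ! m = ?E"
      using TS dis by auto
    have TSK: "U Xs (T - S) \<subseteq> K" using ST by (intro U_sub[OF p]) auto
    have "r (C (Xs ! m), C (U Xs (T - S)))"
      using natural_diff[OF r M(1) TSK, unfolded e] \<open>r (C {}, C ?E)\<close> by blast
    then show ?thesis using natural_trans[OF r _ M(1) TSK below] U_sub[OF p, of "S - T"] ST by auto
  qed
  then show ?thesis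
    using natural_diff[OF r U_sub[OF p ST(1)] U_sub[OF p ST(2)]] U_Diff[OF p ST] U_Diff[OF p ST(2,1)] by simp
qed

definition ordered_on :: "('a set set \<times> 'a set set \<Rightarrow> bool) \<Rightarrow> 'a set list \<Rightarrow> bool" where
  "ordered_on r Xs \<longleftrightarrow> (\<forall>S T. S \<subseteq> {..<length Xs} \<longrightarrow> T \<subseteq> {..<length Xs} \<longrightarrow>
     r (C (U Xs S), C (U Xs T)) \<longleftrightarrow> antilex_less S T)"

lemma ordered_onD:
  "ordered_on r Xs \<Longrightarrow> S \<subseteq> {..<length Xs} \<Longrightarrow> T \<subseteq> {..<length Xs} \<Longrightarrow>
     r (C (U Xs S), C (U Xs T)) \<longleftrightarrow> antilex_less S T"
  by (simp add: ordered_on_def)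

lemma natural_imp_ordered_on:
  assumes r: "natural r" and p: "part Xs"
    and asc: "\<And>i j. i < j \<Longrightarrow> j < length Xs \<Longrightarrow> r (C (Xs ! i), C (Xs ! j))"
  shows "ordered_on r Xs"
proof -
  have less: "r (C (U Xs S), C (U Xs T))"
    if ST: "S \<subseteq> {..<length Xs}" "T \<subseteq> {..<length Xs}" and l: "antilex_less S T" for S T
  proof -
    obtain m where m: "m \<in> T" "m \<notin> S" "\<And>k. k > m \<Longrightarrow> k \<in> S \<longleftrightarrow> k \<in> T"
      using l by (auto simp: antilex_less_def)
    show ?thesis
    proof (rule natural_U[OF r p ST m(1,2)])
      fix s assume s: "s \<in> S - T"
      then have "s < m" using m by (metis DiffD1 DiffD2 linorder_neqE_nat)
      then show "r (C (Xs ! s), C (Xs ! m))" using asc m(1) ST by auto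
    qed
  qed
  have "antilex_less S T"
    if ST: "S \<subseteq> {..<length Xs}" "T \<subseteq> {..<length Xs}" and l: "r (C (U Xs S), C (U Xs T))" for S T
  proof (rule ccontr)
    assume "\<not> antilex_less S T"
    moreover have "S \<noteq> T" using l natural_irrefl[OF r U_sub[OF p ST(1)]] by auto
    ultimately have "antilex_less T S" using antilex_less_linear finite_idx ST by blast
    then have "r (C (U Xs T), C (U Xs S))" using less ST by blast
    then show False using l natural_asym[OF r] U_sub[OF p] ST by blast
  qed
  with less show ?thesis unfolding ordered_on_def by blast
qed

text \<open>
  All conditions become statements on finite sets of indices. For the condition on sizes, the piece
  with the largest index in a join determines the size of the join.
\<close>

lemma ordered_on_imp_natural_at:
  assumes p: "part Xs" and o: "ordered_on r Xs"
    and labs: "\<And>i j. i < j \<Longrightarrow> j < length Xs \<Longrightarrow> lab (Xs ! j) \<subseteq> lab (Xs ! i)"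
    and XYZ: "X \<subseteq> K" "Y \<subseteq> K" "Z \<subseteq> K" and sp: "C X \<in> span Xs" "C Y \<in> span Xs" "C Z \<in> span Xs"
  shows "natural_at r X Y Z"
proof -
  obtain S T V where S: "S \<subseteq> {..<length Xs}" "C X = C (U Xs S)"
    and T: "T \<subseteq> {..<length Xs}" "C Y = C (U Xs T)"
    and V: "V \<subseteq> {..<length Xs}" "C Z = C (U Xs V)"
    using sp unfolding span_def by blast
  note fin = finite_idx[OF S(1)] finite_idx[OF T(1)] finite_idx[OF V(1)]
  note sub = U_sub[OF p S(1)] U_sub[OF p T(1)] U_sub[OF p V(1)]
  have XY: "C (X - Y) = C (U Xs (S - T))"
    using C_Diff_cong[OF S(2) T(2) XYZ(1) sub(1) XYZ(2) sub(2)] U_Diff[OF p S(1) T(1)] by simp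
  have YX: "C (Y - X) = C (U Xs (T - S))"
    using C_Diff_cong[OF T(2) S(2) XYZ(2) sub(2) XYZ(1) sub(1)] U_Diff[OF p T(1) S(1)] by simp
  have XuY: "C (X \<union> Y) = C (U Xs (S \<union> T))"
    using C_Un_cong[OF S(2) T(2) XYZ(1) sub(1) XYZ(2) sub(2)] by (simp add: U_Un)
  have bot: "C {} = C (U Xs {})" by simp
  have disj: "S' \<inter> V = {}"
    if "X' \<inter> Z = {}" "X' \<subseteq> K" "S' \<subseteq> {..<length Xs}" "C X' = C (U Xs S')" for X' S'
  proof -
    have "C (X' \<inter> Z) = C (U Xs (S' \<inter> V))"
      using C_Int_cong[OF that(4) V(2) that(2) U_sub[OF p that(3)] XYZ(3) sub(3)] U_Int[OF p that(3) V(1)] by simp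
    then have "C (U Xs (S' \<inter> V)) = C (U Xs {})" using that(1) by simp
    then show ?thesis using C_U_eq_iff[OF p, of "S' \<inter> V" "{}"] V(1) by auto
  qed
  have labU: "lab X = lab (U Xs S)" "lab Y = lab (U Xs T)"
    by (rule lab_cong; use S T XYZ sub in simp)+
  have size: "antilex_less S T" if nl: "\<not> lab X \<subseteq> lab Y"
  proof -
    have "T \<noteq> {}"
    proof
      assume "T = {}"
      then have "lab Y = cards_between lam kap" using labU lab_small[of "{}"] by simp
      then show False using nl lab_sub by blast
    qed
    then have tm: "Max T \<in> T" using fin by simp
    have "lab (U Xs T) = lab (Xs ! Max T)"
      unfolding U_def
    proof (rule lab_UN[OF fin(2) tm])
      fix i assume "i \<in> T"
      then have "i \<le> Max T" using fin by simp
      then show "lab (Xs ! Max T) \<subseteq> lab (Xs ! i)"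
        using labs[of i "Max T"] tm T(1) by (cases "i = Max T") auto
    qed
    moreover have "s < Max T" if "s \<in> S" for s
    proof (rule ccontr)
      assume "\<not> s < Max T"
      then have "lab (Xs ! s) \<subseteq> lab (Xs ! Max T)"
        using labs[of "Max T" s] S(1) that by (cases "s = Max T") auto
      moreover have "lab (U Xs S) \<subseteq> lab (Xs ! s)" using that by (intro lab_mono) (auto simp: U_def)
      ultimately show False using nl labU \<open>lab (U Xs T) = _\<close> by auto
    qed
    ultimately show ?thesis unfolding antilex_less_def
      using tm fin(2) by (intro exI[of _ "Max T"]) (metis Max_ge less_irrefl not_less order.strict_trans)
  qed
  have diff: "antilex_less (S - T) (T - S) \<longleftrightarrow> antilex_less S T"
    unfolding antilex_less_def by blast
  have join: "antilex_less (S \<union> T) V"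
    if dj: "S \<inter> V = {}" "T \<inter> V = {}" and ls: "antilex_less S V" "antilex_less T V"
  proof -
    obtain m n where m: "m \<in> V" "m \<notin> S" "\<And>k. k > m \<Longrightarrow> k \<in> S \<longleftrightarrow> k \<in> V"
      and n: "n \<in> V" "n \<notin> T" "\<And>k. k > n \<Longrightarrow> k \<in> T \<longleftrightarrow> k \<in> V"
      using ls unfolding antilex_less_def by blast
    have "m = n" using m n dj by (metis IntI empty_iff linorder_neqE_nat)
    then show ?thesis unfolding antilex_less_def using m n by blast
  qed
  have botless: "antilex_less {} S" if "\<not> small X"
  proof -
    have "C X \<noteq> C {}" using that C_eq_bot[OF XYZ(1)] by blast
    then have "S \<noteq> {}" using S(2) U_empty by metis
    moreover have "\<not> antilex_less S {}" by (simp add: antilex_less_def)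
    ultimately show ?thesis using antilex_less_linear[OF finite.emptyI fin(1)] by blast
  qed
  have rST: "r (C X, C X) \<longleftrightarrow> antilex_less S S" "r (C X, C Y) \<longleftrightarrow> antilex_less S T"
    "r (C Y, C X) \<longleftrightarrow> antilex_less T S" "r (C Y, C Z) \<longleftrightarrow> antilex_less T V"
    "r (C X, C Z) \<longleftrightarrow> antilex_less S V" "r (C {}, C X) \<longleftrightarrow> antilex_less {} S"
    "r (C (X - Y), C (Y - X)) \<longleftrightarrow> antilex_less (S - T) (T - S)"
    "r (C (X \<union> Y), C Z) \<longleftrightarrow> antilex_less (S \<union> T) V"
  proof -
    have d: "S - T \<subseteq> {..<length Xs}" "T - S \<subseteq> {..<length Xs}" "S \<union> T \<subseteq> {..<length Xs}"
      "{} \<subseteq> {..<length Xs}" using S(1) T(1) by auto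
    note o = ordered_onD[OF o]
    show "r (C X, C X) \<longleftrightarrow> antilex_less S S" unfolding S(2) by (rule o[OF S(1) S(1)])
    show "r (C X, C Y) \<longleftrightarrow> antilex_less S T" unfolding S(2) T(2) by (rule o[OF S(1) T(1)])
    show "r (C Y, C X) \<longleftrightarrow> antilex_less T S" unfolding S(2) T(2) by (rule o[OF T(1) S(1)])
    show "r (C Y, C Z) \<longleftrightarrow> antilex_less T V" unfolding T(2) V(2) by (rule o[OF T(1) V(1)])
    show "r (C X, C Z) \<longleftrightarrow> antilex_less S V" unfolding S(2) V(2) by (rule o[OF S(1) V(1)])
    show "r (C {}, C X) \<longleftrightarrow> antilex_less {} S" using o[OF d(4) S(1)] S(2) by simp
    show "r (C (X - Y), C (Y - X)) \<longleftrightarrow> antilex_less (S - T) (T - S)"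
      unfolding XY YX by (rule o[OF d(1) d(2)])
    show "r (C (X \<union> Y), C Z) \<longleftrightarrow> antilex_less (S \<union> T) V"
      unfolding XuY V(2) by (rule o[OF d(3) V(1)])
  qed
  show ?thesis
    unfolding natural_at_def rST
    using antilex_less_irrefl antilex_less_trans[of S T V] antilex_less_linear[OF fin(1,2)] botless diff
      join size disj[OF _ XYZ(1) S] disj[OF _ XYZ(2) T] S(2) T(2)
    by blast
qed

lemma antilex_map_C:
  assumes p: "part Xs" and ST: "S \<subseteq> {..<length Xs}" "T \<subseteq> {..<length Xs}"
  shows "antilex B (map C Xs) (C (U Xs S)) (C (U Xs T)) \<longleftrightarrow> antilex_less S T"
proof -
  have le: "bool_le B (map C Xs ! m) (C (U Xs V)) \<longleftrightarrow> m \<in> V"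
    if "m < length Xs" "V \<subseteq> {..<length Xs}" for m V
    using bool_le_U[OF p, of "{m}" V] that by simp
  have eq: "{m. m < length (map C Xs) \<and> bool_le B (map C Xs ! m) (C (U Xs S)) \<noteq>
               bool_le B (map C Xs ! m) (C (U Xs T))} = sym_diff S T"
  proof (rule Set.set_eqI)
    fix m
    show "m \<in> {m. m < length (map C Xs) \<and> bool_le B (map C Xs ! m) (C (U Xs S)) \<noteq>
               bool_le B (map C Xs ! m) (C (U Xs T))} \<longleftrightarrow> m \<in> sym_diff S T"
    proof (cases "m < length Xs")
      case True
      then show ?thesis using le[OF True ST(1)] le[OF True ST(2)] by auto
    qed (use ST in auto)
  qed
  have max: "Max (sym_diff S T) < length Xs" if "S \<noteq> T"
  proof -
    have "Max (sym_diff S T) \<in> sym_diff S T"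
      using that finite_idx[OF ST(1)] finite_idx[OF ST(2)] by (intro Max_in) auto
    then show ?thesis using ST by auto
  qed
  show ?thesis
    unfolding antilex_def eq antilex_less_iff_Max[OF finite_idx[OF ST(1)] finite_idx[OF ST(2)]]
    using C_U_eq_iff[OF p ST] le[OF max ST(2)] by blast
qed

lemma proper_ordering_map_C:
  assumes p: "part Xs"
  shows "proper_ordering lam kap (span Xs) (map C Xs) \<longleftrightarrow>
    (\<forall>i j. i < j \<longrightarrow> j < length Xs \<longrightarrow> lab (Xs ! j) \<subseteq> lab (Xs ! i))"
proof -
  have lev: "map C Xs ! i \<in> level lam kap mu \<longleftrightarrow> mu \<in> lab (Xs ! i)"
    if "i < length Xs" "mu \<in> cards_between lam kap" for i mu
    using level_iff[OF part_nth(1)[OF p that(1)] that(2)] that by simp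
  have bad: "(\<exists>mu\<in>cards_between lam kap. map C Xs ! i \<in> level lam kap mu \<and> map C Xs ! j \<notin> level lam kap mu)
      \<longleftrightarrow> \<not> lab (Xs ! i) \<subseteq> lab (Xs ! j)" if "i < length Xs" "j < length Xs" for i j
  proof -
    have "(\<exists>mu\<in>cards_between lam kap. map C Xs ! i \<in> level lam kap mu \<and> map C Xs ! j \<notin> level lam kap mu)
      \<longleftrightarrow> (\<exists>mu\<in>cards_between lam kap. mu \<in> lab (Xs ! i) \<and> mu \<notin> lab (Xs ! j))"
      using lev[OF that(1)] lev[OF that(2)] by (intro bex_cong) simp_all
    then show ?thesis using lab_sub by blast
  qed
  have "distinct (map C Xs)" using p inj_C_part[OF p] by (simp add: distinct_map part_iff_set)
  moreover have "set (map C Xs) = atoms_of B (span Xs)"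
  proof -
    have "set Xs = (!) Xs ` {..<length Xs}" by (auto simp: set_conv_nth)
    then show ?thesis unfolding atoms_of_span[OF p] by (simp add: image_image)
  qed
  ultimately have "proper_ordering lam kap (span Xs) (map C Xs) \<longleftrightarrow>
    (\<forall>i<length Xs. \<forall>j<length Xs. \<not> lab (Xs ! i) \<subseteq> lab (Xs ! j) \<longrightarrow> i < j)"
    unfolding proper_ordering_def using bad by simp
  also have "\<dots> \<longleftrightarrow> (\<forall>i j. i < j \<longrightarrow> j < length Xs \<longrightarrow> lab (Xs ! j) \<subseteq> lab (Xs ! i))"
    (is "?L \<longleftrightarrow> ?R")
  proof
    assume ?L
    then show ?R by (meson dual_order.strict_trans less_asym')
  next
    assume R: ?R
    show ?L
    proof (intro allI impI)
      fix i j assume ij: "i < length Xs" "j < length Xs" "\<not> lab (Xs ! i) \<subseteq> lab (Xs ! j)"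
      then have "i \<noteq> j" "\<not> j < i" using R by auto
      then show "i < j" by simp
    qed
  qed
  finally show ?thesis .
qed

lemma natural_on_span_iff:
  assumes "part Ys"
  shows "natural_on lam kap (span Ys) r \<longleftrightarrow>
    (\<exists>Xs. part Xs \<and> set Xs = set Ys \<and>
       (\<forall>i j. i < j \<longrightarrow> j < length Xs \<longrightarrow> lab (Xs ! j) \<subseteq> lab (Xs ! i)) \<and> ordered_on r Xs)"
proof
  assume "natural_on lam kap (span Ys) r"
  then obtain as where as: "proper_ordering lam kap (span Ys) as"
    and ras: "\<And>x y. x \<in> span Ys \<Longrightarrow> y \<in> span Ys \<Longrightarrow> r (x, y) \<longleftrightarrow> antilex B as x y"
    unfolding natural_on_def by blast
  have set_as: "distinct as" "set as = C ` set Ys"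
  proof -
    have "set Ys = (!) Ys ` {..<length Ys}" by (auto simp: set_conv_nth)
    then show "distinct as" "set as = C ` set Ys"
      using as unfolding proper_ordering_def atoms_of_span[OF assms] by (simp_all add: image_image)
  qed
  define Xs where "Xs = map (inv_into (set Ys) C) as"
  have asX: "as = map C Xs"
    unfolding Xs_def map_map using set_as by (intro map_idI[symmetric]) (simp add: f_inv_into_f)
  have setX: "set Xs = set Ys"
    using set_as inj_C_part[OF assms] by (simp add: Xs_def inv_into_image_cancel)
  have "distinct Xs" using set_as(1) unfolding asX distinct_map by blast
  then have p: "part Xs" using part_perm[OF assms] setX by blast
  have sp: "span Xs = span Ys" using setX by (rule span_perm)
  have "ordered_on r Xs"
    unfolding ordered_on_def
  proof (intro allI impI)
    fix S T assume ST: "S \<subseteq> {..<length Xs}" "T \<subseteq> {..<length Xs}"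
    then have "C (U Xs S) \<in> span Xs" "C (U Xs T) \<in> span Xs" unfolding span_def by blast+
    then have "C (U Xs S) \<in> span Ys" "C (U Xs T) \<in> span Ys" unfolding sp .
    then show "r (C (U Xs S), C (U Xs T)) \<longleftrightarrow> antilex_less S T"
      using ras antilex_map_C[OF p ST] asX by simp
  qed
  moreover have "\<forall>i j. i < j \<longrightarrow> j < length Xs \<longrightarrow> lab (Xs ! j) \<subseteq> lab (Xs ! i)"
    using as proper_ordering_map_C[OF p] unfolding asX sp by blast
  ultimately show "\<exists>Xs. part Xs \<and> set Xs = set Ys \<and>
       (\<forall>i j. i < j \<longrightarrow> j < length Xs \<longrightarrow> lab (Xs ! j) \<subseteq> lab (Xs ! i)) \<and> ordered_on r Xs"
    using p setX by blast
next
  assume "\<exists>Xs. part Xs \<and> set Xs = set Ys \<and>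
       (\<forall>i j. i < j \<longrightarrow> j < length Xs \<longrightarrow> lab (Xs ! j) \<subseteq> lab (Xs ! i)) \<and> ordered_on r Xs"
  then obtain Xs where p: "part Xs" and setX: "set Xs = set Ys"
    and labs: "\<forall>i j. i < j \<longrightarrow> j < length Xs \<longrightarrow> lab (Xs ! j) \<subseteq> lab (Xs ! i)" and o: "ordered_on r Xs"
    by blast
  have sp: "span Ys = span Xs" by (rule span_perm) (simp add: setX)
  show "natural_on lam kap (span Ys) r"
    unfolding natural_on_def sp
  proof (intro exI[of _ "map C Xs"] conjI ballI)
    show "proper_ordering lam kap (span Xs) (map C Xs)"
      using proper_ordering_map_C[OF p] labs by blast
    fix x y assume "x \<in> span Xs" "y \<in> span Xs"
    then obtain S T where S: "S \<subseteq> {..<length Xs}" "x = C (U Xs S)"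
      and T: "T \<subseteq> {..<length Xs}" "y = C (U Xs T)" by (auto simp: span_def)
    then show "r (x, y) \<longleftrightarrow> antilex B (map C Xs) x y"
      using antilex_map_C[OF p S(1) T(1)] ordered_onD[OF o S(1) T(1)] by simp
  qed
qed

lemma natural_sorted:
  assumes r: "natural r" and p: "part Ys"
  shows "\<exists>Xs. part Xs \<and> set Xs = set Ys \<and> sorted_wrt (\<lambda>X Y. r (C X, C Y)) Xs"
proof -
  have "\<And>Y. Y \<in> set Ys \<Longrightarrow> Y \<subseteq> K" using p by (auto simp: part_def)
  then have "\<exists>Xs. distinct Xs \<and> set Xs = set Ys \<and> sorted_wrt (\<lambda>X Y. r (C X, C Y)) Xs"
  proof (intro sorted_enumeration)
    fix X Y Z assume "X \<in> set Ys" "Y \<in> set Ys" "Z \<in> set Ys" "r (C X, C Y)" "r (C Y, C Z)"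
    then show "r (C X, C Z)" using natural_trans[OF r] \<open>\<And>Y. Y \<in> set Ys \<Longrightarrow> Y \<subseteq> K\<close> by blast
  next
    fix X Y assume XY: "X \<in> set Ys" "Y \<in> set Ys" "X \<noteq> Y"
    then have "C X \<noteq> C Y" using inj_C_part[OF p] by (simp add: inj_on_eq_iff)
    then show "r (C X, C Y) \<or> r (C Y, C X)"
      using natural_total[OF r] \<open>\<And>Y. Y \<in> set Ys \<Longrightarrow> Y \<subseteq> K\<close> XY by blast
  qed simp
  then show ?thesis using part_perm[OF p] by blast
qed

text \<open>
  The local conditions for three elements are checked in the finite subalgebra that they generate.
  Conversely, the atoms of a finite subalgebra are sorted by \<open>r\<close>; the condition on sizes makes this
  enumeration proper, and the others make \<open>r\<close> antilexicographical.
\<close>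

lemma NO_iff: "r \<in> NO lam kap \<longleftrightarrow> r \<in> extensional (P \<times> P) \<and> natural r"
proof
  assume r: "r \<in> NO lam kap"
  have "natural_at r X Y Z" if XYZ: "X \<subseteq> K" "Y \<subseteq> K" "Z \<subseteq> K" for X Y Z
  proof -
    obtain Ys where Ys: "part Ys" "{C X, C Y, C Z} \<subseteq> span Ys"
      using finite_subset_in_span[of "{C X, C Y, C Z}"] XYZ by auto
    have "natural_on lam kap (span Ys) r"
      using r span_finite_subalgebra[OF Ys(1)] by (simp add: NO_def Let_def)
    then obtain Xs where "part Xs" "set Xs = set Ys"
      "\<forall>i j. i < j \<longrightarrow> j < length Xs \<longrightarrow> lab (Xs ! j) \<subseteq> lab (Xs ! i)" "ordered_on r Xs"
      using natural_on_span_iff[OF Ys(1)] by blast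
    then show ?thesis using Ys(2) XYZ span_perm[of Xs Ys] by (intro ordered_on_imp_natural_at[of Xs]) auto
  qed
  then show "r \<in> extensional (P \<times> P) \<and> natural r"
    using r by (simp add: natural_def NO_def Let_def)
next
  assume r: "r \<in> extensional (P \<times> P) \<and> natural r"
  then have nat: "natural r" by simp
  have "strict_linear_order_on P {(x, y) \<in> P \<times> P. r (x, y)}"
    unfolding strict_linear_order_on_def
  proof (intro conjI)
    show "trans {(x, y) \<in> P \<times> P. r (x, y)}"
    proof (rule transI, clarsimp)
      fix x y z assume "x \<in> P" "y \<in> P" "z \<in> P" "r (x, y)" "r (y, z)"
      then show "r (x, z)" using natural_trans[OF nat] by (metis P_cases)
    qed
    show "irrefl {(x, y) \<in> P \<times> P. r (x, y)}"
      unfolding irrefl_def using natural_irrefl[OF nat] by (auto elim!: P_cases)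
    show "total_on P {(x, y) \<in> P \<times> P. r (x, y)}"
      unfolding total_on_def using natural_total[OF nat] by (auto elim!: P_cases)
  qed
  moreover have "natural_on lam kap A r" if A: "finite_subalgebra B A" for A
  proof -
    obtain Ys where Ys: "part Ys" "A = span Ys" using finite_subalgebra_eq_span[OF A] by blast
    obtain Xs where Xs: "part Xs" "set Xs = set Ys" "sorted_wrt (\<lambda>X Y. r (C X, C Y)) Xs"
      using natural_sorted[OF nat Ys(1)] by blast
    have asc: "r (C (Xs ! i), C (Xs ! j))" if "i < j" "j < length Xs" for i j
      using Xs(3) that by (simp add: sorted_wrt_iff_nth_less)
    have "lab (Xs ! j) \<subseteq> lab (Xs ! i)" if ij: "i < j" "j < length Xs" for i j
    proof (rule ccontr)
      assume "\<not> lab (Xs ! j) \<subseteq> lab (Xs ! i)"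
      then have "r (C (Xs ! j), C (Xs ! i))"
        using natural_size[OF nat] part_nth(1)[OF Xs(1)] ij by simp
      then show False using asc[OF ij] natural_asym[OF nat] part_nth(1)[OF Xs(1)] ij by simp
    qed
    moreover have "ordered_on r Xs" by (rule natural_imp_ordered_on[OF nat Xs(1) asc])
    ultimately show ?thesis unfolding Ys(2) natural_on_span_iff[OF Ys(1)] using Xs by blast
  qed
  ultimately show "r \<in> NO lam kap" using r by (simp add: NO_def Let_def)
qed

text \<open>
  Every enumeration of the atoms of a finite subalgebra by increasing size gives rise to an
  antilexicographical ordering.
\<close>

lemma finite_natural_at_satisfiable:
  assumes F: "finite F" "F \<subseteq> P"
  shows "\<exists>r\<in>extensional (P \<times> P). \<forall>X Y Z. X \<subseteq> K \<longrightarrow> Y \<subseteq> K \<longrightarrow> Z \<subseteq> K \<longrightarrow>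
           C X \<in> F \<longrightarrow> C Y \<in> F \<longrightarrow> C Z \<in> F \<longrightarrow> natural_at r X Y Z"
proof -
  obtain Ys where Ys: "part Ys" "F \<subseteq> span Ys" using finite_subset_in_span[OF F] by blast
  have "\<exists>Xs. distinct Xs \<and> set Xs = set Ys \<and> sorted_wrt (\<lambda>X Y. lab Y \<subseteq> lab X) Xs"
    using lab_linear by (intro sorted_enumeration) auto
  then obtain Xs where Xs: "part Xs" "set Xs = set Ys" "sorted_wrt (\<lambda>X Y. lab Y \<subseteq> lab X) Xs"
    using part_perm[OF Ys(1)] by blast
  define r where "r = restrict (\<lambda>(x, y). \<exists>S T. S \<subseteq> {..<length Xs} \<and> T \<subseteq> {..<length Xs} \<and>
     x = C (U Xs S) \<and> y = C (U Xs T) \<and> antilex_less S T) (P \<times> P)"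
  have "ordered_on r Xs"
    unfolding ordered_on_def
  proof (intro allI impI)
    fix S T assume ST: "S \<subseteq> {..<length Xs}" "T \<subseteq> {..<length Xs}"
    have "r (C (U Xs S), C (U Xs T)) \<longleftrightarrow> (\<exists>S' T'. S' \<subseteq> {..<length Xs} \<and> T' \<subseteq> {..<length Xs} \<and>
     C (U Xs S) = C (U Xs S') \<and> C (U Xs T) = C (U Xs T') \<and> antilex_less S' T')"
      using U_sub[OF Xs(1)] ST by (simp add: r_def)
    then show "r (C (U Xs S), C (U Xs T)) \<longleftrightarrow> antilex_less S T"
      using C_U_eq_iff[OF Xs(1) ST(1)] C_U_eq_iff[OF Xs(1) ST(2)] ST by metis
  qed
  then have "natural_at r X Y Z" if "X \<subseteq> K" "Y \<subseteq> K" "Z \<subseteq> K" "C X \<in> F" "C Y \<in> F" "C Z \<in> F" for X Y Z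
    using that Ys(2) span_perm[OF Xs(2)] Xs(3)
    by (intro ordered_on_imp_natural_at[OF Xs(1)]) (auto simp: sorted_wrt_iff_nth_less)
  moreover have "r \<in> extensional (P \<times> P)" by (simp add: r_def)
  ultimately show ?thesis by blast
qed


section \<open>The Ramsey property of natural orderings\<close>

text \<open>
  Partitions are listed from the largest piece down to match the words, in which the first occurrence
  of a letter marks the largest piece of a join.
\<close>

definition descending :: "('a set set \<times> 'a set set \<Rightarrow> bool) \<Rightarrow> 'a set list \<Rightarrow> bool" where
  "descending r Xs \<longleftrightarrow> (\<forall>i j. i < j \<longrightarrow> j < length Xs \<longrightarrow> r (C (Xs ! j), C (Xs ! i)))"

lemma descendingD: "descending r Xs \<Longrightarrow> i < j \<Longrightarrow> j < length Xs \<Longrightarrow> r (C (Xs ! j), C (Xs ! i))"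
  by (simp add: descending_def)

lemma descending_exists:
  assumes r: "natural r" and p: "part Ys"
  shows "\<exists>Xs. part Xs \<and> set Xs = set Ys \<and> descending r Xs"
proof -
  obtain Xs where Xs: "part Xs" "set Xs = set Ys" "sorted_wrt (\<lambda>X Y. r (C X, C Y)) Xs"
    using natural_sorted[OF r p] by blast
  have "sorted_wrt (\<lambda>X Y. r (C Y, C X)) (rev Xs)" using Xs(3) by (simp add: sorted_wrt_rev)
  then have "descending r (rev Xs)" by (simp add: descending_def sorted_wrt_iff_nth_less)
  moreover have "part (rev Xs)" using Xs(1) by (simp add: part_iff_set)
  ultimately show ?thesis using Xs(2) by (intro exI[of _ "rev Xs"]) simp
qed

lemma descending_labs:
  assumes r: "natural r" and p: "part Xs" and d: "descending r Xs"
  shows "sorted_wrt (\<le>) (map lab Xs)"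
  unfolding sorted_wrt_iff_nth_less
proof (intro allI impI)
  fix i j assume ij: "i < j" "j < length (map lab Xs)"
  have "lab (Xs ! i) \<subseteq> lab (Xs ! j)"
  proof (rule ccontr)
    assume n: "\<not> lab (Xs ! i) \<subseteq> lab (Xs ! j)"
    have sub: "Xs ! i \<subseteq> K" "Xs ! j \<subseteq> K" using part_nth(1)[OF p] ij by auto
    have "r (C (Xs ! i), C (Xs ! j))" by (rule natural_size[OF r sub n])
    moreover have "r (C (Xs ! j), C (Xs ! i))" using descendingD[OF d ij(1)] ij(2) by simp
    ultimately show False using natural_asym[OF r sub] by blast
  qed
  then show "map lab Xs ! i \<le> map lab Xs ! j" using ij by simp
qed

lemma lab_U_sorted:
  assumes s: "sorted_wrt (\<le>) (map lab Xs)" and S: "S \<subseteq> {..<length Xs}" "m \<in> S" "\<And>i. i \<in> S \<Longrightarrow> m \<le> i"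
  shows "lab (U Xs S) = lab (Xs ! m)"
  unfolding U_def
proof (rule lab_UN[OF finite_idx[OF S(1)] S(2)])
  fix i assume i: "i \<in> S"
  show "lab (Xs ! m) \<subseteq> lab (Xs ! i)"
  proof (cases "m = i")
    case False
    then have "m < i" "i < length Xs" using S(3)[OF i] S(1) i by auto
    then show ?thesis using s by (simp add: sorted_wrt_iff_nth_less)
  qed simp
qed

lemma part_nonempty: "part Xs \<Longrightarrow> 0 < length Xs"
  using not_small_K by (cases Xs) (auto simp: part_def)

lemma sorted_head:
  assumes p: "part Xs" and s: "sorted_wrt (\<le>) (map lab Xs)"
  shows "map lab Xs ! 0 = lab K"
  using lab_U_sorted[OF s, of "{..<length Xs}" 0] part_U_all[OF p] part_nonempty[OF p] by simp

text \<open>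
  Both orderings are antilexicographical, so the isomorphism that respects the two enumerations of
  atoms is an isomorphism of orderings.
\<close>

lemma descending_compare:
  assumes r: "natural r" and p: "part Xs" and d: "descending r Xs"
    and r': "natural r'" and p': "part Zs" and d': "descending r' Zs" and len: "length Zs = length Xs"
    and ST: "S \<subseteq> {..<length Xs}" "T \<subseteq> {..<length Xs}"
  shows "r (C (U Xs S), C (U Xs T)) \<longleftrightarrow> r' (C (U Zs S), C (U Zs T))"
proof -
  have less: "r (C (U Xs S), C (U Xs T))"
    if r: "natural r" and p: "part Xs" and d: "descending r Xs" and ST: "S \<subseteq> {..<length Xs}" "T \<subseteq> {..<length Xs}"
      and ne: "S \<noteq> T" and min: "Min (sym_diff S T) \<in> T" for r Xs S T
  proof -
    have fin: "finite (sym_diff S T)" using finite_idx[OF ST(1)] finite_idx[OF ST(2)] by simp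
    have mm: "Min (sym_diff S T) \<in> sym_diff S T" using ne by (intro Min_in[OF fin]) auto
    show ?thesis
    proof (rule natural_U[OF r p ST min])
      show "Min (sym_diff S T) \<notin> S" using mm min by auto
      fix s assume s: "s \<in> S - T"
      then have "Min (sym_diff S T) \<le> s" by (intro Min_le[OF fin]) auto
      moreover have "Min (sym_diff S T) \<noteq> s" using s min by auto
      ultimately have "Min (sym_diff S T) < s" by simp
      moreover have "s < length Xs" using s ST by auto
      ultimately show "r (C (Xs ! s), C (Xs ! Min (sym_diff S T)))" by (rule descendingD[OF d])
    qed
  qed
  show ?thesis
  proof (cases "S = T")
    case True
    then show ?thesis using natural_irrefl[OF r U_sub[OF p ST(1)]]
        natural_irrefl[OF r' U_sub[OF p', of S]] ST len by simp
  next
    case False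
    have fin: "finite (sym_diff S T)" using finite_idx[OF ST(1)] finite_idx[OF ST(2)] by simp
    have "Min (sym_diff S T) \<in> sym_diff S T" using False by (intro Min_in[OF fin]) auto
    then consider "Min (sym_diff S T) \<in> T" | "Min (sym_diff T S) \<in> S" by (auto simp: Un_commute)
    then show ?thesis
    proof cases
      case 1
      have "r (C (U Xs S), C (U Xs T))" by (rule less[OF r p d ST False 1])
      moreover have "r' (C (U Zs S), C (U Zs T))"
        by (rule less[OF r' p' d' _ _ False 1]) (use ST len in auto)
      ultimately show ?thesis by simp
    next
      case 2
      have "r (C (U Xs T), C (U Xs S))" by (rule less[OF r p d ST(2,1) _ 2]) (use False in auto)
      moreover have "r' (C (U Zs T), C (U Zs S))"
        by (rule less[OF r' p' d' _ _ _ 2]) (use ST len False in auto)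
      ultimately show ?thesis
        using natural_asym[OF r U_sub[OF p ST(2)] U_sub[OF p ST(1)]]
          natural_asym[OF r' U_sub[OF p', of T] U_sub[OF p', of S]] ST len by auto
    qed
  qed
qed

text \<open>
  A sorted list of labels is determined by its multiset, so it does not matter in which order the
  pieces are constructed: sorting them by \<open>r\<close> puts their labels in the prescribed order.
\<close>

lemma realize_descending:
  assumes r: "natural r" and c: "c \<noteq> []" "c ! 0 = lab K" "sorted_wrt (\<le>) c"
    "\<And>l. l \<in> set c \<Longrightarrow> \<exists>Z\<subseteq>K. \<not> small Z \<and> lab Z = l"
  shows "\<exists>Xs. part Xs \<and> descending r Xs \<and> map lab Xs = c"
proof -
  obtain Ys where Ys: "part Ys" "map lab Ys = c" using realize_labels[OF c(1,2,4)] by blast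
  obtain Xs where Xs: "part Xs" "set Xs = set Ys" "descending r Xs" using descending_exists[OF r Ys(1)] by blast
  have "mset Xs = mset Ys" using Xs Ys(1) by (simp add: part_iff_set set_eq_iff_mset_eq_distinct)
  then have "mset (map lab Xs) = mset c" unfolding Ys(2)[symmetric] by simp
  then have "map lab Xs = c" using descending_labs[OF r Xs(1,3)] c(3) by (intro sorted_wrt_le_unique)
  then show ?thesis using Xs by blast
qed

lemma label_realizable: "part Xs \<Longrightarrow> l \<in> set (map lab Xs) \<Longrightarrow> \<exists>Z\<subseteq>K. \<not> small Z \<and> lab Z = l"
  using part_nth(1,2) by (auto simp: set_conv_nth) blast

text \<open>
  The labels of the atoms, sorted by \<open>r\<close>, are also the labels of some partition sorted by
  \<open>r0\<close>, and by homogeneity an automorphism takes the atoms to the pieces of that partition.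
\<close>

lemma dense_orbit:
  assumes r: "natural r" and r0: "natural r0" and F: "finite F" "F \<subseteq> P"
  shows "\<exists>g\<in>carrier G. \<forall>x\<in>F. \<forall>y\<in>F. r (x, y) \<longleftrightarrow> r0 (g x, g y)"
proof -
  obtain Ys where Ys: "part Ys" "F \<subseteq> span Ys" using finite_subset_in_span[OF F] by blast
  obtain Xs where Xs: "part Xs" "set Xs = set Ys" "descending r Xs" using descending_exists[OF r Ys(1)] by blast
  note labs = descending_labs[OF r Xs(1,3)]
  obtain Zs where Zs: "part Zs" "descending r0 Zs" "map lab Zs = map lab Xs"
    using realize_descending[OF r0 _ sorted_head[OF Xs(1) labs] labs label_realizable[OF Xs(1)]]
      part_nonempty[OF Xs(1)] by auto
  have len: "length Zs = length Xs" using Zs(3) by (metis length_map)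
  obtain g where g: "g \<in> carrier G" "\<And>S. S \<subseteq> {..<length Xs} \<Longrightarrow> g (C (U Xs S)) = C (U Zs S)"
    using homogeneous[OF Xs(1) Zs(1) Zs(3)[symmetric]] by blast
  have "r (x, y) \<longleftrightarrow> r0 (g x, g y)" if "x \<in> F" "y \<in> F" for x y
  proof -
    have "x \<in> span Xs" "y \<in> span Xs" using that Ys(2) span_perm[OF Xs(2)] by auto
    then obtain S T where S: "S \<subseteq> {..<length Xs}" "x = C (U Xs S)"
      and T: "T \<subseteq> {..<length Xs}" "y = C (U Xs T)" unfolding span_def by blast
    show ?thesis using descending_compare[OF r Xs(1,3) r0 Zs(1,2) len S(1) T(1)] g(2)[OF S(1)] g(2)[OF T(1)] S T
      by simp
  qed
  then show ?thesis using g(1) by blast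
qed

text \<open>
  In the join condition the images of disjoint sets are represented by sets with a small
  intersection, which is removed first.
\<close>

lemma natural_pullback:
  assumes r: "natural r" and g: "g \<in> carrier G"
  shows "natural (\<lambda>(x, y). r (g x, g y))"
  unfolding natural_def
proof (intro allI impI)
  fix X Y Z assume XYZ: "X \<subseteq> K" "Y \<subseteq> K" "Z \<subseteq> K"
  have im: "\<exists>X'\<subseteq>K. g (C X) = C X'" if "X \<subseteq> K" for X
    using G_closed[OF g C_in_P[OF that]] by (metis P_cases)
  obtain X0 where X0: "X0 \<subseteq> K" "g (C X) = C X0" using im[OF XYZ(1)] by blast
  obtain Y0 where Y0: "Y0 \<subseteq> K" "g (C Y) = C Y0" using im[OF XYZ(2)] by blast
  obtain Z' where Z': "Z' \<subseteq> K" "g (C Z) = C Z'" using im[OF XYZ(3)] by blast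
  have bot: "g (C {}) = C {}" by (rule G_empty[OF g])
  have XY: "g (C (X - Y)) = C (X0 - Y0)" by (rule G_Diff[OF g XYZ(1,2) X0(1) Y0(1) X0(2) Y0(2)])
  have YX: "g (C (Y - X)) = C (Y0 - X0)" by (rule G_Diff[OF g XYZ(2,1) Y0(1) X0(1) Y0(2) X0(2)])
  have eqXY: "C X = C Y \<longleftrightarrow> C X0 = C Y0"
    using G_inj[OF g C_in_P[OF XYZ(1)] C_in_P[OF XYZ(2)]] X0 Y0 by simp
  have sm: "small X0 \<longleftrightarrow> small X" by (rule G_small[OF g XYZ(1) X0])
  have lb: "lab X0 = lab X" "lab Y0 = lab Y"
    by (rule G_lab[OF g XYZ(1) X0], rule G_lab[OF g XYZ(2) Y0])
  have join: "r (g (C (X \<union> Y)), C Z')"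
    if dj: "X \<inter> Z = {}" "Y \<inter> Z = {}" and l: "r (C X0, C Z')" "r (C Y0, C Z')"
  proof -
    have XZ: "X - Z = X" "Y - Z = Y" using dj by auto
    have eX: "C (X0 - Z') = C X0" using G_Diff[OF g XYZ(1,3) X0(1) Z'(1) X0(2) Z'(2)] XZ X0(2) by simp
    have eY: "C (Y0 - Z') = C Y0" using G_Diff[OF g XYZ(2,3) Y0(1) Z'(1) Y0(2) Z'(2)] XZ Y0(2) by simp
    have "r (C ((X0 - Z') \<union> (Y0 - Z')), C Z')"
      using l X0(1) Y0(1) Z'(1) by (intro natural_join[OF r]) (auto simp: eX eY)
    moreover have "g (C (X \<union> Y)) = C ((X0 - Z') \<union> (Y0 - Z'))"
      by (rule G_Un[OF g XYZ(1,2)]) (use X0 Y0 eX eY in auto)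
    ultimately show ?thesis by simp
  qed
  have XYZ': "natural_at r X0 Y0 Z'" by (rule natural_atD[OF r X0(1) Y0(1) Z'(1)])
  show "natural_at (\<lambda>(x, y). r (g x, g y)) X Y Z"
    using XYZ' join eqXY sm lb unfolding natural_at_def prod.case X0(2) Y0(2) Z'(2) bot XY YX by blast
qed

text \<open>
  The atoms of the image of the embedding that is encoded by \<open>w\<close>.
\<close>

definition pieces :: "'a set list \<Rightarrow> nat list \<Rightarrow> nat \<Rightarrow> 'a set list" where
  "pieces Xs w m = map (\<lambda>i. U Xs {j. j < length Xs \<and> w ! j = i}) [0..<m]"

lemma length_pieces [simp]: "length (pieces Xs w m) = m"
  by (simp add: pieces_def)

lemma nth_pieces: "i < m \<Longrightarrow> pieces Xs w m ! i = U Xs {j. j < length Xs \<and> w ! j = i}"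
  by (simp add: pieces_def)

lemma U_pieces: "S \<subseteq> {..<m} \<Longrightarrow> U (pieces Xs w m) S = U Xs {j. j < length Xs \<and> w ! j \<in> S}"
proof -
  assume S: "S \<subseteq> {..<m}"
  have "U (pieces Xs w m) S = (\<Union>i\<in>S. U Xs {j. j < length Xs \<and> w ! j = i})"
    unfolding U_def[of "pieces Xs w m"] using S by (intro SUP_cong refl nth_pieces) auto
  also have "\<dots> = U Xs (\<Union>i\<in>S. {j. j < length Xs \<and> w ! j = i})" by (rule U_UN[symmetric])
  also have "(\<Union>i\<in>S. {j. j < length Xs \<and> w ! j = i}) = {j. j < length Xs \<and> w ! j \<in> S}" by auto
  finally show ?thesis .
qed

lemma part_pieces:
  assumes p: "part Xs" and w: "length w = length Xs" "set w = {..<m}"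
  shows "part (pieces Xs w m)"
  unfolding part_def
proof (intro conjI ballI allI impI)
  fix X assume "X \<in> set (pieces Xs w m)"
  then obtain i where i: "i < m" "X = U Xs {j. j < length Xs \<and> w ! j = i}" by (auto simp: pieces_def)
  then obtain j where "j < length Xs" "w ! j = i" using w by (metis in_set_conv_nth lessThan_iff)
  then show "\<not> small X" unfolding i(2) using small_U_iff[OF p, of "{j. j < length Xs \<and> w ! j = i}"] by auto
next
  fix i j assume "i < length (pieces Xs w m)" "j < length (pieces Xs w m)" "i \<noteq> j"
  then show "pieces Xs w m ! i \<inter> pieces Xs w m ! j = {}"
    by (simp add: nth_pieces) (rule U_disjoint[OF p]; auto)
next
  have "\<Union> (set (pieces Xs w m)) = U (pieces Xs w m) {..<m}"
    using Union_set_nth[of "pieces Xs w m"] by (simp add: U_def)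
  also have "\<dots> = U Xs {j. j < length Xs \<and> w ! j \<in> {..<m}}" by (simp add: U_pieces)
  also have "{j. j < length Xs \<and> w ! j \<in> {..<m}} = {..<length Xs}" using w by (auto simp: set_conv_nth)
  finally show "\<Union> (set (pieces Xs w m)) = K" using part_U_all[OF p] by simp
qed

text \<open>
  The first occurrence of a letter marks the largest constituent of its piece. It determines
  the label of the piece and its place in the descending order.
\<close>

lemma emb_pieces:
  assumes p: "part Xs" and s: "sorted_wrt (\<le>) (map lab Xs)" and e: "emb 0 q (map lab Xs) w"
  shows "part (pieces Xs w (length q))" "map lab (pieces Xs w (length q)) = q"
    "natural r \<Longrightarrow> descending r Xs \<Longrightarrow> descending r (pieces Xs w (length q))"
proof -
  have w: "length w = length Xs" "set w \<subseteq> {..<length q}"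
    and first: "\<And>i. i < length q \<Longrightarrow> \<exists>j<length Xs. w ! j = i \<and> lab (Xs ! j) = q ! i \<and> (\<forall>j'<j. w ! j' < i)"
  proof -
    note e' = e[unfolded emb_iff]
    show "length w = length Xs" "set w \<subseteq> {..<length q}" using e' by simp_all
    fix i assume "i < length q"
    with e' obtain j where "j < length (map lab Xs)" "w ! j = 0 + i" "map lab Xs ! j = q ! i"
      "\<forall>j'<j. w ! j' < 0 + i" by blast
    then show "\<exists>j<length Xs. w ! j = i \<and> lab (Xs ! j) = q ! i \<and> (\<forall>j'<j. w ! j' < i)"
      by (intro exI[of _ j]) simp
  qed
  have "{..<length q} \<subseteq> set w" using first w(1) by (metis lessThan_iff nth_mem subsetI)
  then have "set w = {..<length q}" using w(2) by blast
  then show part: "part (pieces Xs w (length q))" using part_pieces[OF p w(1)] by blast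
  let ?J = "\<lambda>i. {j. j < length Xs \<and> w ! j = i}"
  show "map lab (pieces Xs w (length q)) = q"
  proof (rule nth_equalityI)
    fix i assume "i < length (map lab (pieces Xs w (length q)))"
    then have i: "i < length q" by simp
    obtain j where j: "j < length Xs" "w ! j = i" "lab (Xs ! j) = q ! i" "\<forall>j'<j. w ! j' < i"
      using first[OF i] by blast
    have "lab (U Xs (?J i)) = lab (Xs ! j)"
    proof (rule lab_U_sorted[OF s])
      fix k assume "k \<in> ?J i"
      then show "j \<le> k" using j(4) by (metis (mono_tags) less_irrefl mem_Collect_eq not_less)
    qed (use j in auto)
    then show "map lab (pieces Xs w (length q)) ! i = q ! i" using i j(3) by (simp add: nth_pieces)
  qed simp
  show "descending r (pieces Xs w (length q))" if r: "natural r" and d: "descending r Xs"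
    unfolding descending_def
  proof (intro allI impI)
    fix i k assume ik: "i < k" "k < length (pieces Xs w (length q))"
    then obtain j where j: "j < length Xs" "w ! j = i" "\<forall>j'<j. w ! j' < i"
      using first[of i] by auto
    have "r (C (U Xs (?J k)), C (U Xs (?J i)))"
    proof (rule natural_U[OF r p])
      show "j \<in> ?J i" "j \<notin> ?J k" using j ik by auto
      fix s assume "s \<in> ?J k - ?J i"
      then have "s < length Xs" "w ! s = k" by auto
      moreover have "j < s" using calculation j ik by (metis linorder_neqE_nat not_less_iff_gr_or_eq)
      ultimately show "r (C (Xs ! s), C (Xs ! j))" using descendingD[OF d] by blast
    qed auto
    then show "r (C (pieces Xs w (length q) ! k), C (pieces Xs w (length q) ! i))"
      using ik by (simp add: nth_pieces)
  qed
qed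

text \<open>
  Conversely, let \<open>g\<close> embed a subalgebra, and let its atoms be sorted by the ordering pulled back
  along \<open>g\<close>. If the letters of its word did not first occur in their order, then some
  atom would have an image with a larger top constituent than an atom that precedes it.
\<close>

lemma word_of_subalgebra:
  assumes r: "natural r" and Ds: "part Ds" "descending r Ds" and Xs: "part Xs"
    and g: "g \<in> carrier G" "g ` span Xs \<subseteq> span Ds" and dX: "descending (\<lambda>(x, y). r (g x, g y)) Xs"
  shows "\<exists>u. emb 0 (map lab Xs) (map lab Ds) u \<and>
    (\<forall>S\<subseteq>{..<length Xs}. g (C (U Xs S)) = C (U (pieces Ds u (length Xs)) S))"
proof -
  let ?n = "length Xs" and ?m = "length Ds"
  have "\<exists>S\<subseteq>{..<?m}. g (C (Xs ! i)) = C (U Ds S)" if "i < ?n" for i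
  proof -
    have "C (U Xs {i}) \<in> span Xs" using that unfolding span_def by blast
    then have "g (C (Xs ! i)) \<in> span Ds" using g(2) by auto
    then show ?thesis by (auto simp: span_def)
  qed
  then obtain I where I: "\<And>i. i < ?n \<Longrightarrow> I i \<subseteq> {..<?m}" "\<And>i. i < ?n \<Longrightarrow> g (C (Xs ! i)) = C (U Ds (I i))"
    by metis
  have Xsub: "Xs ! i \<subseteq> K" if "i < ?n" for i by (rule part_nth(1)[OF Xs that])
  have Isub: "U Ds (I i) \<subseteq> K" if "i < ?n" for i by (rule U_sub[OF Ds(1) I(1)[OF that]])
  have gU: "g (C (U Xs S)) = C (U Ds (\<Union>i\<in>S. I i))" if "S \<subseteq> {..<?n}" for S
    unfolding U_UN unfolding U_def[of Xs]
  proof (rule G_UN[OF g(1) finite_idx[OF that]])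
    fix i assume "i \<in> S"
    then have "i < ?n" using that by auto
    then show "Xs ! i \<subseteq> K" "U Ds (I i) \<subseteq> K" "g (C (Xs ! i)) = C (U Ds (I i))"
      using Xsub Isub I(2) by blast+
  qed
  have disj: "I i \<inter> I j = {}" if "i < ?n" "j < ?n" "i \<noteq> j" for i j
  proof -
    have "g (C (Xs ! i \<inter> Xs ! j)) = C (U Ds (I i) \<inter> U Ds (I j))"
      by (rule G_Int[OF g(1) Xsub[OF that(1)] Xsub[OF that(2)] Isub[OF that(1)] Isub[OF that(2)] I(2)[OF that(1)] I(2)[OF that(2)]])
    then have "C (U Ds (I i \<inter> I j)) = C (U Ds {})"
      using part_disjoint[OF Xs that] G_empty[OF g(1)] U_Int[OF Ds(1) I(1)[OF that(1)] I(1)[OF that(2)]] by simp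
    then show ?thesis using C_U_eq_iff[OF Ds(1), of "I i \<inter> I j" "{}"] I(1)[OF that(1)] by auto
  qed
  have cover: "(\<Union>i<?n. I i) = {..<?m}"
  proof -
    have "C (U Ds (\<Union>i<?n. I i)) = C (U Ds {..<?m})"
      using gU[of "{..<?n}"] part_U_all[OF Xs] part_U_all[OF Ds(1)] G_top[OF g(1)] by simp
    moreover have "(\<Union>i<?n. I i) \<subseteq> {..<?m}" using I(1) by blast
    ultimately show ?thesis using C_U_eq_iff[OF Ds(1), of _ "{..<?m}"] by blast
  qed
  define u where "u = map (\<lambda>j. THE i. i < ?n \<and> j \<in> I i) [0..<?m]"
  have lenu: "length u = ?m" by (simp add: u_def)
  have in_some: "\<exists>k<?n. j \<in> I k" if "j < ?m" for j
    using that unfolding lessThan_iff[symmetric] cover[symmetric] by blast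
  have u: "u ! j = i \<longleftrightarrow> j \<in> I i" if "j < ?m" "i < ?n" for i j
  proof -
    from in_some[OF that(1)] obtain k where k: "k < ?n" "j \<in> I k" by blast
    have "u ! j = k" unfolding u_def using that(1) k disj by (auto intro!: the_equality)
    then show ?thesis using k disj[OF k(1) that(2)] by auto
  qed
  have un: "u ! j < ?n" if "j < ?m" for j
  proof -
    from in_some[OF that] obtain k where k: "k < ?n" "j \<in> I k" by blast
    then have "u ! j = k" using u[OF that k(1)] by simp
    then show ?thesis using k(1) by simp
  qed
  have nonempty: "I i \<noteq> {}" if "i < ?n" for i
  proof
    assume "I i = {}"
    then have "g (C (Xs ! i)) = g (C {})" using I(2)[OF that] G_empty[OF g(1)] by simp
    then have "C (Xs ! i) = C {}" using G_inj[OF g(1)] Xsub[OF that] by simp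
    then show False using C_eq_bot[OF Xsub[OF that]] part_nth(2)[OF Xs that] by simp
  qed
  have sD: "sorted_wrt (\<le>) (map lab Ds)" by (rule descending_labs[OF r Ds])
  have "emb 0 (map lab Xs) (map lab Ds) u"
    unfolding emb_iff
  proof (intro conjI allI impI)
    show "length u = length (map lab Ds)" using lenu by simp
    show "set u \<subseteq> {..<0 + length (map lab Xs)}" using un lenu by (auto simp: set_conv_nth)
    fix i assume "i < length (map lab Xs)"
    then have i: "i < ?n" by simp
    define j where "j = Min (I i)"
    have fin: "finite (I i)" by (rule finite_idx[OF I(1)[OF i]])
    have j: "j \<in> I i" unfolding j_def by (rule Min_in[OF fin nonempty[OF i]])
    have jm: "j < ?m" using j I(1)[OF i] by auto
    have jmin: "j \<le> k" if "k \<in> I i" for k unfolding j_def by (rule Min_le[OF fin that])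
    have "lab (U Ds (I i)) = lab (Ds ! j)" by (rule lab_U_sorted[OF sD I(1)[OF i] j jmin])
    moreover have "lab (U Ds (I i)) = lab (Xs ! i)" by (rule G_lab[OF g(1) Xsub[OF i] Isub[OF i] I(2)[OF i]])
    moreover have "u ! j' < i" if j': "j' < j" for j'
    proof (rule ccontr)
      \<comment> \<open>otherwise a later piece of \<open>Xs\<close> would have a larger top entry in \<open>Ds\<close>\<close>
      assume not: "\<not> u ! j' < i"
      define k where "k = u ! j'"
      have j'm: "j' < ?m" using j' jm by simp
      then have k: "k < ?n" "j' \<in> I k" using un u by (auto simp: k_def)
      have "k \<noteq> i" using jmin[of j'] k(2) j' by auto
      then have "i < k" using not by (simp add: k_def)
      then have "r (C (U Ds (I k)), C (U Ds (I i)))"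
        using descendingD[OF dX, of i k] I(2)[OF i] I(2)[OF k(1)] k(1) by simp
      moreover have "r (C (U Ds (I i)), C (U Ds (I k)))"
      proof (rule natural_U[OF r Ds(1) I(1)[OF i] I(1)[OF k(1)] k(2)])
        show "j' \<notin> I i" using jmin[of j'] j' by auto
        fix s assume "s \<in> I i - I k"
        then have "j' < s" "s < ?m" using jmin[of s] j' I(1)[OF i] by auto
        then show "r (C (Ds ! s), C (Ds ! j'))" by (rule descendingD[OF Ds(2)])
      qed
      ultimately show False using natural_asym[OF r Isub[OF k(1)] Isub[OF i]] by blast
    qed
    ultimately show "\<exists>j<length (map lab Ds). u ! j = 0 + i \<and> map lab Ds ! j = map lab Xs ! i \<and> (\<forall>j'<j. u ! j' < 0 + i)"
      using jm i u[OF jm i] j by (intro exI[of _ j]) simp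
  qed
  moreover have "g (C (U Xs S)) = C (U (pieces Ds u ?n) S)" if S: "S \<subseteq> {..<?n}" for S
  proof -
    have "(\<Union>i\<in>S. I i) = {j. j < ?m \<and> u ! j \<in> S}"
    proof (intro equalityI subsetI)
      fix j assume "j \<in> (\<Union>i\<in>S. I i)"
      then obtain i where i: "i \<in> S" "j \<in> I i" by blast
      then have "i < ?n" using S by auto
      then have "j < ?m" using I(1) i(2) by blast
      then show "j \<in> {j. j < ?m \<and> u ! j \<in> S}" using u[OF _ \<open>i < ?n\<close>] i by auto
    next
      fix j assume "j \<in> {j. j < ?m \<and> u ! j \<in> S}"
      then show "j \<in> (\<Union>i\<in>S. I i)" using u[of j "u ! j"] un by auto
    qed
    then show ?thesis using gU[OF S] U_pieces[OF S] by simp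
  qed
  ultimately show ?thesis by blast
qed

text \<open>
  The sizes \<open>q\<close> of the atoms of \<open>As\<close> are the same list for all proper enumerations of these atoms, so for
  each enumeration in \<open>L\<close> the words for \<open>q\<close> encode the copies on which the ordering induces
  this enumeration. The colour of a word collects the colours of its copies for all enumerations in
  \<open>L\<close>. A subspace \<open>v\<close> on which it is constant defines the automorphism \<open>h\<close>: it maps the
  atoms \<open>Ds\<close> to the pieces that \<open>v\<close> cuts out of a partition with the pattern \<open>c\<close>.
\<close>

theorem ramsey_for_orders:
  fixes \<gamma> :: "('a set set \<Rightarrow> 'a set set) \<Rightarrow> nat"
  assumes r: "natural r" and As: "part As" and Ds0: "part Ds0"
    and bound: "\<And>g. \<gamma> g < R"
    and invar: "\<And>g g'. g \<in> carrier G \<Longrightarrow> g' \<in> carrier G \<Longrightarrow> (\<And>x. x \<in> span As \<Longrightarrow> g x = g' x) \<Longrightarrow> \<gamma> g = \<gamma> g'"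
  shows "\<exists>h\<in>carrier G. \<forall>g1\<in>carrier G. \<forall>g2\<in>carrier G.
    g1 ` span As \<subseteq> span Ds0 \<longrightarrow> g2 ` span As \<subseteq> span Ds0 \<longrightarrow>
    (\<forall>x\<in>span As. \<forall>y\<in>span As. r (h (g1 x), h (g1 y)) \<longleftrightarrow> r (h (g2 x), h (g2 y))) \<longrightarrow>
    \<gamma> (h \<otimes>\<^bsub>G\<^esub> g1) = \<gamma> (h \<otimes>\<^bsub>G\<^esub> g2)"
proof -
  obtain Ds where Ds: "part Ds" "set Ds = set Ds0" "descending r Ds" using descending_exists[OF r Ds0] by blast
  have spD: "span Ds0 = span Ds" using span_perm[OF Ds(2)] by simp
  define d where "d = map lab Ds"
  have d: "sorted_wrt (\<le>) d" unfolding d_def by (rule descending_labs[OF r Ds(1,3)])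
  obtain As1 where As1: "part As1" "set As1 = set As" "descending r As1" using descending_exists[OF r As] by blast
  define q where "q = map lab As1"
  define L where "L = {Xs. distinct Xs \<and> set Xs = set As \<and> map lab Xs = q}"
  have "finite L"
    by (rule finite_subset[of _ "{Xs. set Xs \<subseteq> set As \<and> length Xs \<le> length q}"])
       (auto simp: L_def dest: arg_cong[of _ _ length] intro: finite_lists_length_le)
  then obtain enc R' where enc: "colour_code L R enc R'" using colour_code_exists by blast
  have Lpart: "part Xs" "span Xs = span As" "length Xs = length q" if "Xs \<in> L" for Xs
    using that part_perm[OF As] span_perm[of Xs As] by (auto simp: L_def dest: arg_cong[of _ _ length])
  from ramsey_embeddings[OF d, of 0 R' q] obtain c where c: "sorted_wrt (\<le>) c" "set c \<subseteq> set d"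
    and c_good: "forces 0 d c R' (const_copies 0 q d)" by blast
  \<comment> \<open>any colouring shows that \<open>c\<close> contains a copy of \<open>d\<close>, so its first label is that of \<open>K\<close>\<close>
  have "enc (\<lambda>_. \<gamma> undefined) < R'" using colour_code_bound[OF enc] bound by simp
  then have "\<forall>w :: nat list. (\<lambda>_. 0) w < R'" by simp
  from forcesD[OF c_good this] obtain v0 where v0: "emb 0 d c v0" by blast
  have "0 < length d" using part_nonempty[OF Ds(1)] by (simp add: d_def)
  then obtain j where j: "j < length c" "v0 ! j = 0" "c ! j = d ! 0" "\<forall>j'<j. v0 ! j' < 0"
    using v0 unfolding emb_iff by (metis add_0)
  then have "j = 0" by (metis not_gr_zero not_less_zero)
  have "d ! 0 = lab K" using sorted_head[OF Ds(1)] d by (simp add: d_def)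
  then have c0: "c \<noteq> []" "c ! 0 = lab K" using j \<open>j = 0\<close> by auto
  have "\<exists>Z\<subseteq>K. \<not> small Z \<and> lab Z = l" if "l \<in> set c" for l
    using c(2) that label_realizable[OF Ds(1)] unfolding d_def by blast
  from realize_descending[OF r c0 c(1) this] obtain Cs where Cs: "part Cs" "descending r Cs" "map lab Cs = c"
    by blast
  have sC: "sorted_wrt (\<le>) (map lab Cs)" using c(1) Cs(3) by simp
  define gg where "gg Xs w = (SOME g. g \<in> carrier G \<and>
     (\<forall>S\<subseteq>{..<length q}. g (C (U Xs S)) = C (U (pieces Cs w (length q)) S)))" for Xs w
  have gg: "gg Xs w \<in> carrier G"
    "\<And>S. S \<subseteq> {..<length q} \<Longrightarrow> gg Xs w (C (U Xs S)) = C (U (pieces Cs w (length q)) S)"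
    if X: "Xs \<in> L" and w: "emb 0 q c w" for Xs w
  proof -
    have "emb 0 q (map lab Cs) w" using w Cs(3) by simp
    note pc = emb_pieces[OF Cs(1) sC this]
    have lq: "map lab Xs = q" "length Xs = length q" using X Lpart(3)[OF X] by (auto simp: L_def)
    have "\<exists>g\<in>carrier G. \<forall>S\<subseteq>{..<length Xs}. g (C (U Xs S)) = C (U (pieces Cs w (length q)) S)"
      by (rule homogeneous[OF Lpart(1)[OF X] pc(1)]) (simp add: lq(1) pc(2))
    then have "\<exists>g. g \<in> carrier G \<and> (\<forall>S\<subseteq>{..<length q}. g (C (U Xs S)) = C (U (pieces Cs w (length q)) S))"
      using lq(2) by auto
    from someI_ex[OF this] show "gg Xs w \<in> carrier G"
      "\<And>S. S \<subseteq> {..<length q} \<Longrightarrow> gg Xs w (C (U Xs S)) = C (U (pieces Cs w (length q)) S)"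
      unfolding gg_def by blast+
  qed
  define col where "col w = enc (\<lambda>Xs. \<gamma> (gg Xs w))" for w
  have "\<forall>w. col w < R'" unfolding col_def using colour_code_bound[OF enc] bound by simp
  from forcesD[OF c_good this] obtain v where v: "emb 0 d c v"
    and same: "const_copies 0 q d col v" by blast
  have "emb 0 d (map lab Cs) v" using v Cs(3) by simp
  note pv = emb_pieces[OF Cs(1) sC this]
  define Es where "Es = pieces Cs v (length d)"
  have lenE: "length Es = length Ds" by (simp add: Es_def d_def)
  obtain h where h: "h \<in> carrier G" "\<And>S. S \<subseteq> {..<length Ds} \<Longrightarrow> h (C (U Ds S)) = C (U Es S)"
    using homogeneous[OF Ds(1) pv(1)] pv(2) by (auto simp: Es_def d_def)
  have dE: "descending r Es" unfolding Es_def by (rule pv(3)[OF r Cs(2)])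
  have pE: "part Es" unfolding Es_def by (rule pv(1))
  have vlen: "length v = length Cs" using emb_length[OF v] Cs(3) by auto
  have vlet: "v ! k < length d" if "k < length Cs" for k
  proof -
    have "v ! k \<in> set v" using that vlen by simp
    then show ?thesis using emb_letters[OF v] by auto
  qed
  have hr: "natural (\<lambda>(x, y). r (h x, h y))" by (rule natural_pullback[OF r h(1)])
  have hD: "descending (\<lambda>(x, y). r (h x, h y)) Ds"
    unfolding descending_def
  proof (intro allI impI)
    fix i j assume ij: "i < j" "j < length Ds"
    then show "case (C (Ds ! j), C (Ds ! i)) of (x, y) \<Rightarrow> r (h x, h y)"
      using descendingD[OF dE, of i j] h(2)[of "{i}"] h(2)[of "{j}"] lenE by simp
  qed
  have word: "\<exists>u. emb 0 q d u \<and> \<gamma> (h \<otimes>\<^bsub>G\<^esub> g) = \<gamma> (gg Xs (plug 0 u v))"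
    if g: "g \<in> carrier G" "g ` span As \<subseteq> span Ds0" and X: "Xs \<in> L"
      and dX: "descending (\<lambda>(x, y). r (h (g x), h (g y))) Xs" for g Xs
  proof -
    have lq: "map lab Xs = q" "length Xs = length q" using X Lpart(3)[OF X] by (auto simp: L_def)
    have "descending (\<lambda>(x, y). (\<lambda>(x, y). r (h x, h y)) (g x, g y)) Xs" using dX by simp
    from word_of_subalgebra[OF hr Ds(1) hD Lpart(1)[OF X] g(1) _ this] g(2) Lpart(2)[OF X] spD
    obtain u where u: "emb 0 q d u"
      "\<And>S. S \<subseteq> {..<length q} \<Longrightarrow> g (C (U Xs S)) = C (U (pieces Ds u (length q)) S)"
      unfolding lq d_def by auto
    have w: "emb 0 q c (plug 0 u v)" by (rule emb_plug[OF v u(1)])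
    have ulen: "length u = length Ds" using emb_length[OF u(1)] by (simp add: d_def)
    have plug: "plug 0 u v ! k = u ! (v ! k)" if "k < length Cs" for k
      using that vlen by (simp add: plug_def)
    have "(h \<otimes>\<^bsub>G\<^esub> g) x = gg Xs (plug 0 u v) x" if "x \<in> span As" for x
    proof -
      have "x \<in> span Xs" using that Lpart(2)[OF X] by simp
      then obtain S where S: "S \<subseteq> {..<length q}" "x = C (U Xs S)"
        using lq(2) unfolding span_def by auto
      have xP: "x \<in> P" using S U_sub[OF Lpart(1)[OF X], of S] lq(2) by simp
      let ?T = "{j. j < length Ds \<and> u ! j \<in> S}"
      have "(h \<otimes>\<^bsub>G\<^esub> g) x = h (g x)" by (rule G_mult_apply[OF h(1) g(1) xP])
      also have "g x = C (U Ds ?T)" using u(2)[OF S(1)] S U_pieces[OF S(1), of Ds u] by simp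
      also have "h \<dots> = C (U Es ?T)" by (rule h(2)) auto
      also have "U Es ?T = U Cs {k. k < length Cs \<and> v ! k \<in> ?T}"
        unfolding Es_def by (rule U_pieces) (auto simp: d_def)
      also have "{k. k < length Cs \<and> v ! k \<in> ?T} = {k. k < length Cs \<and> plug 0 u v ! k \<in> S}"
        using plug vlet by (auto simp: d_def)
      also have "U Cs \<dots> = U (pieces Cs (plug 0 u v) (length q)) S"
        by (rule U_pieces[OF S(1), symmetric])
      also have "C \<dots> = gg Xs (plug 0 u v) x" using gg(2)[OF X w S(1)] S(2) by simp
      finally show ?thesis .
    qed
    then have "\<gamma> (h \<otimes>\<^bsub>G\<^esub> g) = \<gamma> (gg Xs (plug 0 u v))"
      using g(1) h(1) gg(1)[OF X w] by (intro invar) auto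
    then show ?thesis using u(1) by blast
  qed
  show ?thesis
  proof (intro bexI[OF _ h(1)] ballI impI)
    fix g1 g2 assume g1: "g1 \<in> carrier G" "g1 ` span As \<subseteq> span Ds0"
      and g2: "g2 \<in> carrier G" "g2 ` span As \<subseteq> span Ds0"
      and ord: "\<forall>x\<in>span As. \<forall>y\<in>span As. r (h (g1 x), h (g1 y)) \<longleftrightarrow> r (h (g2 x), h (g2 y))"
    have n1: "natural (\<lambda>(x, y). r (h (g1 x), h (g1 y)))"
      using natural_pullback[OF hr g1(1)] by simp
    obtain Xs where Xs: "part Xs" "set Xs = set As" "descending (\<lambda>(x, y). r (h (g1 x), h (g1 y))) Xs"
      using descending_exists[OF n1 As] by blast
    have "distinct Xs" "distinct As1" using Xs(1) As1(1) unfolding part_iff_set by blast+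
    then have "mset Xs = mset As1" using set_eq_iff_mset_eq_distinct Xs(2) As1(2) by metis
    then have "mset (map lab Xs) = mset (map lab As1)" by simp
    then have "map lab Xs = q"
      unfolding q_def using descending_labs[OF n1 Xs(1,3)] descending_labs[OF r As1(1,3)]
      by (intro sorted_wrt_le_unique)
    then have X: "Xs \<in> L" using Xs by (simp add: L_def part_iff_set)
    have mem: "C (Xs ! i) \<in> span As" if "i < length Xs" for i
    proof -
      have "C (U Xs {i}) \<in> span Xs" using that unfolding span_def by blast
      then show ?thesis using Lpart(2)[OF X] by simp
    qed
    have "descending (\<lambda>(x, y). r (h (g2 x), h (g2 y))) Xs"
      using Xs(3) ord mem unfolding descending_def by simp
    from word[OF g2 X this] obtain u2
      where u2: "emb 0 q d u2" "\<gamma> (h \<otimes>\<^bsub>G\<^esub> g2) = \<gamma> (gg Xs (plug 0 u2 v))" by blast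
    from word[OF g1 X Xs(3)] obtain u1
      where u1: "emb 0 q d u1" "\<gamma> (h \<otimes>\<^bsub>G\<^esub> g1) = \<gamma> (gg Xs (plug 0 u1 v))" by blast
    have "enc (\<lambda>Xs. \<gamma> (gg Xs (plug 0 u1 v))) = enc (\<lambda>Xs. \<gamma> (gg Xs (plug 0 u2 v)))"
      using const_copiesD[OF same u1(1) u2(1)] by (simp add: col_def)
    from colour_code_eqD[OF enc, OF this X] show "\<gamma> (h \<otimes>\<^bsub>G\<^esub> g1) = \<gamma> (h \<otimes>\<^bsub>G\<^esub> g2)"
      using u1(2) u2(2) bound by simp
  qed
qed

end

section \<open>The flow of natural orderings\<close>

lemma compact_family_meets:
  assumes X: "compact_space X" and cl: "\<And>i. i \<in> I \<Longrightarrow> closedin X (A i)"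
    and fin: "\<And>F. finite F \<Longrightarrow> F \<subseteq> I \<Longrightarrow> \<exists>x\<in>topspace X. \<forall>i\<in>F. x \<in> A i"
  shows "\<exists>x\<in>topspace X. \<forall>i\<in>I. x \<in> A i"
proof -
  let ?U = "insert (topspace X) (A ` I)"
  have "\<Inter> ?U \<noteq> {}"
  proof (rule compact_space_fip[THEN iffD1, OF X, rule_format], intro conjI ballI allI impI)
    fix D assume "D \<in> ?U"
    then show "closedin X D" using cl by auto
  next
    fix \<F> assume F: "finite \<F> \<and> \<F> \<subseteq> ?U"
    then have "finite (\<F> - {topspace X})" "\<F> - {topspace X} \<subseteq> A ` I" by auto
    then obtain F' where F': "F' \<subseteq> I" "finite F'" "\<F> - {topspace X} = A ` F'"
      by (metis finite_subset_image)
    from fin[OF F'(2,1)] obtain x where x: "x \<in> topspace X" "\<forall>i\<in>F'. x \<in> A i" by blast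
    have "x \<in> D" if "D \<in> \<F>" for D
    proof (cases "D = topspace X")
      case False
      then have "D \<in> A ` F'" using that F'(3) by blast
      then show ?thesis using x(2) by blast
    qed (use x in simp)
    then show "\<Inter> \<F> \<noteq> {}" by blast
  qed
  then show ?thesis by blast
qed

text \<open>
  The topologies of the automorphism group and of the space of natural orderings are both of this form.
\<close>

lemma openin_pointwise_iff:
  assumes S: "S \<subseteq> (J \<rightarrow>\<^sub>E D)"
  shows "openin (subtopology (product_topology (\<lambda>_. discrete_topology D) J) S) V \<longleftrightarrow>
    V \<subseteq> S \<and> (\<forall>f\<in>V. \<exists>F. finite F \<and> F \<subseteq> J \<and> (\<forall>g\<in>S. (\<forall>x\<in>F. g x = f x) \<longrightarrow> g \<in> V))"
    (is "?L \<longleftrightarrow> ?R")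
proof
  assume ?L
  then obtain W where W: "openin (product_topology (\<lambda>_. discrete_topology D) J) W" "V = W \<inter> S"
    by (auto simp: openin_subtopology)
  have "\<exists>F. finite F \<and> F \<subseteq> J \<and> (\<forall>g\<in>S. (\<forall>x\<in>F. g x = f x) \<longrightarrow> g \<in> V)" if f: "f \<in> V" for f
  proof -
    obtain U where U: "finite {i \<in> J. U i \<noteq> D}" "f \<in> Pi\<^sub>E J U" "Pi\<^sub>E J U \<subseteq> W"
      using W f unfolding openin_product_topology_alt by auto
    have "g \<in> V" if g: "g \<in> S" "\<forall>x\<in>{i \<in> J. U i \<noteq> D}. g x = f x" for g
    proof -
      have "g \<in> J \<rightarrow>\<^sub>E D" using S g(1) by blast
      moreover have "g i \<in> U i" if "i \<in> J" for i
      proof (cases "U i = D")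
        case True
        then show ?thesis using calculation that by auto
      next
        case False
        then have "g i = f i" using g(2) that by blast
        then show ?thesis using U(2) that by auto
      qed
      ultimately have "g \<in> Pi\<^sub>E J U" by (auto simp: PiE_iff)
      then show ?thesis using U(3) W(2) g(1) by blast
    qed
    then show ?thesis using U(1) by (intro exI[of _ "{i \<in> J. U i \<noteq> D}"]) auto
  qed
  then show ?R using W(2) by blast
next
  assume R: ?R
  then obtain F where F: "\<And>f. f \<in> V \<Longrightarrow> finite (F f)" "\<And>f. f \<in> V \<Longrightarrow> F f \<subseteq> J"
    "\<And>f g. f \<in> V \<Longrightarrow> g \<in> S \<Longrightarrow> (\<forall>x\<in>F f. g x = f x) \<Longrightarrow> g \<in> V" by metis
  define W where "W = {g \<in> J \<rightarrow>\<^sub>E D. \<exists>f\<in>V. \<forall>x\<in>F f. g x = f x}"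
  have "openin (product_topology (\<lambda>_. discrete_topology D) J) W"
    unfolding openin_product_topology_alt
  proof
    fix g assume g: "g \<in> W"
    then obtain f where f: "f \<in> V" "\<forall>x\<in>F f. g x = f x" by (auto simp: W_def)
    define U where "U i = (if i \<in> F f then {g i} else D)" for i
    have gD: "g \<in> J \<rightarrow>\<^sub>E D" using g by (simp add: W_def)
    have "{i \<in> J. U i \<noteq> topspace (discrete_topology D)} \<subseteq> F f" by (auto simp: U_def)
    then have "finite {i \<in> J. U i \<noteq> topspace (discrete_topology D)}"
      using F(1)[OF f(1)] finite_subset by blast
    moreover have "\<forall>i\<in>J. openin (discrete_topology D) (U i)" using gD by (auto simp: U_def)
    moreover have "g \<in> Pi\<^sub>E J U" using gD by (auto simp: U_def PiE_iff)
    moreover have "Pi\<^sub>E J U \<subseteq> W"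
    proof
      fix k assume k: "k \<in> Pi\<^sub>E J U"
      have "k i \<in> D" if "i \<in> J" for i
        using k gD that by (auto simp: U_def PiE_iff split: if_splits)
      moreover have "k x = f x" if "x \<in> F f" for x
      proof -
        have "x \<in> J" using F(2)[OF f(1)] that by blast
        then have "k x \<in> U x" using k by (auto simp: PiE_iff)
        then show ?thesis using that f(2) by (simp add: U_def)
      qed
      ultimately show "k \<in> W" using k f(1) by (auto simp: W_def PiE_iff)
    qed
    ultimately show "\<exists>U. finite {i \<in> J. U i \<noteq> topspace (discrete_topology D)} \<and>
      (\<forall>i\<in>J. openin (discrete_topology D) (U i)) \<and> g \<in> Pi\<^sub>E J U \<and> Pi\<^sub>E J U \<subseteq> W"
      by blast
  qed
  moreover have "V = W \<inter> S" using R S F(3) by (auto simp: W_def)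
  ultimately show ?L by (auto simp: openin_subtopology)
qed

lemma openin_prod_iff:
  "openin (prod_topology X Y) S \<longleftrightarrow>
     (\<forall>p\<in>S. \<exists>U V. openin X U \<and> openin Y V \<and> fst p \<in> U \<and> snd p \<in> V \<and> U \<times> V \<subseteq> S)"
  unfolding openin_prod_topology_alt Ball_def split_paired_All by simp

context cardinal_quotient
begin

abbreviation "TG \<equiv> Aut_topology lam kap"
abbreviation "TN \<equiv> NO_topology lam kap"
abbreviation "N \<equiv> NO lam kap"
abbreviation "act \<equiv> NO_action lam kap"

lemma G_subset_PiE: "carrier G \<subseteq> (P \<rightarrow>\<^sub>E P)"
proof
  fix g assume "g \<in> carrier G"
  then have "g \<in> Bij P" by (rule G_Bij)
  then show "g \<in> P \<rightarrow>\<^sub>E P" using Bij_imp_funcset[of g P] Bij_imp_extensional[of g P] by (simp add: PiE_def)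
qed

lemma N_subset_PiE: "N \<subseteq> (P \<times> P \<rightarrow>\<^sub>E (UNIV :: bool set))"
  using NO_iff by (auto simp: PiE_def)

lemma topspace_TG [simp]: "topspace TG = carrier G"
  using G_subset_PiE by (auto simp: Aut_topology_def)

lemma topspace_TN [simp]: "topspace TN = N"
  using N_subset_PiE by (auto simp: NO_topology_def)

lemma openin_TG: "openin TG V \<longleftrightarrow>
    V \<subseteq> carrier G \<and> (\<forall>f\<in>V. \<exists>F. finite F \<and> F \<subseteq> P \<and> (\<forall>g\<in>carrier G. (\<forall>x\<in>F. g x = f x) \<longrightarrow> g \<in> V))"
  unfolding Aut_topology_def by (rule openin_pointwise_iff[OF G_subset_PiE])

lemma openin_TN: "openin TN V \<longleftrightarrow>
    V \<subseteq> N \<and> (\<forall>f\<in>V. \<exists>F. finite F \<and> F \<subseteq> P \<times> P \<and> (\<forall>g\<in>N. (\<forall>x\<in>F. g x = f x) \<longrightarrow> g \<in> V))"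
  unfolding NO_topology_def by (rule openin_pointwise_iff[OF N_subset_PiE])

lemma openin_TG_nhd:
  "openin TG W \<Longrightarrow> g \<in> W \<Longrightarrow>
     \<exists>F. finite F \<and> F \<subseteq> P \<and> (\<forall>k\<in>carrier G. (\<forall>x\<in>F. k x = g x) \<longrightarrow> k \<in> W)"
  by (rule openin_TG[THEN iffD1, THEN conjunct2, THEN bspec])

lemma openin_TN_nhd:
  "openin TN W \<Longrightarrow> r \<in> W \<Longrightarrow>
     \<exists>F. finite F \<and> F \<subseteq> P \<times> P \<and> (\<forall>s\<in>N. (\<forall>x\<in>F. s x = r x) \<longrightarrow> s \<in> W)"
  by (rule openin_TN[THEN iffD1, THEN conjunct2, THEN bspec])

lemma openin_TG_cylinder:
  assumes "finite F" "F \<subseteq> P" shows "openin TG {g \<in> carrier G. \<forall>x\<in>F. g x = f x}"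
  unfolding openin_TG using assms by auto

lemma openin_TN_cylinder:
  assumes "finite F" "F \<subseteq> P \<times> P" shows "openin TN {r \<in> N. \<forall>x\<in>F. r x = f x}"
  unfolding openin_TN using assms by auto

lemma TG_topological_group: "topological_group G TG"
  unfolding topological_group_def
proof (intro conjI)
  show "group G" by (rule group_G)
  show "topspace TG = carrier G" by simp
  show "continuous_map (prod_topology TG TG) TG (\<lambda>(g, h). g \<otimes>\<^bsub>G\<^esub> h)"
    unfolding continuous_map_def
  proof (intro conjI allI impI)
    show "(\<lambda>(g, h). g \<otimes>\<^bsub>G\<^esub> h) \<in> topspace (prod_topology TG TG) \<rightarrow> topspace TG" by auto
    fix W assume W: "openin TG W"
    show "openin (prod_topology TG TG) {p \<in> topspace (prod_topology TG TG). (case p of (g, h) \<Rightarrow> g \<otimes>\<^bsub>G\<^esub> h) \<in> W}"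
      unfolding openin_prod_iff
    proof
      fix p assume "p \<in> {p \<in> topspace (prod_topology TG TG). (case p of (g, h) \<Rightarrow> g \<otimes>\<^bsub>G\<^esub> h) \<in> W}"
      then obtain g h where p: "p = (g, h)" and gh: "g \<in> carrier G" "h \<in> carrier G" "g \<otimes>\<^bsub>G\<^esub> h \<in> W" by auto
      from openin_TG_nhd[OF W gh(3)] obtain F where F: "finite F" "F \<subseteq> P"
        and FW: "\<forall>k\<in>carrier G. (\<forall>x\<in>F. k x = (g \<otimes>\<^bsub>G\<^esub> h) x) \<longrightarrow> k \<in> W"
        by (elim exE conjE) (rule that)
      let ?U = "{g' \<in> carrier G. \<forall>x\<in>h ` F. g' x = g x}"
      let ?V = "{h' \<in> carrier G. \<forall>x\<in>F. h' x = h x}"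
      have "h ` F \<subseteq> P" using F(2) G_closed[OF gh(2)] by blast
      then have "openin TG ?U" "openin TG ?V"
        using F by (simp_all add: openin_TG_cylinder del: ball_simps)
      moreover have "g' \<otimes>\<^bsub>G\<^esub> h' \<in> W" if "g' \<in> ?U" "h' \<in> ?V" for g' h'
      proof (rule FW[THEN bspec, THEN mp])
        show "\<forall>x\<in>F. (g' \<otimes>\<^bsub>G\<^esub> h') x = (g \<otimes>\<^bsub>G\<^esub> h) x"
          using that gh F(2) by (auto simp: G_mult_apply subset_iff)
      qed (use that in auto)
      ultimately show "\<exists>U V. openin TG U \<and> openin TG V \<and> fst p \<in> U \<and> snd p \<in> V \<and>
          U \<times> V \<subseteq> {p \<in> topspace (prod_topology TG TG). (case p of (g, h) \<Rightarrow> g \<otimes>\<^bsub>G\<^esub> h) \<in> W}"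
        using gh p by (intro exI[of _ ?U] exI[of _ ?V]) auto
    qed
  qed
  show "continuous_map TG TG (\<lambda>g. inv\<^bsub>G\<^esub> g)"
    unfolding continuous_map_def
  proof (intro conjI allI impI)
    show "(\<lambda>g. inv\<^bsub>G\<^esub> g) \<in> topspace TG \<rightarrow> topspace TG" by auto
    fix W assume W: "openin TG W"
    have "\<exists>F. finite F \<and> F \<subseteq> P \<and> (\<forall>g'\<in>carrier G. (\<forall>x\<in>F. g' x = g x) \<longrightarrow> inv\<^bsub>G\<^esub> g' \<in> W)"
      if g: "g \<in> carrier G" "inv\<^bsub>G\<^esub> g \<in> W" for g
    proof -
      from openin_TG_nhd[OF W g(2)] obtain F where F: "finite F" "F \<subseteq> P"
        and FW: "\<forall>k\<in>carrier G. (\<forall>x\<in>F. k x = (inv\<^bsub>G\<^esub> g) x) \<longrightarrow> k \<in> W"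
        by (elim exE conjE) (rule that)
      have "inv\<^bsub>G\<^esub> g' \<in> W" if g': "g' \<in> carrier G" "\<forall>x\<in>(inv\<^bsub>G\<^esub> g) ` F. g' x = g x" for g'
      proof (rule FW[THEN bspec, THEN mp])
        show "\<forall>x\<in>F. (inv\<^bsub>G\<^esub> g') x = (inv\<^bsub>G\<^esub> g) x"
        proof
          fix x assume x: "x \<in> F"
          then have xP: "x \<in> P" using F(2) by blast
          have "g' ((inv\<^bsub>G\<^esub> g) x) = x" using g'(2) x G_inv_right[OF g(1) xP] by simp
          then show "(inv\<^bsub>G\<^esub> g') x = (inv\<^bsub>G\<^esub> g) x"
            using G_inv_left[OF g'(1), of "(inv\<^bsub>G\<^esub> g) x"] g(1) xP by simp
        qed
      qed (use g' in simp)
      moreover have "(inv\<^bsub>G\<^esub> g) ` F \<subseteq> P" using F(2) g(1) by auto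
      ultimately show ?thesis using F(1) by (intro exI[of _ "(inv\<^bsub>G\<^esub> g) ` F"]) auto
    qed
    then show "openin TG {g \<in> topspace TG. inv\<^bsub>G\<^esub> g \<in> W}"
      unfolding openin_TG by auto
  qed
qed

lemma natural_at_cong:
  assumes "\<And>x y. x \<in> {C X, C Y, C Z, C {}, C (X - Y), C (Y - X), C (X \<union> Y)} \<Longrightarrow>
      y \<in> {C X, C Y, C Z, C {}, C (X - Y), C (Y - X), C (X \<union> Y)} \<Longrightarrow> r (x, y) = s (x, y)"
  shows "natural_at r X Y Z \<longleftrightarrow> natural_at s X Y Z"
  unfolding natural_at_def by (simp add: assms)

lemma natural_cong:
  assumes "\<And>x y. x \<in> P \<Longrightarrow> y \<in> P \<Longrightarrow> r (x, y) = s (x, y)" "natural r"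
  shows "natural s"
  unfolding natural_def
proof (intro allI impI)
  fix X Y Z assume XYZ: "X \<subseteq> K" "Y \<subseteq> K" "Z \<subseteq> K"
  have "{C X, C Y, C Z, C {}, C (X - Y), C (Y - X), C (X \<union> Y)} \<subseteq> P" using XYZ by auto
  then have "natural_at r X Y Z \<longleftrightarrow> natural_at s X Y Z" by (intro natural_at_cong assms(1)) blast+
  then show "natural_at s X Y Z" using natural_atD[OF assms(2) XYZ] by simp
qed

lemma closedin_natural_at:
  assumes XYZ: "X \<subseteq> K" "Y \<subseteq> K" "Z \<subseteq> K"
  shows "closedin (product_topology (\<lambda>_. discrete_topology (UNIV :: bool set)) (P \<times> P))
    {r \<in> P \<times> P \<rightarrow>\<^sub>E UNIV. natural_at r X Y Z}"
proof -
  let ?T = "product_topology (\<lambda>_. discrete_topology (UNIV :: bool set)) (P \<times> P)"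
  let ?L = "{C X, C Y, C Z, C {}, C (X - Y), C (Y - X), C (X \<union> Y)}"
  have L: "?L \<subseteq> P" using XYZ by auto
  have top: "topspace ?T = (P \<times> P \<rightarrow>\<^sub>E UNIV)" by simp
  have "openin (subtopology ?T (P \<times> P \<rightarrow>\<^sub>E UNIV)) ((P \<times> P \<rightarrow>\<^sub>E UNIV) - {r \<in> P \<times> P \<rightarrow>\<^sub>E UNIV. natural_at r X Y Z})"
    unfolding openin_pointwise_iff[OF subset_refl]
  proof (intro conjI ballI)
    fix r assume r: "r \<in> (P \<times> P \<rightarrow>\<^sub>E UNIV) - {r \<in> P \<times> P \<rightarrow>\<^sub>E UNIV. natural_at r X Y Z}"
    have "\<not> natural_at s X Y Z" if "\<forall>p\<in>?L \<times> ?L. s p = r p" for s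
    proof -
      have "natural_at s X Y Z \<longleftrightarrow> natural_at r X Y Z" by (rule natural_at_cong) (use that in blast)
      then show ?thesis using r by blast
    qed
    moreover have "finite (?L \<times> ?L)" "?L \<times> ?L \<subseteq> P \<times> P" using L by (simp, blast)
    ultimately show "\<exists>F. finite F \<and> F \<subseteq> P \<times> P \<and> (\<forall>s\<in>P \<times> P \<rightarrow>\<^sub>E UNIV. (\<forall>p\<in>F. s p = r p) \<longrightarrow>
        s \<in> (P \<times> P \<rightarrow>\<^sub>E UNIV) - {r \<in> P \<times> P \<rightarrow>\<^sub>E UNIV. natural_at r X Y Z})"
      by (intro exI[of _ "?L \<times> ?L"] conjI ballI impI) simp_all
  qed blast
  then have "openin ?T ((P \<times> P \<rightarrow>\<^sub>E UNIV) - {r \<in> P \<times> P \<rightarrow>\<^sub>E UNIV. natural_at r X Y Z})"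
    using subtopology_topspace[of ?T] unfolding top by simp
  then show ?thesis unfolding closedin_def top by blast
qed

lemma compact_bool_power: "compact_space (product_topology (\<lambda>_. discrete_topology (UNIV :: bool set)) (P \<times> P))"
  by (simp add: compact_space_product_topology compact_space_discrete_topology)

text \<open>
  Finitely many local conditions involve a finite subalgebra only and can be satisfied there, so
  compactness provides an ordering that satisfies all of them.
\<close>

lemma N_nonempty: "N \<noteq> {}"
proof -
  let ?T = "product_topology (\<lambda>_. discrete_topology (UNIV :: bool set)) (P \<times> P)"
  let ?I = "Pow K \<times> Pow K \<times> Pow K"
  have "\<exists>r\<in>topspace ?T. \<forall>t\<in>?I. r \<in> {r \<in> P \<times> P \<rightarrow>\<^sub>E UNIV. case t of (X, Y, Z) \<Rightarrow> natural_at r X Y Z}"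
  proof (rule compact_family_meets[OF compact_bool_power])
    fix t assume "t \<in> ?I"
    then show "closedin ?T {r \<in> P \<times> P \<rightarrow>\<^sub>E UNIV. case t of (X, Y, Z) \<Rightarrow> natural_at r X Y Z}"
      using closedin_natural_at by (cases t) auto
  next
    fix F assume F: "finite F" "F \<subseteq> ?I"
    let ?F = "(\<lambda>(X, Y, Z). C X) ` F \<union> (\<lambda>(X, Y, Z). C Y) ` F \<union> (\<lambda>(X, Y, Z). C Z) ` F"
    have "finite ?F" "?F \<subseteq> P" using F by auto
    from finite_natural_at_satisfiable[OF this] obtain r where r: "r \<in> extensional (P \<times> P)"
      "\<forall>X Y Z. X \<subseteq> K \<longrightarrow> Y \<subseteq> K \<longrightarrow> Z \<subseteq> K \<longrightarrow> C X \<in> ?F \<longrightarrow> C Y \<in> ?F \<longrightarrow> C Z \<in> ?F \<longrightarrow> natural_at r X Y Z"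
      by (elim bexE) (rule that)
    have "natural_at r X Y Z" if t: "(X, Y, Z) \<in> F" for X Y Z
    proof -
      have "X \<subseteq> K" "Y \<subseteq> K" "Z \<subseteq> K" using t F(2) by auto
      moreover have "C X \<in> ?F" "C Y \<in> ?F" "C Z \<in> ?F" using t by force+
      ultimately show ?thesis by (rule r(2)[rule_format])
    qed
    then show "\<exists>r\<in>topspace ?T. \<forall>t\<in>F. r \<in> {r \<in> P \<times> P \<rightarrow>\<^sub>E UNIV. case t of (X, Y, Z) \<Rightarrow> natural_at r X Y Z}"
      using r(1) by (intro bexI[of _ r]) (auto simp: PiE_def)
  qed
  then obtain r where r: "r \<in> extensional (P \<times> P)"
    "\<forall>t\<in>?I. r \<in> {r \<in> P \<times> P \<rightarrow>\<^sub>E UNIV. case t of (X, Y, Z) \<Rightarrow> natural_at r X Y Z}"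
    by (auto simp: PiE_def)
  have "natural r" unfolding natural_def
  proof (intro allI impI)
    fix X Y Z assume "X \<subseteq> K" "Y \<subseteq> K" "Z \<subseteq> K"
    then have "(X, Y, Z) \<in> ?I" by simp
    then show "natural_at r X Y Z" using r(2) by blast
  qed
  then show ?thesis using r(1) NO_iff by blast
qed

lemma TN_compact: "compact_space TN" and TN_Hausdorff: "Hausdorff_space TN"
proof -
  let ?T = "product_topology (\<lambda>_. discrete_topology (UNIV :: bool set)) (P \<times> P)"
  let ?I = "Pow K \<times> Pow K \<times> Pow K"
  have "N = (\<Inter>t\<in>?I. {r \<in> P \<times> P \<rightarrow>\<^sub>E UNIV. case t of (X, Y, Z) \<Rightarrow> natural_at r X Y Z})"
  proof (intro equalityI subsetI)
    fix r assume "r \<in> N"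
    then show "r \<in> (\<Inter>t\<in>?I. {r \<in> P \<times> P \<rightarrow>\<^sub>E UNIV. case t of (X, Y, Z) \<Rightarrow> natural_at r X Y Z})"
      using natural_atD[of r] by (auto simp: NO_iff PiE_def)
  next
    fix r assume r: "r \<in> (\<Inter>t\<in>?I. {r \<in> P \<times> P \<rightarrow>\<^sub>E UNIV. case t of (X, Y, Z) \<Rightarrow> natural_at r X Y Z})"
    have "natural_at r X Y Z" if "X \<subseteq> K" "Y \<subseteq> K" "Z \<subseteq> K" for X Y Z
    proof -
      have "(X, Y, Z) \<in> ?I" using that by simp
      then show ?thesis using r by blast
    qed
    moreover have "({}, {}, {}) \<in> ?I" by simp
    then have "r \<in> P \<times> P \<rightarrow>\<^sub>E UNIV" using r by blast
    ultimately show "r \<in> N" by (simp add: NO_iff natural_def PiE_def)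
  qed
  moreover have "closedin ?T \<dots>"
    by (rule closedin_Inter) (use closedin_natural_at in auto)
  ultimately have "closedin ?T N" by simp
  then show "compact_space TN"
    unfolding NO_topology_def
    by (intro compact_space_subtopology closedin_compact_space[OF compact_bool_power])
  show "Hausdorff_space TN"
    unfolding NO_topology_def
    by (intro Hausdorff_space_subtopology) (simp add: Hausdorff_space_product_topology)
qed

lemma act_apply: "r \<in> N \<Longrightarrow> x \<in> P \<Longrightarrow> y \<in> P \<Longrightarrow> act g r (x, y) = r ((inv\<^bsub>G\<^esub> g) x, (inv\<^bsub>G\<^esub> g) y)"
  by (simp add: NO_action_def)

lemma act_closed:
  assumes g: "g \<in> carrier G" and r: "r \<in> N"
  shows "act g r \<in> N"
proof -
  have "natural r" using r NO_iff by blast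
  from natural_pullback[OF this G_inv_closed[OF g]]
  have "natural (act g r)" by (rule natural_cong[rotated]) (simp add: act_apply[OF r])
  moreover have "act g r \<in> extensional (P \<times> P)" using r by (simp add: NO_action_def)
  ultimately show ?thesis using NO_iff by blast
qed

lemma N_ext:
  assumes "r \<in> N" "s \<in> N" "\<And>x y. x \<in> P \<Longrightarrow> y \<in> P \<Longrightarrow> r (x, y) = s (x, y)"
  shows "r = s"
  using assms NO_iff by (intro extensionalityI[of r "P \<times> P" s]) auto

lemma act_mult:
  assumes "g \<in> carrier G" "h \<in> carrier G" "r \<in> N"
  shows "act (g \<otimes>\<^bsub>G\<^esub> h) r = act g (act h r)"
proof (rule N_ext)
  fix x y assume xy: "x \<in> P" "y \<in> P"
  have "(inv\<^bsub>G\<^esub> (g \<otimes>\<^bsub>G\<^esub> h)) z = (inv\<^bsub>G\<^esub> h) ((inv\<^bsub>G\<^esub> g) z)" if "z \<in> P" for z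
    using assms that by (simp add: group.inv_mult_group[OF group_G] G_mult_apply)
  then show "act (g \<otimes>\<^bsub>G\<^esub> h) r (x, y) = act g (act h r) (x, y)"
    using xy assms act_closed by (simp add: act_apply)
qed (use assms act_closed in auto)

lemma act_one:
  assumes "r \<in> N" shows "act \<one>\<^bsub>G\<^esub> r = r"
  using assms act_closed[of "\<one>\<^bsub>G\<^esub>"]
  by (intro N_ext) (auto simp: act_apply group.is_monoid[OF group_G] monoid.inv_one G_one_apply)

lemma act_inv_act:
  assumes "g \<in> carrier G" "r \<in> N"
  shows "act (inv\<^bsub>G\<^esub> g) (act g r) = r"
  using act_mult[of "inv\<^bsub>G\<^esub> g" g r] assms group.l_inv[OF group_G assms(1)] act_one by simp

lemma act_group_action: "group_action G N act"
proof -
  have bij: "act g \<in> Bij N" if g: "g \<in> carrier G" for g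
  proof -
    have "bij_betw (act g) N N"
    proof (rule bij_betw_byWitness[where f' = "act (inv\<^bsub>G\<^esub> g)"])
      show "\<forall>r\<in>N. act (inv\<^bsub>G\<^esub> g) (act g r) = r" using act_inv_act g by blast
      show "\<forall>r\<in>N. act g (act (inv\<^bsub>G\<^esub> g) r) = r"
        using act_inv_act[of "inv\<^bsub>G\<^esub> g"] g group.inv_inv[OF group_G g] by auto
    qed (use act_closed g in auto)
    then show ?thesis by (simp add: Bij_def NO_action_def)
  qed
  have "act \<in> hom G (BijGroup N)"
  proof (rule homI)
    fix g assume "g \<in> carrier G"
    then show "act g \<in> carrier (BijGroup N)" using bij by (simp add: BijGroup_def)
  next
    fix g h assume gh: "g \<in> carrier G" "h \<in> carrier G"
    have "act (g \<otimes>\<^bsub>G\<^esub> h) = compose N (act g) (act h)"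
      using bij[OF G_mult_closed[OF gh]] act_mult[OF gh]
      by (intro extensionalityI[of _ N]) (auto simp: Bij_def compose_eq)
    then show "act (g \<otimes>\<^bsub>G\<^esub> h) = act g \<otimes>\<^bsub>BijGroup N\<^esub> act h"
      using bij gh by (simp add: BijGroup_def)
  qed
  then show ?thesis
    by (simp add: group_action_def group_hom_def group_hom_axioms_def group_G group_BijGroup)
qed

lemma act_continuous: "continuous_map (prod_topology TG TN) TN (\<lambda>(g, r). act g r)"
  unfolding continuous_map_def
proof (intro conjI allI impI)
  show "(\<lambda>(g, r). act g r) \<in> topspace (prod_topology TG TN) \<rightarrow> topspace TN" using act_closed by auto
  fix W assume W: "openin TN W"
  show "openin (prod_topology TG TN) {p \<in> topspace (prod_topology TG TN). (case p of (g, r) \<Rightarrow> act g r) \<in> W}"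
    unfolding openin_prod_iff
  proof
    fix p assume "p \<in> {p \<in> topspace (prod_topology TG TN). (case p of (g, r) \<Rightarrow> act g r) \<in> W}"
    then obtain g r where p: "p = (g, r)" and gr: "g \<in> carrier G" "r \<in> N" "act g r \<in> W" by auto
    from openin_TN_nhd[OF W gr(3)] obtain F where F: "finite F" "F \<subseteq> P \<times> P"
      and FW: "\<forall>s\<in>N. (\<forall>x\<in>F. s x = act g r x) \<longrightarrow> s \<in> W"
      by (elim exE conjE) (rule that)
    let ?i = "inv\<^bsub>G\<^esub> g"
    let ?D = "?i ` (fst ` F \<union> snd ` F)"
    let ?E = "(\<lambda>(x, y). (?i x, ?i y)) ` F"
    let ?U = "{g' \<in> carrier G. \<forall>x\<in>?D. g' x = g x}"
    let ?V = "{s \<in> N. \<forall>q\<in>?E. s q = r q}"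
    have FP: "fst ` F \<union> snd ` F \<subseteq> P" using F(2) by auto
    have "?D \<subseteq> P" using FP gr(1) by auto
    then have "openin TG ?U" using F(1) by (intro openin_TG_cylinder) auto
    moreover have "?E \<subseteq> P \<times> P" using F(2) gr(1) by auto
    then have "openin TN ?V" using F(1) by (intro openin_TN_cylinder) auto
    moreover have "act g' s \<in> W" if g': "g' \<in> ?U" and s: "s \<in> ?V" for g' s
    proof (rule FW[THEN bspec, THEN mp])
      show "act g' s \<in> N" using g' s by (intro act_closed) auto
      have inv_eq: "(inv\<^bsub>G\<^esub> g') x = ?i x" if x: "x \<in> fst ` F \<union> snd ` F" for x
      proof -
        have xP: "x \<in> P" using FP x by blast
        have "g' (?i x) = g (?i x)" using g' x by blast
        then have "g' (?i x) = x" using G_inv_right[OF gr(1) xP] by simp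
        then show ?thesis using G_inv_left[of g' "?i x"] g' gr(1) xP by auto
      qed
      show "\<forall>q\<in>F. act g' s q = act g r q"
      proof
        fix q assume q: "q \<in> F"
        obtain x y where xy: "q = (x, y)" by (cases q)
        have xyP: "x \<in> P" "y \<in> P" using q xy F(2) by auto
        have mem: "x \<in> fst ` F \<union> snd ` F" "y \<in> fst ` F \<union> snd ` F" using q xy by force+
        have "(?i x, ?i y) \<in> ?E" using q xy by force
        then have "s (?i x, ?i y) = r (?i x, ?i y)" using s by blast
        then show "act g' s q = act g r q"
          using xy xyP s gr(2) inv_eq[OF mem(1)] inv_eq[OF mem(2)] by (simp add: act_apply)
      qed
    qed
    ultimately show "\<exists>U V. openin TG U \<and> openin TN V \<and> fst p \<in> U \<and> snd p \<in> V \<and>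
        U \<times> V \<subseteq> {p \<in> topspace (prod_topology TG TN). (case p of (g, r) \<Rightarrow> act g r) \<in> W}"
      using gr p by (intro exI[of _ ?U] exI[of _ ?V]) auto
  qed
qed

lemma NO_flow: "flow G TG TN act"
  unfolding flow_def
  using TG_topological_group TN_compact TN_Hausdorff act_group_action act_continuous by simp

lemma orbit_meets_open:
  assumes r0: "r0 \<in> N" and W: "openin TN W" "W \<noteq> {}"
  shows "\<exists>g\<in>carrier G. act g r0 \<in> W"
proof -
  obtain r where r: "r \<in> W" using W by blast
  from openin_TN_nhd[OF W(1) r] obtain F where F: "finite F" "F \<subseteq> P \<times> P"
    and FW: "\<forall>s\<in>N. (\<forall>x\<in>F. s x = r x) \<longrightarrow> s \<in> W"
    by (elim exE conjE) (rule that)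
  have rN: "r \<in> N" using W(1) r openin_subset[of TN W] by auto
  have nat: "natural r" "natural r0" using rN r0 NO_iff by auto
  have "finite (fst ` F \<union> snd ` F)" "fst ` F \<union> snd ` F \<subseteq> P" using F by auto
  from dense_orbit[OF nat this] obtain g where g: "g \<in> carrier G"
    "\<forall>x\<in>fst ` F \<union> snd ` F. \<forall>y\<in>fst ` F \<union> snd ` F. r (x, y) \<longleftrightarrow> r0 (g x, g y)" by blast
  have "act (inv\<^bsub>G\<^esub> g) r0 \<in> W"
  proof (rule FW[THEN bspec, THEN mp])
    show "act (inv\<^bsub>G\<^esub> g) r0 \<in> N" using g(1) r0 by (intro act_closed) auto
    show "\<forall>q\<in>F. act (inv\<^bsub>G\<^esub> g) r0 q = r q"
    proof
      fix q assume q: "q \<in> F"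
      obtain x y where xy: "q = (x, y)" by (cases q)
      have xyP: "x \<in> P" "y \<in> P" using q xy F(2) by auto
      have mem: "x \<in> fst ` F \<union> snd ` F" "y \<in> fst ` F \<union> snd ` F" using q xy by force+
      have "act (inv\<^bsub>G\<^esub> g) r0 (x, y) = r0 (g x, g y)"
        using act_apply[OF r0 xyP, of "inv\<^bsub>G\<^esub> g"] group.inv_inv[OF group_G g(1)] by simp
      then show "act (inv\<^bsub>G\<^esub> g) r0 q = r q" using g(2) mem xy by simp
    qed
  qed
  then show ?thesis using g(1) by (intro bexI[of _ "inv\<^bsub>G\<^esub> g"]) auto
qed

text \<open>
  Every orbit is dense.
\<close>

theorem NO_minimal_flow: "minimal_flow G TG TN act"
  unfolding minimal_flow_def
proof (intro conjI allI impI)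
  show "flow G TG TN act" by (rule NO_flow)
  show "topspace TN \<noteq> {}" using N_nonempty by simp
  fix D assume D: "closedin TN D \<and> D \<noteq> {} \<and> (\<forall>g\<in>carrier G. act g ` D \<subseteq> D)"
  then obtain r0 where r0: "r0 \<in> D" by blast
  have DN: "D \<subseteq> N" using D closedin_subset[of TN D] by simp
  have "openin TN (N - D)" using D by (auto simp: closedin_def)
  then have "N - D = {}"
    using orbit_meets_open[of r0 "N - D"] r0 DN D by blast
  then show "D = topspace TN" using DN by simp
qed


section \<open>Universality\<close>

context
  fixes Y :: "'y topology" and \<psi>
  assumes Y: "flow G TG Y \<psi>"
begin

abbreviation "E \<equiv> topspace Y"

lemma Y_compact: "compact_space Y" and Y_Hausdorff: "Hausdorff_space Y"
  and Y_action: "group_action G E \<psi>"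
  and Y_continuous: "continuous_map (prod_topology TG Y) Y (\<lambda>(g, y). \<psi> g y)"
  using Y by (auto simp: flow_def)

lemma Y_closed: "g \<in> carrier G \<Longrightarrow> y \<in> E \<Longrightarrow> \<psi> g y \<in> E"
  using group_action.element_image[OF Y_action] by blast

lemma Y_mult: "g \<in> carrier G \<Longrightarrow> h \<in> carrier G \<Longrightarrow> y \<in> E \<Longrightarrow> \<psi> (g \<otimes>\<^bsub>G\<^esub> h) y = \<psi> g (\<psi> h y)"
  using group_action.composition_rule[OF Y_action] by blast

lemma Y_one: "y \<in> E \<Longrightarrow> \<psi> \<one>\<^bsub>G\<^esub> y = y"
  using group_action.id_eq_one[OF Y_action] by (metis restrict_apply')

lemma Y_map_continuous:
  assumes "g \<in> carrier G" shows "continuous_map Y Y (\<psi> g)"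
proof -
  have "continuous_map Y (prod_topology TG Y) (\<lambda>y. (g, y))"
    using assms by (intro continuous_map_pairedI) auto
  from continuous_map_compose[OF this Y_continuous] show ?thesis by (simp add: o_def)
qed

text \<open>
  Continuity of the action at the pairs of the neutral element and a point \<open>y\<close> gives a finite set for
  each \<open>y\<close>, and by compactness of \<open>Y\<close> finitely many of them suffice.
\<close>

lemma small_displacement:
  assumes f: "continuous_map Y euclideanreal f" and "0 < \<epsilon>"
  shows "\<exists>F. finite F \<and> F \<subseteq> P \<and>
    (\<forall>k\<in>carrier G. (\<forall>x\<in>F. k x = x) \<longrightarrow> (\<forall>y\<in>E. \<bar>f (\<psi> k y) - f y\<bar> < \<epsilon>))"
proof -
  have f\<psi>: "continuous_map (prod_topology TG Y) euclideanreal (\<lambda>p. f (case p of (g, y) \<Rightarrow> \<psi> g y))"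
    using continuous_map_compose[OF Y_continuous f] by (simp add: o_def)
  define Q where "Q y F V \<longleftrightarrow> finite F \<and> F \<subseteq> P \<and> openin Y V \<and> y \<in> V \<and>
      (\<forall>k\<in>carrier G. (\<forall>x\<in>F. k x = x) \<longrightarrow> (\<forall>z\<in>V. \<bar>f (\<psi> k z) - f y\<bar> < \<epsilon> / 2))" for y F V
  have "\<exists>F V. Q y F V" if y: "y \<in> E" for y
  proof -
    let ?W = "{p \<in> topspace (prod_topology TG Y). f (case p of (g, y) \<Rightarrow> \<psi> g y) \<in> ball (f y) (\<epsilon> / 2)}"
    have op: "openin (prod_topology TG Y) ?W"
      by (rule openin_continuous_map_preimage[OF f\<psi>]) simp
    have mem: "(\<one>\<^bsub>G\<^esub>, y) \<in> ?W" using y assms(2) by (simp add: Y_one)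
    from openin_prod_topology_alt[THEN iffD1, OF op, THEN spec, THEN spec, THEN mp, OF mem]
    obtain U V where UV: "openin TG U" "openin Y V" "\<one>\<^bsub>G\<^esub> \<in> U" "y \<in> V" "U \<times> V \<subseteq> ?W"
      by (elim exE conjE) (rule that)
    obtain F where F: "finite F" "F \<subseteq> P"
      and FU: "\<forall>k\<in>carrier G. (\<forall>x\<in>F. k x = \<one>\<^bsub>G\<^esub> x) \<longrightarrow> k \<in> U"
      using openin_TG_nhd[OF UV(1,3)] by (elim exE conjE) (rule that)
    have "\<bar>f (\<psi> k z) - f y\<bar> < \<epsilon> / 2" if k: "k \<in> carrier G" "\<forall>x\<in>F. k x = x" and z: "z \<in> V" for k z
    proof -
      have "\<forall>x\<in>F. k x = \<one>\<^bsub>G\<^esub> x" using k(2) F(2) G_one_apply by auto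
      then have "k \<in> U" using FU k(1) by blast
      then have "(k, z) \<in> ?W" using UV(5) z by blast
      then show ?thesis by (simp add: dist_real_def abs_minus_commute)
    qed
    then show ?thesis using F UV(2,4) unfolding Q_def by (intro exI[of _ F] exI[of _ V]) simp
  qed
  then obtain F V where FV: "\<And>y. y \<in> E \<Longrightarrow> Q y (F y) (V y)" by metis
  note FV' = FV[unfolded Q_def]
  have FV: "finite (F y)" "F y \<subseteq> P" "openin Y (V y)" "y \<in> V y" if "y \<in> E" for y
    using FV'[OF that] by simp_all
  have small: "\<bar>f (\<psi> k z) - f y\<bar> < \<epsilon> / 2"
    if "y \<in> E" "k \<in> carrier G" "\<forall>x\<in>F y. k x = x" "z \<in> V y" for y k z
    using FV'[OF that(1)] that(2-4) by blast
  have "\<exists>\<F>. finite \<F> \<and> \<F> \<subseteq> V ` E \<and> E \<subseteq> \<Union> \<F>"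
    by (rule compact_space_alt[THEN iffD1, OF Y_compact, rule_format]) (use FV in auto)
  then obtain E' where E': "finite E'" "E' \<subseteq> E" "E \<subseteq> \<Union> (V ` E')"
    by (metis finite_subset_image)
  show ?thesis
  proof (intro exI[of _ "\<Union>y\<in>E'. F y"] conjI ballI impI)
    show "finite (\<Union>y\<in>E'. F y)" using E' FV(1) by blast
    show "(\<Union>y\<in>E'. F y) \<subseteq> P" using E' FV(2) by blast
    fix k z assume k: "k \<in> carrier G" "\<forall>x\<in>\<Union>y\<in>E'. F y. k x = x" and z: "z \<in> E"
    obtain y where y: "y \<in> E'" "z \<in> V y" using E'(3) z by blast
    then have yE: "y \<in> E" using E'(2) by blast
    have "\<bar>f (\<psi> k z) - f y\<bar> < \<epsilon> / 2" using small[OF yE k(1) _ y(2)] k(2) y(1) by blast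
    moreover have "\<bar>f (\<psi> \<one>\<^bsub>G\<^esub> z) - f y\<bar> < \<epsilon> / 2"
      by (rule small[OF yE _ _ y(2)]) (use FV(2)[OF yE] G_one_apply in auto)
    then have "\<bar>f z - f y\<bar> < \<epsilon> / 2" by (simp add: Y_one[OF z])
    ultimately show "\<bar>f (\<psi> k z) - f z\<bar> < \<epsilon>" by linarith
  qed
qed

text \<open>
  For an adapted partition the value \<open>f (g\<inverse> y)\<close> depends, up to \<open>\<epsilon>\<close>, only on the restriction of
  \<open>g\<close> to the finite subalgebra, that is, on a copy of it.
\<close>

definition adapted :: "('y \<Rightarrow> real) \<Rightarrow> real \<Rightarrow> 'a set list \<Rightarrow> bool" where
  "adapted f \<epsilon> As \<longleftrightarrow> continuous_map Y (top_of_set {0..1}) f \<and> 0 < \<epsilon> \<and> part As \<and>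
     (\<forall>k\<in>carrier G. (\<forall>x\<in>span As. k x = x) \<longrightarrow> (\<forall>y\<in>E. \<bar>f (\<psi> k y) - f y\<bar> < \<epsilon>))"

lemma adapted_exists:
  assumes f: "continuous_map Y (top_of_set {0..1}) f" and "0 < \<epsilon>"
  shows "\<exists>As. adapted f \<epsilon> As"
proof -
  have "continuous_map Y euclideanreal f" using f by (rule continuous_map_into_fulltopology)
  from small_displacement[OF this assms(2)] obtain F where F: "finite F" "F \<subseteq> P"
    and FF: "\<forall>k\<in>carrier G. (\<forall>x\<in>F. k x = x) \<longrightarrow> (\<forall>y\<in>E. \<bar>f (\<psi> k y) - f y\<bar> < \<epsilon>)"
    by (elim exE conjE) (rule that)
  obtain As where As: "part As" "F \<subseteq> span As" using finite_subset_in_span[OF F] by blast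
  have "\<bar>f (\<psi> k y) - f y\<bar> < \<epsilon>" if "k \<in> carrier G" "\<forall>x\<in>span As. k x = x" "y \<in> E" for k y
  proof -
    have "\<forall>x\<in>F. k x = x" using that(2) As(2) by blast
    then show ?thesis using FF that(1,3) by blast
  qed
  then have "adapted f \<epsilon> As" using As(1) f assms(2) by (simp add: adapted_def)
  then show ?thesis by blast
qed

text \<open>
  The pairs for which two copies with the same induced ordering have almost the same colour. The
  bound is \<open>3 * \<epsilon>\<close> since \<open>\<epsilon>\<close> is lost within a colour class and another \<open>\<epsilon>\<close> for each of the two
  copies when \<open>g1\<close> and \<open>g2\<close> are replaced by fixed automorphisms with the same restrictions.
\<close>

definition same_order_close ::
  "('y \<Rightarrow> real) \<Rightarrow> real \<Rightarrow> 'a set list \<Rightarrow> ('a set set \<Rightarrow> 'a set set) \<Rightarrow> ('a set set \<Rightarrow> 'a set set) \<Rightarrow>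
     (('a set set \<times> 'a set set \<Rightarrow> bool) \<times> 'y) set" where
  "same_order_close f \<epsilon> As g1 g2 = {(r, y) \<in> N \<times> E.
     (\<forall>x\<in>span As. \<forall>z\<in>span As. r (g1 x, g1 z) \<longleftrightarrow> r (g2 x, g2 z)) \<longrightarrow>
       \<bar>f (\<psi> (inv\<^bsub>G\<^esub> g1) y) - f (\<psi> (inv\<^bsub>G\<^esub> g2) y)\<bar> \<le> 3 * \<epsilon>}"

lemma closedin_same_order_close:
  assumes ad: "adapted f \<epsilon> As" and g: "g1 \<in> carrier G" "g2 \<in> carrier G"
  shows "closedin (prod_topology TN Y) (same_order_close f \<epsilon> As g1 g2)"
proof -
  let ?S = "same_order_close f \<epsilon> As g1 g2"
  let ?d = "\<lambda>y. \<bar>f (\<psi> (inv\<^bsub>G\<^esub> g1) y) - f (\<psi> (inv\<^bsub>G\<^esub> g2) y)\<bar>"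
  have part: "part As" using ad by (simp add: adapted_def)
  have f: "continuous_map Y euclideanreal f"
    using ad unfolding adapted_def by (blast intro: continuous_map_into_fulltopology)
  have d: "continuous_map Y euclideanreal ?d"
    using continuous_map_compose[OF Y_map_continuous[OF G_inv_closed[OF g(1)]] f]
      continuous_map_compose[OF Y_map_continuous[OF G_inv_closed[OF g(2)]] f]
    by (intro continuous_map_real_abs continuous_map_diff) (simp_all add: o_def)
  have fin: "finite (span As)" and sub: "span As \<subseteq> P"
    using span_finite_subalgebra[OF part] by (auto simp: finite_subalgebra_def)
  let ?F = "(\<lambda>(x, z). (g1 x, g1 z)) ` (span As \<times> span As) \<union> (\<lambda>(x, z). (g2 x, g2 z)) ` (span As \<times> span As)"
  have F: "finite ?F" "?F \<subseteq> P \<times> P"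
    using fin sub G_closed[OF g(1)] G_closed[OF g(2)] by auto
  have "openin (prod_topology TN Y) (N \<times> E - ?S)"
    unfolding openin_prod_iff
  proof
    fix p assume p: "p \<in> N \<times> E - ?S"
    then obtain r y where ry: "p = (r, y)" "r \<in> N" "y \<in> E" by auto
    have same: "\<forall>x\<in>span As. \<forall>z\<in>span As. r (g1 x, g1 z) \<longleftrightarrow> r (g2 x, g2 z)" and far: "3 * \<epsilon> < ?d y"
      using p ry by (auto simp: same_order_close_def)
    let ?U = "{s \<in> N. \<forall>q\<in>?F. s q = r q}" and ?V = "{z \<in> E. ?d z \<in> {3 * \<epsilon><..}}"
    have "openin TN ?U" by (rule openin_TN_cylinder[OF F])
    moreover have "openin Y ?V" by (rule openin_continuous_map_preimage[OF d]) simp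
    moreover have "(s, z) \<in> N \<times> E - ?S" if s: "s \<in> ?U" and z: "z \<in> ?V" for s z
    proof -
      have "s (g1 x, g1 w) \<longleftrightarrow> s (g2 x, g2 w)" if xw: "x \<in> span As" "w \<in> span As" for x w
      proof -
        have "(g1 x, g1 w) \<in> ?F" "(g2 x, g2 w) \<in> ?F" using xw by force+
        then have "s (g1 x, g1 w) = r (g1 x, g1 w)" "s (g2 x, g2 w) = r (g2 x, g2 w)" using s by blast+
        then show ?thesis using same xw by simp
      qed
      then show ?thesis using s z by (auto simp: same_order_close_def not_le)
    qed
    ultimately show "\<exists>U V. openin TN U \<and> openin Y V \<and> fst p \<in> U \<and> snd p \<in> V \<and> U \<times> V \<subseteq> N \<times> E - ?S"
      using ry far by (intro exI[of _ ?U] exI[of _ ?V]) auto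
  qed
  moreover have "?S \<subseteq> N \<times> E" by (auto simp: same_order_close_def)
  ultimately show ?thesis by (simp add: closedin_def)
qed

text \<open>
  By compactness finitely many pairs \<open>(g1, g2)\<close> may be considered. All their copies of the
  subalgebra lie in one finite subalgebra, and the Ramsey property provides \<open>h\<close> such that moving a
  point of \<open>Z\<close> by the inverse of \<open>h\<close> makes the colours of these copies depend on their orderings only.
\<close>

lemma invariant_set_meets:
  assumes Z: "closedin (prod_topology TN Y) Z" "Z \<noteq> {}"
    and inv: "\<And>g r y. g \<in> carrier G \<Longrightarrow> (r, y) \<in> Z \<Longrightarrow> (act g r, \<psi> g y) \<in> Z"
    and ad: "adapted f \<epsilon> As"
  shows "\<exists>p\<in>Z. \<forall>g1\<in>carrier G. \<forall>g2\<in>carrier G. p \<in> same_order_close f \<epsilon> As g1 g2"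
proof -
  have ZNE: "Z \<subseteq> N \<times> E" using closedin_subset[OF Z(1)] by simp
  have part: "part As" and e0: "0 < \<epsilon>" using ad by (auto simp: adapted_def)
  have f01: "0 \<le> f y" "f y \<le> 1" if "y \<in> E" for y
  proof -
    have "f \<in> E \<rightarrow> {0..1}" using ad unfolding adapted_def continuous_map_def by auto
    then show "0 \<le> f y" "f y \<le> 1" using that by auto
  qed
  have fin: "finite (span As)" and sub: "span As \<subseteq> P"
    using span_finite_subalgebra[OF part] by (auto simp: finite_subalgebra_def)
  obtain r0 y0 where z0: "(r0, y0) \<in> Z" using Z(2) by auto
  then have r0: "r0 \<in> N" and y0: "y0 \<in> E" using ZNE by auto
  define rep where "rep g = (SOME k. k \<in> carrier G \<and> (\<forall>x\<in>span As. k x = g x))" for g :: "'a set set \<Rightarrow> 'a set set"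
  have rep: "rep g \<in> carrier G" "\<And>x. x \<in> span As \<Longrightarrow> rep g x = g x" if "g \<in> carrier G" for g
    using someI[of "\<lambda>k. k \<in> carrier G \<and> (\<forall>x\<in>span As. k x = g x)" g] that unfolding rep_def by auto
  have rep_cong: "rep g = rep g'" if "\<And>x. x \<in> span As \<Longrightarrow> g x = g' x" for g g'
    unfolding rep_def using that by (simp cong: ball_cong)
  define val where "val g = f (\<psi> (inv\<^bsub>G\<^esub> (rep g)) y0)" for g
  \<comment> \<open>the colour of \<open>g\<close> is the interval of length \<open>\<epsilon>\<close> that contains the value for the chosen
    automorphism with the same restriction\<close>
  define col where "col g = (if g \<in> carrier G then nat \<lfloor>val g / \<epsilon>\<rfloor> else 0)" for g
  have val01: "0 \<le> val g" "val g \<le> 1" if "g \<in> carrier G" for g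
    unfolding val_def using f01[OF Y_closed[OF G_inv_closed[OF rep(1)[OF that]] y0]] by auto
  have col_bound: "col g < Suc (nat \<lfloor>1 / \<epsilon>\<rfloor>)" for g
  proof (cases "g \<in> carrier G")
    case True
    have "val g / \<epsilon> \<le> 1 / \<epsilon>" using val01[OF True] e0 by (simp add: divide_right_mono)
    then show ?thesis using True by (simp add: col_def le_imp_less_Suc nat_mono floor_mono)
  qed (simp add: col_def)
  have col_inv: "col g = col g'"
    if "g \<in> carrier G" "g' \<in> carrier G" "\<And>x. x \<in> span As \<Longrightarrow> g x = g' x" for g g'
    using rep_cong[of g g'] that by (simp add: col_def val_def)
  have col_close: "\<bar>val g - val g'\<bar> \<le> \<epsilon>"
    if "g \<in> carrier G" "g' \<in> carrier G" "col g = col g'" for g g'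
  proof -
    have "0 \<le> val g / \<epsilon>" "0 \<le> val g' / \<epsilon>" using val01 that(1,2) e0 by simp_all
    then have "\<lfloor>val g / \<epsilon>\<rfloor> = \<lfloor>val g' / \<epsilon>\<rfloor>" using that by (simp add: col_def nat_eq_iff)
    then have "\<bar>val g / \<epsilon> - val g' / \<epsilon>\<bar> < 1" by linarith
    then have "\<bar>(val g - val g') / \<epsilon>\<bar> < 1" by (simp add: diff_divide_distrib)
    then show ?thesis using e0 by (simp add: abs_divide)
  qed
  have val_close: "\<bar>f (\<psi> (inv\<^bsub>G\<^esub> g) y0) - val g\<bar> < \<epsilon>" if g: "g \<in> carrier G" for g
  proof -
    note rg = rep(1)[OF g]
    define k where "k = inv\<^bsub>G\<^esub> g \<otimes>\<^bsub>G\<^esub> rep g"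
    have kG: "k \<in> carrier G" using g rg by (simp add: k_def)
    have "k x = x" if x: "x \<in> span As" for x
    proof -
      have "x \<in> P" using x sub by blast
      then show ?thesis unfolding k_def using g rg rep(2)[OF g x] by (simp add: G_mult_apply G_inv_left)
    qed
    then have "\<bar>f (\<psi> k (\<psi> (inv\<^bsub>G\<^esub> (rep g)) y0)) - f (\<psi> (inv\<^bsub>G\<^esub> (rep g)) y0)\<bar> < \<epsilon>"
      using ad kG Y_closed[OF G_inv_closed[OF rg] y0] unfolding adapted_def by blast
    moreover have "k \<otimes>\<^bsub>G\<^esub> inv\<^bsub>G\<^esub> (rep g) = inv\<^bsub>G\<^esub> g"
      unfolding k_def using g rg group.is_monoid[OF group_G]
      by (simp add: monoid.m_assoc group.r_inv[OF group_G])
    then have "\<psi> k (\<psi> (inv\<^bsub>G\<^esub> (rep g)) y0) = \<psi> (inv\<^bsub>G\<^esub> g) y0"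
      using Y_mult[OF kG G_inv_closed[OF rg] y0] by simp
    ultimately show ?thesis by (simp add: val_def)
  qed
  have nat: "natural r0" using r0 NO_iff by blast
  have comp: "compact_space (prod_topology TN Y)"
    by (simp add: compact_space_prod_topology TN_compact Y_compact)
  have "\<exists>p\<in>topspace (prod_topology TN Y). \<forall>q\<in>carrier G \<times> carrier G.
      p \<in> Z \<inter> (case q of (g1, g2) \<Rightarrow> same_order_close f \<epsilon> As g1 g2)"
  proof (rule compact_family_meets[OF comp])
    fix q assume "q \<in> carrier G \<times> carrier G"
    then show "closedin (prod_topology TN Y) (Z \<inter> (case q of (g1, g2) \<Rightarrow> same_order_close f \<epsilon> As g1 g2))"
      using Z(1) closedin_same_order_close[OF ad] by (cases q) auto
  next
    fix Q assume Q: "finite Q" "Q \<subseteq> carrier G \<times> carrier G"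
    define F where "F = (\<Union>g\<in>fst ` Q \<union> snd ` Q. g ` span As)"
    have "finite F" unfolding F_def using Q(1) fin by simp
    moreover have "F \<subseteq> P" unfolding F_def using Q(2) sub by fastforce
    ultimately obtain Ds where Ds: "part Ds" "F \<subseteq> span Ds" using finite_subset_in_span by blast
    have "\<exists>h\<in>carrier G. \<forall>g1\<in>carrier G. \<forall>g2\<in>carrier G.
        g1 ` span As \<subseteq> span Ds \<longrightarrow> g2 ` span As \<subseteq> span Ds \<longrightarrow>
        (\<forall>x\<in>span As. \<forall>y\<in>span As. r0 (h (g1 x), h (g1 y)) \<longleftrightarrow> r0 (h (g2 x), h (g2 y))) \<longrightarrow>
        col (h \<otimes>\<^bsub>G\<^esub> g1) = col (h \<otimes>\<^bsub>G\<^esub> g2)"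
    proof (rule ramsey_for_orders[OF nat part Ds(1) col_bound])
      fix g g' assume "g \<in> carrier G" "g' \<in> carrier G" "\<And>x. x \<in> span As \<Longrightarrow> g x = g' x"
      then show "col g = col g'" by (rule col_inv)
    qed
    then obtain h where h: "h \<in> carrier G"
      and hh: "\<forall>g1\<in>carrier G. \<forall>g2\<in>carrier G.
        g1 ` span As \<subseteq> span Ds \<longrightarrow> g2 ` span As \<subseteq> span Ds \<longrightarrow>
        (\<forall>x\<in>span As. \<forall>y\<in>span As. r0 (h (g1 x), h (g1 y)) \<longleftrightarrow> r0 (h (g2 x), h (g2 y))) \<longrightarrow>
        col (h \<otimes>\<^bsub>G\<^esub> g1) = col (h \<otimes>\<^bsub>G\<^esub> g2)"
      by (elim bexE) (rule that)
    let ?p = "(act (inv\<^bsub>G\<^esub> h) r0, \<psi> (inv\<^bsub>G\<^esub> h) y0)"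
    have pZ: "?p \<in> Z" using inv[OF G_inv_closed[OF h] z0] .
    have "?p \<in> same_order_close f \<epsilon> As g1 g2" if q: "(g1, g2) \<in> Q" for g1 g2
    proof -
      have g: "g1 \<in> carrier G" "g2 \<in> carrier G" using q Q(2) by auto
      have "g1 \<in> fst ` Q \<union> snd ` Q" "g2 \<in> fst ` Q \<union> snd ` Q" using q by force+
      then have im: "g1 ` span As \<subseteq> span Ds" "g2 ` span As \<subseteq> span Ds"
        using Ds(2) unfolding F_def by blast+
      have hg: "h \<otimes>\<^bsub>G\<^esub> g1 \<in> carrier G" "h \<otimes>\<^bsub>G\<^esub> g2 \<in> carrier G" using h g by auto
      have a: "act (inv\<^bsub>G\<^esub> h) r0 (u, w) = r0 (h u, h w)" if "u \<in> P" "w \<in> P" for u w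
        using act_apply[OF r0 that, of "inv\<^bsub>G\<^esub> h"] group.inv_inv[OF group_G h] by simp
      have b: "\<psi> (inv\<^bsub>G\<^esub> g) (\<psi> (inv\<^bsub>G\<^esub> h) y0) = \<psi> (inv\<^bsub>G\<^esub> (h \<otimes>\<^bsub>G\<^esub> g)) y0" if "g \<in> carrier G" for g
        using Y_mult[OF G_inv_closed[OF that] G_inv_closed[OF h] y0] group.inv_mult_group[OF group_G h that]
        by simp
      have "\<bar>f (\<psi> (inv\<^bsub>G\<^esub> g1) (\<psi> (inv\<^bsub>G\<^esub> h) y0)) - f (\<psi> (inv\<^bsub>G\<^esub> g2) (\<psi> (inv\<^bsub>G\<^esub> h) y0))\<bar> \<le> 3 * \<epsilon>"
        if ord: "\<forall>x\<in>span As. \<forall>z\<in>span As. act (inv\<^bsub>G\<^esub> h) r0 (g1 x, g1 z) \<longleftrightarrow> act (inv\<^bsub>G\<^esub> h) r0 (g2 x, g2 z)"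
      proof -
        have "\<forall>x\<in>span As. \<forall>z\<in>span As. r0 (h (g1 x), h (g1 z)) \<longleftrightarrow> r0 (h (g2 x), h (g2 z))"
        proof (intro ballI)
          fix x z assume xz: "x \<in> span As" "z \<in> span As"
          then have xzP: "x \<in> P" "z \<in> P" using sub by blast+
          show "r0 (h (g1 x), h (g1 z)) \<longleftrightarrow> r0 (h (g2 x), h (g2 z))"
            using ord[rule_format, OF xz] a G_closed[OF g(1)] G_closed[OF g(2)] xzP by simp
        qed
        then have "col (h \<otimes>\<^bsub>G\<^esub> g1) = col (h \<otimes>\<^bsub>G\<^esub> g2)" using hh g im by blast
        then have "\<bar>val (h \<otimes>\<^bsub>G\<^esub> g1) - val (h \<otimes>\<^bsub>G\<^esub> g2)\<bar> \<le> \<epsilon>" by (rule col_close[OF hg])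
        then show ?thesis unfolding b[OF g(1)] b[OF g(2)]
          using val_close[OF hg(1)] val_close[OF hg(2)] by linarith
      qed
      then show ?thesis using pZ ZNE by (auto simp: same_order_close_def)
    qed
    then show "\<exists>p\<in>topspace (prod_topology TN Y). \<forall>q\<in>Q.
      p \<in> Z \<inter> (case q of (g1, g2) \<Rightarrow> same_order_close f \<epsilon> As g1 g2)"
      using pZ ZNE by (intro bexI[of _ ?p]) auto
  qed
  then obtain p where p: "\<forall>q\<in>carrier G \<times> carrier G.
      p \<in> Z \<inter> (case q of (g1, g2) \<Rightarrow> same_order_close f \<epsilon> As g1 g2)" by blast
  have "p \<in> Z \<and> p \<in> same_order_close f \<epsilon> As g1 g2" if "g1 \<in> carrier G" "g2 \<in> carrier G" for g1 g2
    using p that by blast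
  then show ?thesis using G_one_closed by blast
qed

lemma same_order_close_invariant:
  assumes h: "h \<in> carrier G" and ad: "adapted f \<epsilon> As"
    and p: "\<forall>g1\<in>carrier G. \<forall>g2\<in>carrier G. (r, y) \<in> same_order_close f \<epsilon> As g1 g2"
    and g: "g1 \<in> carrier G" "g2 \<in> carrier G"
  shows "(act h r, \<psi> h y) \<in> same_order_close f \<epsilon> As g1 g2"
proof -
  have ry: "r \<in> N" "y \<in> E" using p g by (auto simp: same_order_close_def)
  have sub: "span As \<subseteq> P"
    using ad span_finite_subalgebra by (auto simp: finite_subalgebra_def adapted_def)
  let ?k = "\<lambda>g. inv\<^bsub>G\<^esub> h \<otimes>\<^bsub>G\<^esub> g"
  have k: "?k g1 \<in> carrier G" "?k g2 \<in> carrier G" using h g by auto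
  have a: "act h r (g x, g z) = r (?k g x, ?k g z)" if "g \<in> carrier G" "x \<in> span As" "z \<in> span As" for g x z
  proof -
    have "x \<in> P" "z \<in> P" using that sub by blast+
    then show ?thesis using that(1) h by (simp add: act_apply[OF ry(1)] G_mult_apply)
  qed
  have b: "\<psi> (inv\<^bsub>G\<^esub> g) (\<psi> h y) = \<psi> (inv\<^bsub>G\<^esub> (?k g)) y" if "g \<in> carrier G" for g
    using Y_mult[OF G_inv_closed[OF that] h ry(2)] h
      group.inv_mult_group[OF group_G G_inv_closed[OF h] that] group.inv_inv[OF group_G h] by simp
  have "(r, y) \<in> same_order_close f \<epsilon> As (?k g1) (?k g2)" using p k by blast
  then have "(\<forall>x\<in>span As. \<forall>z\<in>span As. act h r (g1 x, g1 z) \<longleftrightarrow> act h r (g2 x, g2 z)) \<longrightarrow>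
       \<bar>f (\<psi> (inv\<^bsub>G\<^esub> g1) (\<psi> h y)) - f (\<psi> (inv\<^bsub>G\<^esub> g2) (\<psi> h y))\<bar> \<le> 3 * \<epsilon>"
    unfolding same_order_close_def b[OF g(1)] b[OF g(2)] by (simp add: a[OF g(1)] a[OF g(2)])
  then show ?thesis
    using act_closed[OF h ry(1)] Y_closed[OF h ry(2)] by (simp add: same_order_close_def)
qed

text \<open>
  The sets for the various \<open>f\<close>, \<open>\<epsilon>\<close> and \<open>As\<close> are closed and invariant, and each of them meets
  every nonempty closed invariant set. So any finitely many of them have a common point, as they can be
  intersected one after the other.
\<close>

lemma coherent_point:
  assumes "E \<noteq> {}"
  shows "\<exists>r y. r \<in> N \<and> y \<in> E \<and> (\<forall>f \<epsilon> As. adapted f \<epsilon> As \<longrightarrow>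
    (\<forall>g1\<in>carrier G. \<forall>g2\<in>carrier G. (r, y) \<in> same_order_close f \<epsilon> As g1 g2))"
proof -
  let ?T = "prod_topology TN Y"
  define I where "I = {(f, \<epsilon>, As). adapted f \<epsilon> As}"
  define W where "W i = (case i of (f, \<epsilon>, As) \<Rightarrow> {p \<in> N \<times> E. \<forall>g1\<in>carrier G. \<forall>g2\<in>carrier G.
     p \<in> same_order_close f \<epsilon> As g1 g2})" for i
  have comp: "compact_space ?T"
    by (simp add: compact_space_prod_topology TN_compact Y_compact)
  have soc_sub: "same_order_close f \<epsilon> As g1 g2 \<subseteq> N \<times> E" for f \<epsilon> As g1 g2
    by (auto simp: same_order_close_def)
  have W_eq: "W (f, \<epsilon>, As) = (\<Inter>q\<in>carrier G \<times> carrier G. case q of (g1, g2) \<Rightarrow> same_order_close f \<epsilon> As g1 g2)"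
    for f \<epsilon> As
  proof (intro equalityI subsetI)
    fix p assume "p \<in> (\<Inter>q\<in>carrier G \<times> carrier G. case q of (g1, g2) \<Rightarrow> same_order_close f \<epsilon> As g1 g2)"
    then have "\<forall>g1\<in>carrier G. \<forall>g2\<in>carrier G. p \<in> same_order_close f \<epsilon> As g1 g2" by blast
    moreover from this have "p \<in> N \<times> E" using G_one_closed soc_sub by blast
    ultimately show "p \<in> W (f, \<epsilon>, As)" by (simp add: W_def)
  qed (auto simp: W_def)
  have Wcl: "closedin ?T (W i)" if i: "i \<in> I" for i
  proof -
    obtain f \<epsilon> As where i': "i = (f, \<epsilon>, As)" "adapted f \<epsilon> As" using i by (auto simp: I_def)
    have "carrier G \<times> carrier G \<noteq> {}" using G_one_closed by blast
    then show ?thesis unfolding i'(1) W_eq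
      using closedin_same_order_close[OF i'(2)] by (intro closedin_INT) auto
  qed
  have Winv: "(act h r, \<psi> h y) \<in> W i" if "h \<in> carrier G" "(r, y) \<in> W i" and iI: "i \<in> I" for h r y i
  proof -
    obtain f \<epsilon> As where i': "i = (f, \<epsilon>, As)" "adapted f \<epsilon> As" using iI by (auto simp: I_def)
    have p: "\<forall>g1\<in>carrier G. \<forall>g2\<in>carrier G. (r, y) \<in> same_order_close f \<epsilon> As g1 g2" "r \<in> N" "y \<in> E"
      using that(2) by (auto simp: i'(1) W_def)
    have "\<forall>g1\<in>carrier G. \<forall>g2\<in>carrier G. (act h r, \<psi> h y) \<in> same_order_close f \<epsilon> As g1 g2"
      by (intro ballI same_order_close_invariant[OF that(1) i'(2) p(1)])
    moreover have "(act h r, \<psi> h y) \<in> N \<times> E"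
      using act_closed[OF that(1) p(2)] Y_closed[OF that(1) p(3)] by simp
    ultimately show ?thesis unfolding i'(1) W_def prod.case by (intro CollectI conjI)
  qed
  have "\<exists>p\<in>topspace ?T. \<forall>i\<in>I. p \<in> W i"
  proof (rule compact_family_meets[OF comp Wcl])
    fix F assume "finite F" "F \<subseteq> I"
    then have "\<exists>Z. closedin ?T Z \<and> Z \<noteq> {} \<and> (\<forall>g\<in>carrier G. \<forall>(r, y)\<in>Z. (act g r, \<psi> g y) \<in> Z) \<and> (\<forall>i\<in>F. Z \<subseteq> W i)"
    proof (induction F rule: finite_induct)
      case empty
      have "closedin ?T (N \<times> E)" using closedin_topspace[of ?T] by simp
      then show ?case using assms N_nonempty act_closed Y_closed by (intro exI[of _ "N \<times> E"]) auto
    next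
      case (insert i F)
      then obtain Z where Z: "closedin ?T Z" "Z \<noteq> {}"
        "\<forall>g\<in>carrier G. \<forall>(r, y)\<in>Z. (act g r, \<psi> g y) \<in> Z" "\<forall>i\<in>F. Z \<subseteq> W i" by blast
      have iI: "i \<in> I" using insert by simp
      then obtain f \<epsilon> As where i': "i = (f, \<epsilon>, As)" "adapted f \<epsilon> As" by (auto simp: I_def)
      have "\<exists>p\<in>Z. \<forall>g1\<in>carrier G. \<forall>g2\<in>carrier G. p \<in> same_order_close f \<epsilon> As g1 g2"
        by (rule invariant_set_meets[OF Z(1,2) _ i'(2)]) (use Z(3) in blast)
      then have "Z \<inter> W i \<noteq> {}"
        using closedin_subset[OF Z(1)] unfolding i'(1) W_def by fastforce
      moreover have "closedin ?T (Z \<inter> W i)" using Z(1) Wcl[OF iI] by blast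
      moreover have "\<forall>g\<in>carrier G. \<forall>(r, y)\<in>Z \<inter> W i. (act g r, \<psi> g y) \<in> Z \<inter> W i"
      proof (intro ballI)
        fix g p assume g: "g \<in> carrier G" and p: "p \<in> Z \<inter> W i"
        obtain r y where ry: "p = (r, y)" by (cases p)
        have "(act g r, \<psi> g y) \<in> Z" using Z(3) g p ry by fastforce
        moreover have "(act g r, \<psi> g y) \<in> W i" using Winv[OF g _ iI] p ry by simp
        ultimately show "case p of (r, y) \<Rightarrow> (act g r, \<psi> g y) \<in> Z \<inter> W i" using ry by simp
      qed
      ultimately show ?case using Z(4) by (intro exI[of _ "Z \<inter> W i"]) auto
    qed
    then obtain Z where "closedin ?T Z" "Z \<noteq> {}" "\<forall>i\<in>F. Z \<subseteq> W i" by blast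
    then show "\<exists>p\<in>topspace ?T. \<forall>i\<in>F. p \<in> W i" using closedin_subset[of ?T Z] by blast
  qed
  then obtain r y where ry: "(r, y) \<in> N \<times> E" "\<forall>i\<in>I. (r, y) \<in> W i" by auto
  have "\<forall>g1\<in>carrier G. \<forall>g2\<in>carrier G. (r, y) \<in> same_order_close f \<epsilon> As g1 g2" if "adapted f \<epsilon> As" for f \<epsilon> As
  proof -
    have "(f, \<epsilon>, As) \<in> I" using that by (simp add: I_def)
    then have "(r, y) \<in> W (f, \<epsilon>, As)" using ry(2) by blast
    then show ?thesis by (simp add: W_def)
  qed
  then show ?thesis using ry(1) by blast
qed

text \<open>
  Suppose that \<open>f\<close> separates \<open>z1\<close> from \<open>z2\<close>. Both \<open>(s, z1)\<close> and \<open>(s, z2)\<close> are approximated by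
  points of the orbit whose first components agree with \<open>s\<close> on an adapted subalgebra. The values of
  \<open>f\<close> at the second components are then close to each other by coherence, and also close to \<open>f z1\<close> and
  \<open>f z2\<close>.
\<close>

lemma joint_orbit_closure_is_graph:
  assumes ry: "r \<in> N" "y \<in> E"
    and coh: "\<And>f \<epsilon> As g1 g2. adapted f \<epsilon> As \<Longrightarrow> g1 \<in> carrier G \<Longrightarrow> g2 \<in> carrier G \<Longrightarrow>
       (r, y) \<in> same_order_close f \<epsilon> As g1 g2"
    and Z: "Z = prod_topology TN Y closure_of ((\<lambda>g. (act g r, \<psi> g y)) ` carrier G)"
    and s: "(s, z1) \<in> Z" "(s, z2) \<in> Z"
  shows "z1 = z2"
proof (rule ccontr)
  assume ne: "z1 \<noteq> z2"
  have "Z \<subseteq> N \<times> E" using closure_of_subset_topspace[of "prod_topology TN Y"] unfolding Z by simp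
  then have sz: "s \<in> N" "z1 \<in> E" "z2 \<in> E" using s by auto
  have "completely_regular_space Y"
    using normal_imp_completely_regular_space compact_Hausdorff_or_regular_imp_normal_space Y_compact Y_Hausdorff
    by blast
  moreover have "closedin Y {z2}" using Y_Hausdorff sz(3) by (simp add: closedin_Hausdorff_sing_eq)
  ultimately obtain f where f: "continuous_map Y (top_of_set {0..1}) f" "f z1 = 0" "f ` {z2} \<subseteq> {1::real}"
    using sz ne unfolding completely_regular_space_def by (metis DiffI singletonD)
  have f2: "f z2 = 1" using f(3) by simp
  obtain As where ad: "adapted f (1/10) As" using adapted_exists[OF f(1), of "1/10"] by auto
  have f': "continuous_map Y euclideanreal f" using f(1) by (rule continuous_map_into_fulltopology)
  have fin: "finite (span As)" and sub: "span As \<subseteq> P"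
    using ad span_finite_subalgebra by (auto simp: finite_subalgebra_def adapted_def)
  let ?U = "{t \<in> N. \<forall>q\<in>span As \<times> span As. t q = s q}"
  have U: "openin TN ?U" using fin sub by (intro openin_TN_cylinder) auto
  have near: "\<exists>g\<in>carrier G. act g r \<in> ?U \<and> f (\<psi> g y) \<in> ball (f z) (1/4)"
    if z: "(s, z) \<in> Z" "z \<in> E" for z
  proof -
    let ?V = "{w \<in> E. f w \<in> ball (f z) (1/4)}"
    have V: "openin Y ?V" by (rule openin_continuous_map_preimage[OF f']) simp
    have "openin (prod_topology TN Y) (?U \<times> ?V)" using U V by (simp add: openin_prod_Times_iff)
    moreover have "(s, z) \<in> ?U \<times> ?V" using sz z by simp
    moreover have "\<forall>T. (s, z) \<in> T \<and> openin (prod_topology TN Y) T \<longrightarrow>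
        (\<exists>p. p \<in> (\<lambda>g. (act g r, \<psi> g y)) ` carrier G \<and> p \<in> T)"
      using z(1) unfolding Z in_closure_of by (rule conjunct2)
    ultimately obtain p where "p \<in> (\<lambda>g. (act g r, \<psi> g y)) ` carrier G" "p \<in> ?U \<times> ?V"
      by meson
    then obtain g where "g \<in> carrier G" "(act g r, \<psi> g y) \<in> ?U \<times> ?V" by (elim imageE) simp
    then show ?thesis by (intro bexI[of _ g]) simp_all
  qed
  obtain g1 where g1: "g1 \<in> carrier G" "act g1 r \<in> ?U" "f (\<psi> g1 y) \<in> ball (f z1) (1/4)"
    using near[OF s(1) sz(2)] by blast
  obtain g2 where g2: "g2 \<in> carrier G" "act g2 r \<in> ?U" "f (\<psi> g2 y) \<in> ball (f z2) (1/4)"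
    using near[OF s(2) sz(3)] by blast
  have "r ((inv\<^bsub>G\<^esub> g1) x, (inv\<^bsub>G\<^esub> g1) w) \<longleftrightarrow> r ((inv\<^bsub>G\<^esub> g2) x, (inv\<^bsub>G\<^esub> g2) w)"
    if xw: "x \<in> span As" "w \<in> span As" for x w
  proof -
    have "act g1 r (x, w) = s (x, w)" "act g2 r (x, w) = s (x, w)" using g1(2) g2(2) xw by blast+
    moreover have "x \<in> P" "w \<in> P" using xw sub by blast+
    ultimately show ?thesis by (simp add: act_apply[OF ry(1)])
  qed
  moreover have "(r, y) \<in> same_order_close f (1/10) As (inv\<^bsub>G\<^esub> g1) (inv\<^bsub>G\<^esub> g2)"
    using coh[OF ad] g1(1) g2(1) by simp
  ultimately have "\<bar>f (\<psi> g1 y) - f (\<psi> g2 y)\<bar> \<le> 3 * (1/10)"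
    using group.inv_inv[OF group_G g1(1)] group.inv_inv[OF group_G g2(1)]
    by (simp add: same_order_close_def)
  moreover have "\<bar>f (\<psi> g1 y)\<bar> < 1/4" "\<bar>f (\<psi> g2 y) - 1\<bar> < 1/4"
    using g1(3) g2(3) f(2) f2 by (simp_all add: dist_real_def abs_minus_commute)
  ultimately show False by linarith
qed

lemma NO_maps_onto:
  assumes min: "minimal_flow G TG Y \<psi>"
  shows "flow_factor G TN act Y \<psi>"
proof -
  let ?T = "prod_topology TN Y"
  have "E \<noteq> {}" using min by (simp add: minimal_flow_def)
  from coherent_point[OF this] obtain r y where ry: "r \<in> N" "y \<in> E"
    and coh: "\<forall>f \<epsilon> As. adapted f \<epsilon> As \<longrightarrow>
    (\<forall>g1\<in>carrier G. \<forall>g2\<in>carrier G. (r, y) \<in> same_order_close f \<epsilon> As g1 g2)" by (elim exE conjE) (rule that)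
  define Orb where "Orb = (\<lambda>g. (act g r, \<psi> g y)) ` carrier G"
  define Z where "Z = ?T closure_of Orb"
  have ON: "Orb \<subseteq> N \<times> E" unfolding Orb_def using act_closed Y_closed ry by auto
  have Zcl: "closedin ?T Z" unfolding Z_def by simp
  have OZ: "Orb \<subseteq> Z" unfolding Z_def using ON by (intro closure_of_subset) simp
  have ZNE: "Z \<subseteq> N \<times> E" using closedin_subset[OF Zcl] by simp
  have single: "z1 = z2" if "(s, z1) \<in> Z" "(s, z2) \<in> Z" for s z1 z2
    by (rule joint_orbit_closure_is_graph[OF ry _ _ that]) (use coh in \<open>auto simp: Z_def Orb_def\<close>)
  have Zinv: "(act h s, \<psi> h z) \<in> Z" if h: "h \<in> carrier G" and sz: "(s, z) \<in> Z" for h s z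
  proof -
    let ?h = "\<lambda>p. (act h (fst p), \<psi> h (snd p))"
    have "continuous_map TN TN (act h)"
    proof -
      have "continuous_map TN (prod_topology TG TN) (\<lambda>s. (h, s))"
        using h by (intro continuous_map_pairedI) auto
      from continuous_map_compose[OF this act_continuous] show ?thesis by (simp add: o_def)
    qed
    then have "continuous_map ?T ?T ?h"
      using Y_map_continuous[OF h]
      by (intro continuous_map_pairedI continuous_map_compose[OF continuous_map_fst, unfolded o_def]
          continuous_map_compose[OF continuous_map_snd, unfolded o_def])
    then have "?h ` Z \<subseteq> ?T closure_of (?h ` Orb)"
      unfolding Z_def by (rule continuous_map_image_closure_subset)
    also have "?h ` Orb \<subseteq> Orb"
    proof
      fix p assume "p \<in> ?h ` Orb"
      then obtain g where g: "g \<in> carrier G" "p = (act h (act g r), \<psi> h (\<psi> g y))" by (auto simp: Orb_def)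
      then have "p = (act (h \<otimes>\<^bsub>G\<^esub> g) r, \<psi> (h \<otimes>\<^bsub>G\<^esub> g) y)"
        using act_mult[OF h g(1) ry(1)] Y_mult[OF h g(1) ry(2)] by simp
      then show "p \<in> Orb" unfolding Orb_def using G_mult_closed[OF h g(1)] by blast
    qed
    then have "?T closure_of (?h ` Orb) \<subseteq> Z" unfolding Z_def by (rule closure_of_mono)
    finally show ?thesis using sz by force
  qed
  have total: "fst ` Z = N"
  proof
    show "fst ` Z \<subseteq> N" using ZNE by auto
    have "closedin TN (fst ` Z)"
      using closed_map_fst[OF Y_compact, of TN] Zcl by (simp add: closed_map_def)
    then have op: "openin TN (N - fst ` Z)" by (simp add: closedin_def)
    have "act g r \<in> fst ` Z" if "g \<in> carrier G" for g
      using OZ that unfolding Orb_def by force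
    then show "N \<subseteq> fst ` Z" using orbit_meets_open[OF ry(1) op] by blast
  qed
  define \<Phi> where "\<Phi> s = (THE z. (s, z) \<in> Z)" for s
  have \<Phi>: "(s, \<Phi> s) \<in> Z" if s: "s \<in> N" for s
  proof -
    obtain z where "(s, z) \<in> Z" using total s by force
    then show ?thesis unfolding \<Phi>_def using single by (metis theI)
  qed
  have \<Phi>_eq: "\<Phi> s = z" if "(s, z) \<in> Z" for s z
    using single[OF \<Phi> that] ZNE that by blast
  have \<Phi>E: "\<Phi> s \<in> E" if "s \<in> N" for s using \<Phi>[OF that] ZNE by blast
  have cont: "continuous_map TN Y \<Phi>"
    unfolding continuous_map_closedin
  proof (intro conjI allI impI)
    show "\<Phi> \<in> topspace TN \<rightarrow> E" using \<Phi>E by simp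
    fix D assume D: "closedin Y D"
    have "closedin ?T (N \<times> D)" using D closedin_topspace[of TN] by (simp add: closedin_prod_Times_iff)
    then have "closedin ?T (Z \<inter> (N \<times> D))" using Zcl by blast
    then have "closedin TN (fst ` (Z \<inter> (N \<times> D)))"
      using closed_map_fst[OF Y_compact, of TN] by (simp add: closed_map_def)
    moreover have "fst ` (Z \<inter> (N \<times> D)) = {s \<in> topspace TN. \<Phi> s \<in> D}"
    proof (intro equalityI subsetI)
      fix s assume "s \<in> fst ` (Z \<inter> (N \<times> D))"
      then obtain z where "(s, z) \<in> Z" "s \<in> N" "z \<in> D" by auto
      then show "s \<in> {s \<in> topspace TN. \<Phi> s \<in> D}" using \<Phi>_eq by simp
    next
      fix s assume "s \<in> {s \<in> topspace TN. \<Phi> s \<in> D}"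
      then have "(s, \<Phi> s) \<in> Z \<inter> (N \<times> D)" using \<Phi> by simp
      then show "s \<in> fst ` (Z \<inter> (N \<times> D))" by (metis fst_conv imageI)
    qed
    ultimately show "closedin TN {s \<in> topspace TN. \<Phi> s \<in> D}" by simp
  qed
  have equiv: "\<Phi> (act g s) = \<psi> g (\<Phi> s)" if "g \<in> carrier G" "s \<in> N" for g s
    using \<Phi>_eq[OF Zinv[OF that(1) \<Phi>[OF that(2)]]] .
  have "\<Phi> ` N = E"
  proof -
    have "compactin Y (\<Phi> ` topspace TN)"
      using TN_compact cont by (intro image_compactin) (auto simp: compact_space_def)
    then have "closedin Y (\<Phi> ` N)" using compactin_imp_closedin[OF Y_Hausdorff] by simp
    moreover have "\<Phi> ` N \<noteq> {}" using N_nonempty by simp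
    moreover have "\<forall>g\<in>carrier G. \<psi> g ` (\<Phi> ` N) \<subseteq> \<Phi> ` N"
    proof
      fix g assume that: "g \<in> carrier G"
      show "\<psi> g ` (\<Phi> ` N) \<subseteq> \<Phi> ` N"
    proof
      fix z assume "z \<in> \<psi> g ` (\<Phi> ` N)"
      then obtain s where s: "s \<in> N" "z = \<psi> g (\<Phi> s)" by blast
      then have "z = \<Phi> (act g s)" using equiv[OF that] by simp
      then show "z \<in> \<Phi> ` N" using act_closed[OF that s(1)] by blast
    qed
    qed
    ultimately show ?thesis
      by (intro min[unfolded minimal_flow_def, THEN conjunct2, THEN conjunct2, THEN spec, THEN mp] conjI)
  qed
  then show ?thesis unfolding flow_factor_def using cont equiv by (intro exI[of _ \<Phi>]) simp
qed

end

end

theorem theorem13: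
  fixes kap :: "'a rel" and lam :: "'b rel"
  assumes "Cinfinite lam" and "Cinfinite kap" and "lam \<le>o kap"
  shows "universal_minimal_flow TYPE('y) (Aut lam kap) (Aut_topology lam kap)
           (NO_topology lam kap) (NO_action lam kap)"
proof -
  interpret cardinal_quotient kap lam using assms by unfold_locales
  show ?thesis
    unfolding universal_minimal_flow_def
    using NO_minimal_flow NO_maps_onto by (auto simp: minimal_flow_def)
qed

end
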